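(* For every countable ordinal $\xi$, the space $X_{G_\xi}$ is reflexive.
   Context: General notation. $\mathbb N=\{1,2,\dots\}$, $(e_n)$ is the unit vector basis of $c_{00}(\mathbb N)$, $e_n^*$ the coordinate functionals; an element $f\in c_{00}(\mathbb N)$ acts on $c_{00}(\mathbb N)$ by $f(x)=\sum_n f(n)x(n)$. For an interval $E\subset\mathbb N$, $Ef$ is the restriction of $f$ to $E$. $f<g$ means $\max\operatorname{supp}f<\min\operatorname{supp}g$. Schreier families. $\mathcal S_0=\{\{n\}:n\in\mathbb N\}\cup\{\emptyset\}$; $\mathcal S_{\xi+1}=\{F_1\cup\dots\cup F_m: m\in\mathbb N,\ F_i\in\mathcal S_\xi,\ m\le F_1<\dots<F_m\}$; for limit $\xi<\omega_1$ fix $\xi_n\nearrow\xi$ and set $\mathcal S_\xi=\{F: F\in\mathcal S_{\xi_n}\text{ and }n\le F\text{ for some }n\}$. The set $G_\xi$. Fix $\xi<\omega_1$. Let $m_1=2^5$, $m_{j+1}=m_j^5$, $n_1=2^6$, $n_{j+1}=(2n_j)^{s_j}$ where $2^{s_j}=m_{j+1}^3$. Put $G_0=\{\pm e_n^*:n\in\mathbb N\}$ and, for $j\in\mathbb N$, $G_1^j=\{m_{2j-1}^{-2}\sum_{i\in B}\varepsilon_ie_i^*: B\subset\mathbb N,\ 1\le\#B\le n_{2j-1},\ \varepsilon_i\in\{-1,1\}\}$, $G_1=\bigcup_jG_1^j$; for $f\in G_1^j$ put $\operatorname{ind}(f)=j$. Let $\mathcal U$ be the set of finite sequences $(f_1,\dots,f_d)$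 with $f_1<\dots<f_d$, $f_i\in G_1^{j_i}$, $j_1<\dots<j_d$. Fix a partition $\mathbb N=M_1\cup M_2$ into infinite disjoint sets and an injective map $\sigma_1:\mathcal U\to M_2$ with $\sigma_1(f_1,\dots,f_{i+1})>\sigma_1(f_1,\dots,f_i)$ always. A special sequence is $(f_1,\dots,f_d)\in\mathcal U$ such that $\{\min\operatorname{supp}f_i:i\le d\}\in\mathcal S_\xi$, $f_1\in G_1^{j_1}$ with $j_1\in M_1$, and $f_{i+1}\in G_1^{\sigma_1(f_1,\dots,f_i)}$ for $1\le i<d$. Put $G_{sp}=\{E\sum_{i=1}^d\varepsilon_if_i:(f_1,\dots,f_d)\text{ special},\ \varepsilon_i\in\{-1,1\},\ E\text{ an interval}\}$, and for $\phi=E\sum\varepsilon_if_i\in G_{sp}$ put $\operatorname{ind}(\phi)=\{\operatorname{ind}(f_i):Ef_i\neq0\}$ (for $\phi\in G_1^j$, $\operatorname{ind}(\phi)$ is identified with $\{j\}$). Put $G_{\ell_2}=\{\sum_{i=1}^da_i\phi_i: d\in\mathbb N,\ a_i\in\mathbb Q,\ \sum a_i^2\le1,\ \phi_i\in G_{sp}\cup G_1,\ (\operatorname{ind}\phi_i)_{i=1}^d\text{ pairwise disjoint}\}$ and $G_\xi=G_0\cup G_1\cup G_{sp}\cup G_{\ell_2}$. Finally $\|x\|_{G_\xi}=\sup\{\phi(x):\phi\in G_\xi\}$ for $x\in c_{00}(\mathbb N)$ and $X_{G_\xi}$ is the completion of $(c_{00}(\mathbb N),\|\cdot\|_{G_\xi})$.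 *)

theory Defs
  imports
    "HOL-Analysis.Analysis"
    "HOL-Analysis.Finite_Function_Topology"
    "HOL-Library.Countable_Set_Type"
begin

section \<open>Countable ordinals\<close>

text \<open>A concrete copy of \<open>\<omega>\<^sub>1\<close>: an uncountable well-order (on the cardinal successor of
  \<open>\<omega>\<close>) all of whose proper initial segments are countable, so that its elements, in order,
  represent exactly the countable ordinals.\<close>

typedef countable_ordinal = "Field (cardSuc natLeq)"
proof -
  have "infinite (Field (cardSuc natLeq))"
    using cardSuc_finite[OF natLeq_Card_order] by (simp add: Field_natLeq)
  then show ?thesis
    by (metis finite.emptyI ex_in_conv)
qed

lemma Well_order_cardSuc_natLeq: "Well_order (cardSuc natLeq)"
  using cardSuc_Card_order[OF natLeq_Card_order] card_order_on_well_order_on by blast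

instantiation countable_ordinal :: wellorder
begin

definition less_eq_countable_ordinal :: "countable_ordinal \<Rightarrow> countable_ordinal \<Rightarrow> bool" where
  "\<xi> \<le> \<eta> \<longleftrightarrow> (Rep_countable_ordinal \<xi>, Rep_countable_ordinal \<eta>) \<in> cardSuc natLeq"

definition less_countable_ordinal :: "countable_ordinal \<Rightarrow> countable_ordinal \<Rightarrow> bool" where
  "\<xi> < \<eta> \<longleftrightarrow> \<xi> \<le> \<eta> \<and> \<xi> \<noteq> (\<eta> :: countable_ordinal)"

instance
proof -
  let ?r = "cardSuc natLeq"
  have lin: "refl_on (Field ?r) ?r" "trans ?r" "antisym ?r" "total_on (Field ?r) ?r"
    and wf: "wf (?r - Id)"
    using Well_order_cardSuc_natLeq
    by (auto simp: well_order_on_def linear_order_on_def partial_order_on_def preorder_on_def)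
  have antisym: "x = y" if "x \<le> y" "y \<le> x" for x y :: countable_ordinal
    using that lin(3) unfolding less_eq_countable_ordinal_def antisym_def
    by (metis Rep_countable_ordinal_inject)
  show "OFCLASS(countable_ordinal, wellorder_class)"
  proof intro_classes
    fix x y z :: countable_ordinal
    show "(x < y) = (x \<le> y \<and> \<not> y \<le> x)"
      using antisym by (metis less_countable_ordinal_def)
    show "x \<le> x"
      using lin(1) Rep_countable_ordinal unfolding less_eq_countable_ordinal_def
      by (metis refl_onD)
    show "x \<le> y \<Longrightarrow> y \<le> z \<Longrightarrow> x \<le> z"
      using lin(2) unfolding less_eq_countable_ordinal_def by (meson transD)
    show "x \<le> y \<Longrightarrow> y \<le> x \<Longrightarrow> x = y"
      by (rule antisym)
    show "x \<le> y \<or> y \<le> x"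
      using lin(4) Rep_countable_ordinal \<open>x \<le> x\<close> unfolding less_eq_countable_ordinal_def total_on_def
      by metis
  next
    fix P :: "countable_ordinal \<Rightarrow> bool" and a :: countable_ordinal
    assume step: "\<And>x. (\<And>y. y < x \<Longrightarrow> P y) \<Longrightarrow> P x"
    have "wf (inv_image (?r - Id) Rep_countable_ordinal)"
      using wf by (rule wf_inv_image)
    then show "P a"
      by (induction a rule: wf_induct_rule)
        (auto simp: less_countable_ordinal_def less_eq_countable_ordinal_def
          Rep_countable_ordinal_inject intro: step)
  qed
qed

end

lemma countable_lessThan_countable_ordinal:
  includes cardinal_syntax
  shows "countable {..< \<xi> :: countable_ordinal}"
proof -
  let ?r = "cardSuc natLeq" and ?x = "Rep_countable_ordinal \<xi>"
  have "|underS ?r ?x| <o ?r"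
    using card_of_underS[OF cardSuc_Card_order[OF natLeq_Card_order] Rep_countable_ordinal] .
  then have "|underS ?r ?x| \<le>o natLeq"
    using cardSuc_ordLeq_ordLess[OF natLeq_Card_order card_of_Card_order] by blast
  then have "countable (underS ?r ?x)"
    by (simp add: countable_card_le_natLeq)
  moreover have "Rep_countable_ordinal ` {..< \<xi>} \<subseteq> underS ?r ?x"
    by (auto simp: underS_def less_countable_ordinal_def less_eq_countable_ordinal_def
        Rep_countable_ordinal_inject)
  ultimately have "countable (Rep_countable_ordinal ` {..< \<xi>})"
    by (rule countable_subset[rotated])
  then show ?thesis
    by (rule countable_image_inj_on) (simp add: inj_on_def Rep_countable_ordinal_inject)
qed

lemma uncountable_UNIV_countable_ordinal:
  includes cardinal_syntax
  shows "uncountable (UNIV :: countable_ordinal set)"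
proof
  assume "countable (UNIV :: countable_ordinal set)"
  then have "countable (Field (cardSuc natLeq))"
    by (metis countable_image type_definition.Rep_range type_definition_countable_ordinal)
  then have "|Field (cardSuc natLeq)| \<le>o natLeq"
    by (simp add: countable_card_le_natLeq)
  moreover have "|Field (cardSuc natLeq)| =o cardSuc natLeq"
    using card_of_Field_ordIso cardSuc_Card_order natLeq_Card_order by blast
  ultimately have "cardSuc natLeq \<le>o natLeq"
    using ordIso_ordLeq_trans ordIso_symmetric by blast
  then show False
    using cardSuc_greater[OF natLeq_Card_order] not_ordLess_ordLeq by blast
qed

definition is_zero_ord :: "'o::wellorder \<Rightarrow> bool" where
  "is_zero_ord \<xi> \<longleftrightarrow> (\<forall>\<eta>. \<xi> \<le> \<eta>)"

definition is_succ_ord :: "'o::wellorder \<Rightarrow> 'o \<Rightarrow> bool" where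
  "is_succ_ord \<eta> \<xi> \<longleftrightarrow> \<eta> < \<xi> \<and> (\<nexists>\<zeta>. \<eta> < \<zeta> \<and> \<zeta> < \<xi>)"

definition is_limit_ord :: "'o::wellorder \<Rightarrow> bool" where
  "is_limit_ord \<xi> \<longleftrightarrow> \<not> is_zero_ord \<xi> \<and> (\<nexists>\<eta>. is_succ_ord \<eta> \<xi>)"


section \<open>Schreier families\<close>

text \<open>Throughout, \<open>\<nat> = {1, 2, \<dots>}\<close> is rendered as the set \<open>{1..}\<close> of type \<^typ>\<open>nat\<close>.
  A choice of sequences \<open>\<xi>\<^sub>n \<nearrow> \<xi>\<close> is a function \<open>fs\<close>, with \<open>fs \<xi> n\<close> relevant
  only for limit \<open>\<xi>\<close> and \<open>n \<ge> 1\<close>.\<close>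

definition fundamental_sequences :: "(countable_ordinal \<Rightarrow> nat \<Rightarrow> countable_ordinal) \<Rightarrow> bool" where
  "fundamental_sequences fs \<longleftrightarrow>
     (\<forall>\<xi>. is_limit_ord \<xi> \<longrightarrow>
        strict_mono_on {1..} (fs \<xi>) \<and> (\<forall>n\<ge>1. fs \<xi> n < \<xi>) \<and> (\<forall>\<eta><\<xi>. \<exists>n\<ge>1. \<eta> < fs \<xi> n))"

text \<open>The families are given by transfinite recursion; as every rule for \<open>\<xi>\<close> refers only to
  families of smaller index, this is the same as the following inductive definition.
  The sets \<open>F\<^sub>i\<close> may be empty, so \<open>m \<le> F\<^sub>1 < \<dots> < F\<^sub>m\<close> is required of all \<open>F\<^sub>i\<close>
  (and not just of \<open>F\<^sub>1\<close> and of consecutive pairs, which would be vacuous for empty sets).\<close>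

inductive schreier ::
  "(countable_ordinal \<Rightarrow> nat \<Rightarrow> countable_ordinal) \<Rightarrow> countable_ordinal \<Rightarrow> nat set \<Rightarrow> bool"
  for fs where
  zero_empty: "is_zero_ord \<xi> \<Longrightarrow> schreier fs \<xi> {}"
| zero_single: "is_zero_ord \<xi> \<Longrightarrow> n \<ge> 1 \<Longrightarrow> schreier fs \<xi> {n}"
| succ: "is_succ_ord \<eta> \<xi> \<Longrightarrow> length Fs \<ge> 1 \<Longrightarrow> (\<forall>F\<in>set Fs. schreier fs \<eta> F) \<Longrightarrow>
    (\<forall>F\<in>set Fs. \<forall>a\<in>F. length Fs \<le> a) \<Longrightarrow>
    sorted_wrt (\<lambda>A B. \<forall>a\<in>A. \<forall>b\<in>B. a < b) Fs \<Longrightarrow> schreier fs \<xi> (\<Union>(set Fs))"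
| limit: "is_limit_ord \<xi> \<Longrightarrow> n \<ge> 1 \<Longrightarrow> schreier fs (fs \<xi> n) F \<Longrightarrow> (\<forall>a\<in>F. n \<le> a) \<Longrightarrow>
    schreier fs \<xi> F"


section \<open>Finitely supported sequences\<close>

definition c00 :: "(nat \<Rightarrow>\<^sub>0 real) set" where
  "c00 = {x. Poly_Mapping.keys x \<subseteq> {1..}}"

definition pairing :: "(nat \<Rightarrow>\<^sub>0 real) \<Rightarrow> (nat \<Rightarrow>\<^sub>0 real) \<Rightarrow> real" where
  "pairing f x = (\<Sum>n\<in>Poly_Mapping.keys f. Poly_Mapping.lookup f n * Poly_Mapping.lookup x n)"

lift_definition restr :: "nat set \<Rightarrow> (nat \<Rightarrow>\<^sub>0 real) \<Rightarrow> (nat \<Rightarrow>\<^sub>0 real)" is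
  "\<lambda>E f n. if n \<in> E then f n else 0"
  by (rule finite_subset[of _ "{n. _ n \<noteq> 0}"]) auto

definition interval :: "nat set \<Rightarrow> bool" where
  "interval E \<longleftrightarrow> E \<subseteq> {1..} \<and> (\<forall>a\<in>E. \<forall>b\<in>E. {a..b} \<subseteq> E)"

definition block_less :: "(nat \<Rightarrow>\<^sub>0 real) \<Rightarrow> (nat \<Rightarrow>\<^sub>0 real) \<Rightarrow> bool" where
  "block_less f g \<longleftrightarrow> Max (Poly_Mapping.keys f) < Min (Poly_Mapping.keys g)"


section \<open>The norming set\<close>

text \<open>The sequences start at index \<open>1\<close>; the values at \<open>0\<close> are never used.\<close>

primrec m_seq :: "nat \<Rightarrow> nat" where
  "m_seq 0 = 2"
| "m_seq (Suc j) = m_seq j ^ 5"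

definition s_seq :: "nat \<Rightarrow> nat" where
  "s_seq j = (THE s. 2 ^ s = m_seq (j + 1) ^ 3)"

fun n_seq :: "nat \<Rightarrow> nat" where
  "n_seq 0 = 0"
| "n_seq (Suc 0) = 2 ^ 6"
| "n_seq (Suc (Suc j)) = (2 * n_seq (Suc j)) ^ s_seq (Suc j)"

lemma m_seq_1: "m_seq 1 = 2 ^ 5"
  by simp

lemma m_seq_eq: "m_seq j = 2 ^ (5 ^ j)"
  by (induction j) (simp_all add: power_mult[symmetric] mult.commute)

lemma s_seq_eq: "s_seq j = 3 * 5 ^ (j + 1)"
  unfolding s_seq_def m_seq_eq power_mult[symmetric]
  by (rule the_equality) (simp_all add: mult.commute)

lemma two_power_s_seq: "2 ^ s_seq j = m_seq (j + 1) ^ 3"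
  by (simp only: s_seq_eq m_seq_eq power_mult[symmetric] mult.commute)

definition G0 :: "(nat \<Rightarrow>\<^sub>0 real) set" where
  "G0 = {Poly_Mapping.single n e |n e. n \<ge> 1 \<and> e \<in> {-1, 1}}"

definition G1_level :: "nat \<Rightarrow> (nat \<Rightarrow>\<^sub>0 real) set" where
  "G1_level j =
     {(1 / real (m_seq (2 * j - 1)) ^ 2) *\<^sub>R (\<Sum>i\<in>B. Poly_Mapping.single i (\<epsilon> i)) |B \<epsilon>.
        finite B \<and> B \<subseteq> {1..} \<and> 1 \<le> card B \<and> card B \<le> n_seq (2 * j - 1) \<and>
        (\<forall>i\<in>B. \<epsilon> i \<in> {-1, 1})}"

definition G1 :: "(nat \<Rightarrow>\<^sub>0 real) set" where
  "G1 = (\<Union>j\<in>{1..}. G1_level j)"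

definition ind_G1 :: "(nat \<Rightarrow>\<^sub>0 real) \<Rightarrow> nat" where
  "ind_G1 f = (THE j. j \<ge> 1 \<and> f \<in> G1_level j)"

definition U_seqs :: "(nat \<Rightarrow>\<^sub>0 real) list set" where
  "U_seqs = {gs. gs \<noteq> [] \<and> sorted_wrt block_less gs \<and>
     (\<exists>js. length js = length gs \<and> sorted_wrt (<) js \<and>
        (\<forall>i<length gs. js ! i \<ge> 1 \<and> gs ! i \<in> G1_level (js ! i)))}"

definition partition_of_naturals :: "nat set \<Rightarrow> nat set \<Rightarrow> bool" where
  "partition_of_naturals M1 M2 \<longleftrightarrow>
     M1 \<union> M2 = {1..} \<and> M1 \<inter> M2 = {} \<and> infinite M1 \<and> infinite M2"

definition coding_function :: "nat set \<Rightarrow> ((nat \<Rightarrow>\<^sub>0 real) list \<Rightarrow> nat) \<Rightarrow> bool" where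
  "coding_function M2 \<sigma> \<longleftrightarrow>
     \<sigma> ` U_seqs \<subseteq> M2 \<and> inj_on \<sigma> U_seqs \<and>
     (\<forall>gs f. gs \<noteq> [] \<longrightarrow> gs @ [f] \<in> U_seqs \<longrightarrow> \<sigma> gs < \<sigma> (gs @ [f]))"

text \<open>Lists are indexed from \<open>0\<close>: \<open>gs ! i\<close> is \<open>f\<^bsub>i+1\<^esub>\<close> and
  \<open>take i gs\<close> is \<open>(f\<^sub>1, \<dots>, f\<^sub>i)\<close>.\<close>

definition special_sequence ::
  "(countable_ordinal \<Rightarrow> nat \<Rightarrow> countable_ordinal) \<Rightarrow> nat set \<Rightarrow> ((nat \<Rightarrow>\<^sub>0 real) list \<Rightarrow> nat) \<Rightarrow>
   countable_ordinal \<Rightarrow> (nat \<Rightarrow>\<^sub>0 real) list \<Rightarrow> bool" where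
  "special_sequence fs M1 \<sigma> \<xi> gs \<longleftrightarrow>
     gs \<in> U_seqs \<and>
     schreier fs \<xi> ((\<lambda>f. Min (Poly_Mapping.keys f)) ` set gs) \<and>
     (\<exists>j\<in>M1. gs ! 0 \<in> G1_level j) \<and>
     (\<forall>i. 1 \<le> i \<and> i < length gs \<longrightarrow> gs ! i \<in> G1_level (\<sigma> (take i gs)))"

text \<open>\<open>sp_with_ind fs M1 \<sigma> \<xi> \<phi> I\<close>: \<open>\<phi>\<close> is \<open>E (\<Sum>\<^sub>i \<epsilon>\<^sub>i f\<^sub>i)\<close> for some special sequence, signs and
  interval, and \<open>I\<close> is the set \<open>ind(\<phi>)\<close> computed from this representation. (As \<open>E f\<^sub>i\<close> determines
  \<open>ind(f\<^sub>i)\<close> when it is nonzero, \<open>I\<close> is in fact determined by \<open>\<phi>\<close>.)\<close>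

definition sp_with_ind ::
  "(countable_ordinal \<Rightarrow> nat \<Rightarrow> countable_ordinal) \<Rightarrow> nat set \<Rightarrow> ((nat \<Rightarrow>\<^sub>0 real) list \<Rightarrow> nat) \<Rightarrow>
   countable_ordinal \<Rightarrow> (nat \<Rightarrow>\<^sub>0 real) \<Rightarrow> nat set \<Rightarrow> bool" where
  "sp_with_ind fs M1 \<sigma> \<xi> \<phi> I \<longleftrightarrow>
     (\<exists>gs \<epsilon> E. special_sequence fs M1 \<sigma> \<xi> gs \<and> interval E \<and>
        (\<forall>i<length gs. \<epsilon> i \<in> {-1, 1}) \<and>
        \<phi> = restr E (\<Sum>i<length gs. \<epsilon> i *\<^sub>R (gs ! i)) \<and>
        I = {ind_G1 f |f. f \<in> set gs \<and> restr E f \<noteq> 0})"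

definition Gsp ::
  "(countable_ordinal \<Rightarrow> nat \<Rightarrow> countable_ordinal) \<Rightarrow> nat set \<Rightarrow> ((nat \<Rightarrow>\<^sub>0 real) list \<Rightarrow> nat) \<Rightarrow>
   countable_ordinal \<Rightarrow> (nat \<Rightarrow>\<^sub>0 real) set" where
  "Gsp fs M1 \<sigma> \<xi> = {\<phi>. \<exists>I. sp_with_ind fs M1 \<sigma> \<xi> \<phi> I}"

definition has_ind ::
  "(countable_ordinal \<Rightarrow> nat \<Rightarrow> countable_ordinal) \<Rightarrow> nat set \<Rightarrow> ((nat \<Rightarrow>\<^sub>0 real) list \<Rightarrow> nat) \<Rightarrow>
   countable_ordinal \<Rightarrow> (nat \<Rightarrow>\<^sub>0 real) \<Rightarrow> nat set \<Rightarrow> bool" where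
  "has_ind fs M1 \<sigma> \<xi> \<phi> I \<longleftrightarrow>
     sp_with_ind fs M1 \<sigma> \<xi> \<phi> I \<or> (\<phi> \<in> G1 \<and> I = {ind_G1 \<phi>})"

definition Gl2 ::
  "(countable_ordinal \<Rightarrow> nat \<Rightarrow> countable_ordinal) \<Rightarrow> nat set \<Rightarrow> ((nat \<Rightarrow>\<^sub>0 real) list \<Rightarrow> nat) \<Rightarrow>
   countable_ordinal \<Rightarrow> (nat \<Rightarrow>\<^sub>0 real) set" where
  "Gl2 fs M1 \<sigma> \<xi> =
     {(\<Sum>i=1..d. a i *\<^sub>R \<phi> i) |(d :: nat) a \<phi>.
        1 \<le> d \<and> (\<forall>i\<in>{1..d}. a i \<in> \<rat>) \<and> (\<Sum>i=1..d. (a i)\<^sup>2) \<le> 1 \<and>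
        (\<exists>I. (\<forall>i\<in>{1..d}. has_ind fs M1 \<sigma> \<xi> (\<phi> i) (I i)) \<and> disjoint_family_on I {1..d})}"

definition G_xi ::
  "(countable_ordinal \<Rightarrow> nat \<Rightarrow> countable_ordinal) \<Rightarrow> nat set \<Rightarrow> ((nat \<Rightarrow>\<^sub>0 real) list \<Rightarrow> nat) \<Rightarrow>
   countable_ordinal \<Rightarrow> (nat \<Rightarrow>\<^sub>0 real) set" where
  "G_xi fs M1 \<sigma> \<xi> = G0 \<union> G1 \<union> Gsp fs M1 \<sigma> \<xi> \<union> Gl2 fs M1 \<sigma> \<xi>"

definition norm_G :: "(nat \<Rightarrow>\<^sub>0 real) set \<Rightarrow> (nat \<Rightarrow>\<^sub>0 real) \<Rightarrow> real" where
  "norm_G G x = (SUP \<phi>\<in>G. pairing \<phi> x)"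


section \<open>Completion and reflexivity\<close>

text \<open>A Banach space together with a linear isometry with dense range: this determines the
  completion of \<open>c00\<close> under the norm \<open>N\<close> up to isometric isomorphism.\<close>

definition completion_of_c00 ::
  "((nat \<Rightarrow>\<^sub>0 real) \<Rightarrow> real) \<Rightarrow> ((nat \<Rightarrow>\<^sub>0 real) \<Rightarrow> 'a::banach) \<Rightarrow> bool" where
  "completion_of_c00 N T \<longleftrightarrow>
     (\<forall>x\<in>c00. \<forall>y\<in>c00. T (x + y) = T x + T y) \<and>
     (\<forall>r. \<forall>x\<in>c00. T (r *\<^sub>R x) = r *\<^sub>R T x) \<and>
     (\<forall>x\<in>c00. norm (T x) = N x) \<and>
     closure (T ` c00) = UNIV"

lift_definition bidual_embedding ::
  "'a::real_normed_vector \<Rightarrow> ('a \<Rightarrow>\<^sub>L real) \<Rightarrow>\<^sub>L real" is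
  "\<lambda>x f. blinfun_apply f x"
  by (rule blinfun.bounded_linear_left)

definition reflexive_space :: "'a::real_normed_vector itself \<Rightarrow> bool" where
  "reflexive_space (t :: 'a itself) \<longleftrightarrow> surj (bidual_embedding :: 'a \<Rightarrow> ('a \<Rightarrow>\<^sub>L real) \<Rightarrow>\<^sub>L real)"

end

theory Submission
  imports Defs
begin

text \<open>The unit vectors form a basis of the completion; it is shown to be boundedly complete and
  shrinking, which gives reflexivity.

  If a series with bounded partial sums diverged, its coefficients would still tend to zero, because
  the functionals of index \<open>j\<close> have supports of size \<open>n\<^bsub>2j-1\<^esub>\<close>, much larger than \<open>m\<^bsub>2j-1\<^esub>\<^sup>2\<close>.
  Small indices are then negligible on late blocks, so successive blocks are normed by functionals
  with disjoint index sets, and their \<open>\<ell>\<^sub>2\<close>-combinations contradict boundedness.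

  For the shrinking property, suppose a functional stays bounded below on blocks going to infinity;
  convex combinations of the blocks have the same property. Averaging makes the coordinates small.
  The special sequences form a tree by injectivity of the coding function, and this tree is well-founded
  because the Schreier families are compact; induction along the tree produces convex combinations
  on which all special functionals are small. A last averaging satisfies an upper
  \<open>\<ell>\<^sub>2\<close>-estimate and hence tends to zero in norm, a contradiction.\<close>

section \<open>Finitely supported sequences and their pairing\<close>

text \<open>Every estimate plays off two regimes of a functional of index \<open>j\<close>. On a
  fixed vector it is at most (1/2)^j times the l_1 norm, hence negligible for large
  \<open>j\<close>; for bounded \<open>j\<close> it has boundedly many coordinates, hence is
  negligible on vectors with small coordinates. So, of several vectors chosen one after the other,
  each with knowledge of the previous ones, essentially one sees a given index. The obstacle is a
  special functional: it is a sum of unboundedly many pieces, and smallness on each piece says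
  nothing about the sum. There the code of an initial segment takes over the role of the index,
  since it is the index of the next piece and only finitely many segments have a small code.
  Convexity lets the steps be iterated: the conditions imposed on vectors are bounds on absolute
  values of functionals, so they survive all further averaging. Restrictions are to intervals
  throughout, because a special sequence cannot be thinned out: the index of each piece depends on
  all its predecessors.\<close>

lemma lookup_restr: "Poly_Mapping.lookup (restr E f) n = (if n \<in> E then Poly_Mapping.lookup f n else 0)"
  by (simp add: restr.rep_eq)

lemma keys_restr: "Poly_Mapping.keys (restr E f) = Poly_Mapping.keys f \<inter> E"
  by (auto simp: in_keys_iff lookup_restr split: if_splits)

lemma restr_restr: "restr A (restr B f) = restr (A \<inter> B) f"
  by (rule poly_mapping_eqI) (simp add: lookup_restr)

lemma lookup_scaleR_real:
  "Poly_Mapping.lookup (r *\<^sub>R (x :: 'b \<Rightarrow>\<^sub>0 real)) n = r * Poly_Mapping.lookup x n"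
proof -
  have "finite {i. r *\<^sub>R Poly_Mapping.lookup x i \<noteq> 0}"
    by (rule finite_subset[OF _ finite_keys[of x]]) (auto simp: in_keys_iff)
  then show ?thesis
    by (simp add: scaleR_poly_mapping_def)
qed

lemma lookup_sum_scaleR:
  "Poly_Mapping.lookup (\<Sum>i\<in>S. (g i :: 'b \<Rightarrow>\<^sub>0 real)) n = (\<Sum>i\<in>S. Poly_Mapping.lookup (g i) n)"
  by (induction S rule: infinite_finite_induct) (simp_all add: lookup_add)

lemma restr_add: "restr E (f + g) = restr E f + restr E g"
  by (rule poly_mapping_eqI) (simp add: lookup_restr lookup_add)

lemma restr_scaleR: "restr E (r *\<^sub>R f) = r *\<^sub>R restr E f"
  by (rule poly_mapping_eqI) (simp add: lookup_restr lookup_scaleR_real)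

lemma restr_zero [simp]: "restr E 0 = 0"
  by (rule poly_mapping_eqI) (simp add: lookup_restr)

lemma restr_sum: "restr E (\<Sum>i\<in>S. g i) = (\<Sum>i\<in>S. restr E (g i))"
  by (induction S rule: infinite_finite_induct) (simp_all add: restr_add)

lemma pairing_eq_sum:
  assumes "finite S" "Poly_Mapping.keys f \<subseteq> S"
  shows "pairing f x = (\<Sum>n\<in>S. Poly_Mapping.lookup f n * Poly_Mapping.lookup x n)"
  unfolding pairing_def using assms by (intro sum.mono_neutral_left) (auto simp: in_keys_iff)

lemma pairing_add_left: "pairing (f + g) x = pairing f x + pairing g x"
proof -
  let ?S = "Poly_Mapping.keys f \<union> Poly_Mapping.keys g"
  have "pairing (f + g) x = (\<Sum>n\<in>?S. Poly_Mapping.lookup (f + g) n * Poly_Mapping.lookup x n)"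
    by (rule pairing_eq_sum) (auto simp: Poly_Mapping.keys_add)
  also have "\<dots> = (\<Sum>n\<in>?S. Poly_Mapping.lookup f n * Poly_Mapping.lookup x n)
      + (\<Sum>n\<in>?S. Poly_Mapping.lookup g n * Poly_Mapping.lookup x n)"
    by (simp add: lookup_add algebra_simps sum.distrib)
  also have "\<dots> = pairing f x + pairing g x"
    by (simp add: pairing_eq_sum[of ?S])
  finally show ?thesis .
qed

lemma pairing_scaleR_left: "pairing (r *\<^sub>R f) x = r * pairing f x"
proof -
  have "Poly_Mapping.keys (r *\<^sub>R f) \<subseteq> Poly_Mapping.keys f"
    by (auto simp: in_keys_iff lookup_scaleR_real)
  then have "pairing (r *\<^sub>R f) x =
      (\<Sum>n\<in>Poly_Mapping.keys f. Poly_Mapping.lookup (r *\<^sub>R f) n * Poly_Mapping.lookup x n)"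
    by (intro pairing_eq_sum) auto
  then show ?thesis
    by (simp add: pairing_def lookup_scaleR_real sum_distrib_left algebra_simps)
qed

lemma pairing_zero_left [simp]: "pairing 0 x = 0"
  by (simp add: pairing_def)

lemma pairing_uminus_left: "pairing (- f) x = - pairing f x"
  using pairing_scaleR_left[of "-1"] by simp

lemma pairing_diff_left: "pairing (f - g) x = pairing f x - pairing g x"
  using pairing_add_left[of f "- g"] by (simp add: pairing_uminus_left)

lemma pairing_sum_left: "pairing (\<Sum>i\<in>S. g i) x = (\<Sum>i\<in>S. pairing (g i) x)"
  by (induction S rule: infinite_finite_induct) (simp_all add: pairing_add_left)

lemma pairing_add_right: "pairing f (x + y) = pairing f x + pairing f y"
  by (simp add: pairing_def lookup_add algebra_simps sum.distrib)

lemma pairing_scaleR_right: "pairing f (r *\<^sub>R x) = r * pairing f x"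
  by (simp add: pairing_def lookup_scaleR_real sum_distrib_left algebra_simps)

lemma pairing_restr: "pairing (restr E f) x = pairing f (restr E x)"
  by (subst pairing_eq_sum[of "Poly_Mapping.keys f"]) (auto simp: keys_restr pairing_def lookup_restr intro!: sum.cong)

lemma pairing_single: "pairing (Poly_Mapping.single n e) x = e * Poly_Mapping.lookup x n"
  by (subst pairing_eq_sum[of "{n}"]) auto

lemma abs_pairing_le_card:
  assumes "\<And>n. \<bar>Poly_Mapping.lookup f n\<bar> \<le> 1" "\<And>n. \<bar>Poly_Mapping.lookup y n\<bar> \<le> \<kappa>"
  shows "\<bar>pairing f y\<bar> \<le> real (card (Poly_Mapping.keys f)) * \<kappa>"
proof -
  have "\<bar>pairing f y\<bar> \<le> (\<Sum>n\<in>Poly_Mapping.keys f. \<bar>Poly_Mapping.lookup f n * Poly_Mapping.lookup y n\<bar>)"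
    unfolding pairing_def by (rule sum_abs)
  also have "\<dots> \<le> (\<Sum>n\<in>Poly_Mapping.keys f. \<kappa>)"
  proof (rule sum_mono)
    fix n
    have "\<bar>Poly_Mapping.lookup f n\<bar> * \<bar>Poly_Mapping.lookup y n\<bar> \<le> 1 * \<kappa>"
      by (rule mult_mono) (use assms in auto)
    then show "\<bar>Poly_Mapping.lookup f n * Poly_Mapping.lookup y n\<bar> \<le> \<kappa>"
      by (simp add: abs_mult)
  qed
  finally show ?thesis by simp
qed

text \<open>Here \<open>norm\<close> is the norm that the library gives to finitely supported
  functions, the l_1 norm of the coefficients. It is finite on each fixed vector and is not to be
  confused with the norm \<open>N\<close> under study.\<close>

lemma abs_pairing_le_norm:
  assumes "\<And>n. \<bar>Poly_Mapping.lookup f n\<bar> \<le> c"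
  shows "\<bar>pairing f y\<bar> \<le> c * norm y"
proof -
  let ?S = "Poly_Mapping.keys f \<union> Poly_Mapping.keys y"
  have "\<bar>pairing f y\<bar> \<le> (\<Sum>n\<in>?S. \<bar>Poly_Mapping.lookup f n * Poly_Mapping.lookup y n\<bar>)"
    by (subst pairing_eq_sum[of ?S]) auto
  also have "\<dots> = (\<Sum>n\<in>Poly_Mapping.keys y. \<bar>Poly_Mapping.lookup f n * Poly_Mapping.lookup y n\<bar>)"
    by (rule sum.mono_neutral_right) (auto simp: in_keys_iff)
  also have "\<dots> \<le> (\<Sum>n\<in>Poly_Mapping.keys y. c * \<bar>Poly_Mapping.lookup y n\<bar>)"
    by (rule sum_mono) (auto simp: abs_mult assms intro!: mult_right_mono)
  also have "\<dots> = c * norm y"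
    by (simp add: norm_poly_mapping_def dist_poly_mapping_def sum_distrib_left)
  finally show ?thesis .
qed

section \<open>Compactness of the Schreier families\<close>

lemma schreier_subset: "schreier fs \<xi> F \<Longrightarrow> F' \<subseteq> F \<Longrightarrow> schreier fs \<xi> F'"
proof (induction arbitrary: F' rule: schreier.induct)
  case (zero_empty \<xi>)
  then show ?case by (simp add: schreier.zero_empty)
next
  case (zero_single \<xi> n)
  then show ?case by (auto simp: subset_singleton_iff schreier.intros)
next
  case (succ \<eta> \<xi> Fs)
  \<comment> \<open>Intersecting may empty some pieces, which the successor rule permits, so the
    number of pieces is unchanged.\<close>
  let ?Fs = "map (\<lambda>F. F \<inter> F') Fs"
  have eq: "F' = \<Union> (set ?Fs)"
    using succ.prems by auto
  have "schreier fs \<xi> (\<Union> (set ?Fs))"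
  proof (rule schreier.succ[OF succ.hyps(1)])
    show "1 \<le> length ?Fs" using succ.hyps by simp
    show "\<forall>F\<in>set ?Fs. schreier fs \<eta> F" using succ.IH by auto
    show "\<forall>F\<in>set ?Fs. \<forall>a\<in>F. length ?Fs \<le> a" using succ.hyps by auto
    show "sorted_wrt (\<lambda>A B. \<forall>a\<in>A. \<forall>b\<in>B. a < b) ?Fs"
      unfolding sorted_wrt_map by (rule sorted_wrt_mono_rel[OF _ succ.hyps(4)]) auto
  qed
  then show ?case using eq by simp
next
  case (limit \<xi> n F)
  then show ?case by (meson schreier.limit subset_iff)
qed

lemma schreier_singleton:
  assumes "fundamental_sequences fs" "n \<ge> 1"
  shows "schreier fs \<xi> {n}"
proof (induction \<xi> rule: less_induct)
  case (less \<xi>)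
  consider "is_zero_ord \<xi>" | \<eta> where "is_succ_ord \<eta> \<xi>" | "is_limit_ord \<xi>"
    by (auto simp: is_limit_ord_def)
  then show ?case
  proof cases
    case 1
    then show ?thesis using assms by (intro schreier.zero_single)
  next
    case (2 \<eta>)
    then have "schreier fs \<xi> (\<Union> (set [{n}]))"
      using less assms by (intro schreier.succ[OF 2]) (auto simp: is_succ_ord_def)
    then show ?thesis by simp
  next
    case 3
    then have "fs \<xi> 1 < \<xi>" using assms(1) by (simp add: fundamental_sequences_def)
    then show ?thesis using assms by (intro schreier.limit[OF 3, of 1] less) auto
  qed
qed

text \<open>Take a finite \<open>B1\<close> in \<open>A\<close> violating \<open>P\<close>, then
  treat \<open>m\<close> sets beyond \<open>B1\<close> by induction. The first of
  \<open>m + 1\<close> successive sets cannot contain \<open>B1\<close>, so a later one meets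
  \<open>B1\<close>; the first set then lies entirely before the new part \<open>B'\<close>, which
  is left to the other \<open>m\<close> sets.\<close>

lemma successive_unions_compact:
  fixes P :: "nat set \<Rightarrow> bool"
  assumes hereditary: "\<And>F F'. P F \<Longrightarrow> F' \<subseteq> F \<Longrightarrow> P F'"
    and compact: "\<And>A. infinite A \<Longrightarrow> \<exists>B\<subseteq>A. finite B \<and> \<not> P B"
    and "infinite A"
  shows "\<exists>B\<subseteq>A. finite B \<and> (\<forall>Fs. length Fs \<le> m \<longrightarrow> (\<forall>F\<in>set Fs. P F) \<longrightarrow>
      sorted_wrt (\<lambda>A B. \<forall>a\<in>A. \<forall>b\<in>B. a < b) Fs \<longrightarrow> \<Union> (set Fs) \<noteq> B)"
  using \<open>infinite A\<close>
proof (induction m arbitrary: A)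
  case 0
  then obtain a where "a \<in> A" using infinite_imp_nonempty by blast
  then show ?case by (intro exI[of _ "{a}"]) auto
next
  case (Suc m)
  obtain B1 where B1: "B1 \<subseteq> A" "finite B1" "\<not> P B1" using compact[OF Suc.prems] by auto
  define A' where "A' = A - {..Max (insert 0 B1)}"
  have "infinite A'" unfolding A'_def using Suc.prems by (simp add: Diff_infinite_finite)
  from Suc.IH[OF this] obtain B' where B': "B' \<subseteq> A'" "finite B'"
    and cov: "\<And>Fs. length Fs \<le> m \<Longrightarrow> \<forall>F\<in>set Fs. P F \<Longrightarrow>
      sorted_wrt (\<lambda>A B. \<forall>a\<in>A. \<forall>b\<in>B. a < b) Fs \<Longrightarrow> \<Union> (set Fs) \<noteq> B'" by auto
  have lt: "b < b'" if "b \<in> B1" "b' \<in> B'" for b b'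
  proof -
    have "b \<le> Max (insert 0 B1)" using that B1 by (intro Max_ge) auto
    moreover have "Max (insert 0 B1) < b'" using that B'(1) by (auto simp: A'_def)
    ultimately show ?thesis by linarith
  qed
  have "\<Union> (set Fs) \<noteq> B1 \<union> B'" if len: "length Fs \<le> Suc m" and P: "\<forall>F\<in>set Fs. P F"
    and sorted: "sorted_wrt (\<lambda>A B. \<forall>a\<in>A. \<forall>b\<in>B. a < b) Fs" for Fs
  proof
    assume eq: "\<Union> (set Fs) = B1 \<union> B'"
    show False
    proof (cases Fs)
      case Nil
      then show False using eq cov[of "[]"] by auto
    next
      case (Cons F1 Fs')
      let ?Gs = "map (\<lambda>F. F \<inter> B') Fs'"
      have "\<not> B1 \<subseteq> F1" using B1 P hereditary Cons by auto
      then obtain b where "b \<in> B1" "b \<notin> F1" by blast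
      moreover have "b \<in> F1 \<union> \<Union> (set Fs')" using \<open>b \<in> B1\<close> eq Cons by auto
      ultimately obtain F where b: "b \<in> B1" "F \<in> set Fs'" "b \<in> F" by blast
      have "F1 \<inter> B' = {}"
        using lt[OF b(1)] sorted b Cons by fastforce
      then have "\<Union> (set ?Gs) = B'" using eq Cons by auto
      moreover have "\<Union> (set ?Gs) \<noteq> B'"
      proof (rule cov)
        show "length ?Gs \<le> m" using len Cons by simp
        show "\<forall>F\<in>set ?Gs. P F" using P hereditary Cons by auto
        show "sorted_wrt (\<lambda>A B. \<forall>a\<in>A. \<forall>b\<in>B. a < b) ?Gs"
          unfolding sorted_wrt_map using sorted Cons
          by (auto intro: sorted_wrt_mono_rel[rotated])
      qed
      ultimately show False by simp
    qed
  qed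
  then show ?case using B1 B' by (intro exI[of _ "B1 \<union> B'"]) (auto simp: A'_def)
qed

text \<open>An element \<open>a\<close> of a set bounds the complexity of that set: in the successor
  case at most \<open>a\<close> pieces are used, in the limit case only the members 1 to
  \<open>a\<close> of the fundamental sequence are possible. Putting \<open>a\<close> into the set
  to be excluded thus leaves a bounded number of pieces, or finitely many smaller families, whose
  excluded sets are united.\<close>

lemma schreier_compact:
  assumes "fundamental_sequences fs" "infinite A"
  shows "\<exists>B\<subseteq>A. finite B \<and> \<not> schreier fs \<xi> B"
  using assms(2)
proof (induction \<xi> arbitrary: A rule: less_induct)
  case (less \<xi>)
  obtain a where a: "a \<in> A" using less.prems infinite_imp_nonempty by blast
  consider (zero) "is_zero_ord \<xi>" | (succ) \<eta> where "is_succ_ord \<eta> \<xi>" | (limit) "is_limit_ord \<xi>"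
    by (auto simp: is_limit_ord_def)
  then show ?case
  proof cases
    case zero
    obtain b where "b \<in> A" "b \<noteq> a"
      using less.prems by (metis finite.simps insertI1 finite_subset subsetI singleton_iff)
    moreover have "\<not> schreier fs \<xi> {a, b}"
    proof
      assume "schreier fs \<xi> {a, b}"
      then show False
        using zero \<open>b \<noteq> a\<close>
        by cases (auto simp: is_limit_ord_def is_succ_ord_def is_zero_ord_def doubleton_eq_iff simp flip: not_le)
    qed
    ultimately show ?thesis using a by (intro exI[of _ "{a, b}"]) auto
  next
    case (succ \<eta>)
    have "infinite (A - {..a})" using less.prems by (simp add: Diff_infinite_finite)
    then obtain B where B: "B \<subseteq> A - {..a}" "finite B"
      and cov: "\<And>Fs. length Fs \<le> a \<Longrightarrow> \<forall>F\<in>set Fs. schreier fs \<eta> F \<Longrightarrow>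
        sorted_wrt (\<lambda>A B. \<forall>a\<in>A. \<forall>b\<in>B. a < b) Fs \<Longrightarrow> \<Union> (set Fs) \<noteq> B"
      using successive_unions_compact[of "schreier fs \<eta>" "A - {..a}" a] schreier_subset
        less.IH[of \<eta>] succ by (auto simp: is_succ_ord_def)
    have "\<not> schreier fs \<xi> (insert a B)"
    proof
      assume "schreier fs \<xi> (insert a B)"
      then show False
      proof cases
        case (succ \<eta>' Fs)
        have [simp]: "\<eta>' = \<eta>"
          using succ(2) \<open>is_succ_ord \<eta> \<xi>\<close> by (auto simp: is_succ_ord_def) (metis linorder_neqE)
        let ?Gs = "map (\<lambda>F. F \<inter> B) Fs"
        have "\<Union> (set ?Gs) = B" using succ(1) by auto
        moreover have "\<Union> (set ?Gs) \<noteq> B"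
        proof (rule cov)
          show "length ?Gs \<le> a" using succ by auto
          show "\<forall>F\<in>set ?Gs. schreier fs \<eta> F" using succ by (auto intro: schreier_subset)
          show "sorted_wrt (\<lambda>A B. \<forall>a\<in>A. \<forall>b\<in>B. a < b) ?Gs"
            unfolding sorted_wrt_map using succ by (auto intro: sorted_wrt_mono_rel[rotated])
        qed
        ultimately show False by simp
      qed (use \<open>is_succ_ord \<eta> \<xi>\<close> in \<open>auto simp: is_zero_ord_def is_succ_ord_def is_limit_ord_def simp flip: not_le\<close>)
    qed
    then show ?thesis using a B by (intro exI[of _ "insert a B"]) auto
  next
    case limit
    show ?thesis
    proof -
      have "\<exists>B\<subseteq>A. finite B \<and> \<not> schreier fs (fs \<xi> n) B" if "n \<in> {1..a}" for n
        using less that limit assms(1) by (simp add: fundamental_sequences_def)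
      then obtain B where B: "B n \<subseteq> A" "finite (B n)" "\<not> schreier fs (fs \<xi> n) (B n)"
        if "n \<in> {1..a}" for n by metis
      let ?B = "insert a (\<Union>n\<in>{1..a}. B n)"
      have "\<not> schreier fs \<xi> ?B"
      proof
        assume "schreier fs \<xi> ?B"
        then show False
        proof cases
          case (limit n)
          then have "n \<in> {1..a}" by auto
          then show False using B(3) limit(3) by (meson UN_upper schreier_subset subset_insertI2)
        qed (use limit in \<open>auto simp: is_limit_ord_def\<close>)
      qed
      moreover have "?B \<subseteq> A" "finite ?B" using a B(1,2) by (blast, simp)
      ultimately show ?thesis by blast
    qed
  qed
qed

section \<open>Functionals of a fixed index and sequences with increasing indices\<close>

lemma m_seq_inject: "m_seq i = m_seq j \<longleftrightarrow> i = j"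
  by (simp add: m_seq_eq)

lemma coefficient_inject:
  assumes "1 / real (m_seq (2 * j - 1)) ^ 2 = 1 / real (m_seq (2 * k - 1)) ^ 2" "j \<ge> 1" "k \<ge> 1"
  shows "j = k"
proof -
  have "m_seq (2 * j - 1) = m_seq (2 * k - 1)"
    using assms(1) by (simp add: power2_eq_iff_nonneg)
  then show ?thesis using assms by (simp add: m_seq_inject)
qed

text \<open>A crude bound, since \<open>m_seq\<close> grows doubly exponentially. Only the
  summability of the weights (1/2)^j, with total at most 1 over \<open>j\<close> from 1 on, is used
  for large indices.\<close>

lemma coefficient_le:
  assumes "j \<ge> 1"
  shows "1 / real (m_seq (2 * j - 1)) ^ 2 \<le> (1 / 2) ^ j"
proof -
  have "j < 5 ^ j" by (rule less_exp[THEN less_le_trans]) (simp add: power_mono)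
  also have "(5::nat) ^ j \<le> 5 ^ (2 * j - 1)" using assms by (intro power_increasing) auto
  finally have "j \<le> 5 ^ (2 * j - 1) * 2" by simp
  then have "(2::real) ^ j \<le> real (m_seq (2 * j - 1)) ^ 2"
    by (simp add: m_seq_eq power_increasing flip: power_mult)
  then have "1 / real (m_seq (2 * j - 1)) ^ 2 \<le> 1 / 2 ^ j"
    by (intro divide_left_mono) (auto simp: m_seq_eq)
  then show ?thesis by (simp add: power_one_over)
qed

lemma n_seq_pos: "n_seq (Suc j) \<ge> 1"
  by (induction j) auto

text \<open>The choice of \<open>s_seq\<close> makes 2 to that power equal to the cube. The bound
  starts at 2: for \<open>k\<close> = 1 the two sides would be 2^15 and 2^6. It makes the l_1 norm
  of a functional with maximal support at least \<open>m_seq k\<close>, so unbounded in the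
  index.\<close>

lemma m_seq_cube_le_n_seq:
  assumes "k \<ge> 2"
  shows "m_seq k ^ 3 \<le> n_seq k"
proof -
  obtain j where k: "k = Suc (Suc j)" using assms by (metis Suc_le_D numeral_2_eq_2 Suc_le_mono)
  have "m_seq k ^ 3 = 2 ^ s_seq (Suc j)" using two_power_s_seq[of "Suc j"] k by simp
  also have "\<dots> \<le> (2 * n_seq (Suc j)) ^ s_seq (Suc j)"
    using n_seq_pos[of j] by (intro power_mono) auto
  finally show ?thesis by (simp add: k)
qed

text \<open>Describing membership by the support and the common modulus hides the choice of signs,
  so that restrictions can be handled directly. Conversely, the signs are recovered with
  \<open>sgn\<close>.\<close>

lemma G1_level_iff:
  "f \<in> G1_level j \<longleftrightarrow> Poly_Mapping.keys f \<noteq> {} \<and> Poly_Mapping.keys f \<subseteq> {1..} \<and>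
     card (Poly_Mapping.keys f) \<le> n_seq (2 * j - 1) \<and>
     (\<forall>n\<in>Poly_Mapping.keys f. \<bar>Poly_Mapping.lookup f n\<bar> = 1 / real (m_seq (2 * j - 1)) ^ 2)"
  (is "_ \<longleftrightarrow> ?R")
proof -
  let ?c = "1 / real (m_seq (2 * j - 1)) ^ 2"
  have c: "?c > 0" by (simp add: m_seq_eq)
  have lookup: "Poly_Mapping.lookup (?c *\<^sub>R (\<Sum>i\<in>B. Poly_Mapping.single i (\<epsilon> i))) n =
      (if n \<in> B then ?c * \<epsilon> n else 0)" if "finite B" for B n and \<epsilon> :: "nat \<Rightarrow> real"
    using that by (simp add: lookup_scaleR_real lookup_sum_scaleR lookup_single when_def)
  show ?thesis
  proof
    assume "f \<in> G1_level j"
    then obtain B \<epsilon> where f: "f = ?c *\<^sub>R (\<Sum>i\<in>B. Poly_Mapping.single i (\<epsilon> i))"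
      and B: "finite B" "B \<subseteq> {1..}" "1 \<le> card B" "card B \<le> n_seq (2 * j - 1)"
      and \<epsilon>: "\<forall>i\<in>B. \<epsilon> i \<in> {-1, 1::real}"
      unfolding G1_level_def by blast
    have f': "Poly_Mapping.lookup f n = (if n \<in> B then ?c * \<epsilon> n else 0)" for n
      unfolding f by (rule lookup[OF B(1)])
    have "Poly_Mapping.keys f = B"
      using \<epsilon> c by (auto simp: in_keys_iff f' split: if_splits)
    moreover have "\<bar>Poly_Mapping.lookup f n\<bar> = ?c" if "n \<in> B" for n
      using \<epsilon> that c by (auto simp: f')
    ultimately show ?R using B by auto
  next
    assume R: ?R
    let ?B = "Poly_Mapping.keys f"
    let ?\<epsilon> = "\<lambda>n. sgn (Poly_Mapping.lookup f n)"
    have f_eq: "f = ?c *\<^sub>R (\<Sum>i\<in>?B. Poly_Mapping.single i (?\<epsilon> i))"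
    proof (rule poly_mapping_eqI)
      fix n
      show "Poly_Mapping.lookup f n = Poly_Mapping.lookup (?c *\<^sub>R (\<Sum>i\<in>?B. Poly_Mapping.single i (?\<epsilon> i))) n"
      proof (cases "n \<in> ?B")
        case True
        then have "?c = \<bar>Poly_Mapping.lookup f n\<bar>" using R by simp
        then show ?thesis using True by (subst lookup) (simp_all add: abs_mult_sgn)
      next
        case False
        then show ?thesis by (subst lookup) (simp_all add: in_keys_iff)
      qed
    qed
    have signs: "\<forall>i\<in>?B. ?\<epsilon> i \<in> {-1, 1}" by (auto simp: in_keys_iff sgn_if)
    have card: "1 \<le> card ?B" "card ?B \<le> n_seq (2 * j - 1)" and sub: "?B \<subseteq> {1..}"
      using R by (simp_all add: Suc_le_eq card_gt_0_iff)
    show "f \<in> G1_level j"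
      unfolding G1_level_def mem_Collect_eq
      by (intro exI[of _ ?B] exI[of _ ?\<epsilon>] conjI f_eq signs card sub finite_keys)
  qed
qed

text \<open>The support is nonempty, so the common modulus of the coefficients can be read off, and
  it determines the index.\<close>

lemma ind_G1_eq:
  assumes "f \<in> G1_level j" "j \<ge> 1"
  shows "ind_G1 f = j"
  unfolding ind_G1_def
proof (rule the_equality)
  fix k assume "1 \<le> k \<and> f \<in> G1_level k"
  then show "k = j"
    using assms coefficient_inject[of k j] unfolding G1_level_iff by (metis all_not_in_conv)
qed (use assms in auto)

lemma G1_level_restr:
  assumes "f \<in> G1_level j" "restr E f \<noteq> 0"
  shows "restr E f \<in> G1_level j"
  using assms card_mono[of "Poly_Mapping.keys f" "Poly_Mapping.keys f \<inter> E"]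
  by (auto simp: G1_level_iff keys_restr lookup_restr simp flip: keys_eq_empty)

lemma abs_lookup_restr_G1_level:
  assumes "f \<in> G1_level j" "j \<ge> 1"
  shows "\<bar>Poly_Mapping.lookup (restr E f) n\<bar> \<le> (1 / 2) ^ j"
  using assms coefficient_le[of j] by (cases "n \<in> Poly_Mapping.keys f")
    (auto simp: lookup_restr G1_level_iff in_keys_iff)

text \<open>The bound for large indices: useful when \<open>y\<close> is fixed first and
  \<open>j\<close> is large afterwards.\<close>

lemma abs_pairing_G1_level_le_norm:
  assumes "f \<in> G1_level j" "j \<ge> 1"
  shows "\<bar>pairing (restr E f) y\<bar> \<le> (1 / 2) ^ j * norm y"
  using abs_lookup_restr_G1_level[OF assms] by (rule abs_pairing_le_norm)

text \<open>The bound for small indices: useful when \<open>j\<close> is bounded first and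
  \<open>y\<close> is then chosen with small coordinates.\<close>

lemma abs_pairing_G1_level_le_card:
  assumes "f \<in> G1_level j" "j \<ge> 1" "\<And>n. \<bar>Poly_Mapping.lookup y n\<bar> \<le> \<kappa>"
  shows "\<bar>pairing (restr E f) y\<bar> \<le> real (n_seq (2 * j - 1)) * \<kappa>"
proof -
  have "\<bar>pairing (restr E f) y\<bar> \<le> real (card (Poly_Mapping.keys (restr E f))) * \<kappa>"
    using abs_lookup_restr_G1_level[OF assms(1,2), of E] power_le_one[of "1/2::real" j]
    by (intro abs_pairing_le_card assms) (auto intro: order_trans)
  also have "\<dots> \<le> real (n_seq (2 * j - 1)) * \<kappa>"
  proof (rule mult_right_mono)
    have "card (Poly_Mapping.keys (restr E f)) \<le> card (Poly_Mapping.keys f)"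
      unfolding keys_restr by (intro card_mono) auto
    then show "real (card (Poly_Mapping.keys (restr E f))) \<le> real (n_seq (2 * j - 1))"
      using assms(1) by (auto simp: G1_level_iff)
    show "0 \<le> \<kappa>" using assms(3)[of 0] by linarith
  qed
  finally show ?thesis .
qed

section \<open>Sequences with increasing indices and their restrictions to intervals\<close>

lemma U_seqs_nth:
  assumes "gs \<in> U_seqs" "i < length gs"
  shows "ind_G1 (gs ! i) \<ge> 1" "gs ! i \<in> G1_level (ind_G1 (gs ! i))" "Poly_Mapping.keys (gs ! i) \<noteq> {}"
proof -
  obtain j where j: "j \<ge> 1" "gs ! i \<in> G1_level j" using assms by (auto simp: U_seqs_def)
  then show "ind_G1 (gs ! i) \<ge> 1" "gs ! i \<in> G1_level (ind_G1 (gs ! i))" by (simp_all add: ind_G1_eq)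
  show "Poly_Mapping.keys (gs ! i) \<noteq> {}" using j by (simp add: G1_level_iff)
qed

lemma U_seqs_ind_less:
  assumes "gs \<in> U_seqs" "i < k" "k < length gs"
  shows "ind_G1 (gs ! i) < ind_G1 (gs ! k)"
proof -
  obtain js where js: "length js = length gs" "sorted_wrt (<) js"
    "\<And>i. i < length gs \<Longrightarrow> js ! i \<ge> 1 \<and> gs ! i \<in> G1_level (js ! i)"
    using assms by (auto simp: U_seqs_def)
  have "js ! i < js ! k" using js assms by (simp add: sorted_wrt_iff_nth_less)
  then show ?thesis using js(3)[of i] js(3)[of k] assms ind_G1_eq[of "gs ! i" "js ! i"]
      ind_G1_eq[of "gs ! k" "js ! k"] by simp
qed

lemma U_seqs_inj_on_ind:
  assumes "gs \<in> U_seqs"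
  shows "inj_on (\<lambda>i. ind_G1 (gs ! i)) {..<length gs}"
proof (rule linorder_inj_onI')
  fix i k assume "i \<in> {..<length gs}" "k \<in> {..<length gs}" "i < k"
  then show "ind_G1 (gs ! i) \<noteq> ind_G1 (gs ! k)"
    using U_seqs_ind_less[OF assms, of i k] by simp
qed

lemma U_seqs_block_less:
  assumes "gs \<in> U_seqs" "i < k" "k < length gs"
    "a \<in> Poly_Mapping.keys (gs ! i)" "b \<in> Poly_Mapping.keys (gs ! k)"
  shows "a < b"
proof -
  have "Max (Poly_Mapping.keys (gs ! i)) < Min (Poly_Mapping.keys (gs ! k))"
    using assms(1-3) by (auto simp: U_seqs_def sorted_wrt_iff_nth_less block_less_def)
  moreover have "a \<le> Max (Poly_Mapping.keys (gs ! i))" "Min (Poly_Mapping.keys (gs ! k)) \<le> b"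
    using assms by auto
  ultimately show ?thesis by linarith
qed

lemma U_seqs_take:
  assumes "gs \<in> U_seqs" "k \<ge> 1"
  shows "take k gs \<in> U_seqs"
proof -
  obtain js where "length js = length gs" "sorted_wrt (<) js"
    "\<forall>i<length gs. js ! i \<ge> 1 \<and> gs ! i \<in> G1_level (js ! i)" "gs \<noteq> []" "sorted_wrt block_less gs"
    using assms by (auto simp: U_seqs_def)
  then show ?thesis
    using assms(2) unfolding U_seqs_def
    by (auto intro!: sorted_wrt_take exI[of _ "take k js"])
qed

lemma restr_cong:
  assumes "Poly_Mapping.keys f \<inter> E = Poly_Mapping.keys f \<inter> E'"
  shows "restr E f = restr E' f"
proof (rule poly_mapping_eqI)
  fix n
  show "Poly_Mapping.lookup (restr E f) n = Poly_Mapping.lookup (restr E' f) n"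
  proof (cases "n \<in> Poly_Mapping.keys f")
    case True
    then have "n \<in> E \<longleftrightarrow> n \<in> E'" using assms by blast
    then show ?thesis by (simp add: lookup_restr)
  qed (simp add: lookup_restr in_keys_iff)
qed

lemma U_seqs_restr_initial:
  assumes "gs \<in> U_seqs" "i < k" "k < length gs"
  shows "restr (E \<inter> {Min (Poly_Mapping.keys (gs ! k))..}) (gs ! i) = 0"
proof -
  have "Min (Poly_Mapping.keys (gs ! k)) \<in> Poly_Mapping.keys (gs ! k)"
    using U_seqs_nth(3)[OF assms(1,3)] by (intro Min_in) auto
  then have "Poly_Mapping.keys (restr (E \<inter> {Min (Poly_Mapping.keys (gs ! k))..}) (gs ! i)) = {}"
    using U_seqs_block_less[OF assms] by (fastforce simp: keys_restr)
  then show ?thesis by simp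
qed

lemma U_seqs_restr_final:
  assumes "gs \<in> U_seqs" "k \<le> i" "i < length gs"
  shows "restr (E \<inter> {Min (Poly_Mapping.keys (gs ! k))..}) (gs ! i) = restr E (gs ! i)"
proof (rule restr_cong)
  have "Min (Poly_Mapping.keys (gs ! k)) \<le> b" if "b \<in> Poly_Mapping.keys (gs ! i)" for b
  proof (cases "k = i")
    case True
    then show ?thesis using that by simp
  next
    case False
    then have "k < i" using assms by simp
    have "Min (Poly_Mapping.keys (gs ! k)) \<in> Poly_Mapping.keys (gs ! k)"
      using U_seqs_nth(3)[OF assms(1), of k] assms by (intro Min_in) auto
    then show ?thesis using U_seqs_block_less[OF assms(1) \<open>k < i\<close> assms(3)] that by fastforce
  qed
  then show "Poly_Mapping.keys (gs ! i) \<inter> (E \<inter> {Min (Poly_Mapping.keys (gs ! k))..}) =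
      Poly_Mapping.keys (gs ! i) \<inter> E"
    by auto
qed

text \<open>The blocks are successive, so a half-line starting at the minimum of one support removes
  the earlier pieces and leaves the later ones intact. A tail of a signed sum is therefore an
  interval restriction of the whole sum.\<close>

lemma U_seqs_restr_tail:
  assumes "gs \<in> U_seqs" "k < length gs"
  shows "restr (E \<inter> {Min (Poly_Mapping.keys (gs ! k))..}) (\<Sum>i<length gs. \<epsilon> i *\<^sub>R (gs ! i)) =
    (\<Sum>i=k..<length gs. \<epsilon> i *\<^sub>R restr E (gs ! i))" (is "restr ?E _ = _")
proof -
  have "restr ?E (\<Sum>i<length gs. \<epsilon> i *\<^sub>R (gs ! i)) = (\<Sum>i<length gs. \<epsilon> i *\<^sub>R restr ?E (gs ! i))"
    by (simp add: restr_sum restr_scaleR)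
  also have "\<dots> = (\<Sum>i=k..<length gs. \<epsilon> i *\<^sub>R restr ?E (gs ! i))"
    using assms by (intro sum.mono_neutral_right) (auto simp: U_seqs_restr_initial)
  also have "\<dots> = (\<Sum>i=k..<length gs. \<epsilon> i *\<^sub>R restr E (gs ! i))"
    using assms by (intro sum.cong) (auto simp: U_seqs_restr_final)
  finally show ?thesis .
qed

text \<open>Distinct pieces have distinct indices, so a sum over pieces is dominated by a sum over
  indices. The weight \<open>w\<close> stands for either of the two bounds for a single index, and
  \<open>K\<close> may select an initial part, a tail or everything.\<close>

lemma abs_pairing_pieces_le:
  assumes gs: "gs \<in> U_seqs" and K: "K \<subseteq> {..<length gs}"
    and \<epsilon>: "\<forall>i<length gs. \<epsilon> i \<in> {-1, 1}"
    and J: "(\<lambda>i. ind_G1 (gs ! i)) ` {i \<in> K. restr E (gs ! i) \<noteq> 0} \<subseteq> J" "finite J"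
    and w: "\<And>j f. j \<ge> 1 \<Longrightarrow> f \<in> G1_level j \<Longrightarrow> \<bar>pairing (restr E f) y\<bar> \<le> w j" "\<And>j. w j \<ge> 0"
  shows "\<bar>pairing (\<Sum>i\<in>K. \<epsilon> i *\<^sub>R restr E (gs ! i)) y\<bar> \<le> (\<Sum>j\<in>J. w j)"
proof -
  let ?K = "{i \<in> K. restr E (gs ! i) \<noteq> 0}"
  have finK: "finite K" using K finite_subset by blast
  have "\<bar>pairing (\<Sum>i\<in>K. \<epsilon> i *\<^sub>R restr E (gs ! i)) y\<bar> \<le> (\<Sum>i\<in>K. \<bar>\<epsilon> i * pairing (restr E (gs ! i)) y\<bar>)"
    unfolding pairing_sum_left pairing_scaleR_left by (rule sum_abs)
  also have "\<dots> = (\<Sum>i\<in>?K. \<bar>\<epsilon> i * pairing (restr E (gs ! i)) y\<bar>)"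
    using finK by (intro sum.mono_neutral_right) auto
  also have "\<dots> \<le> (\<Sum>i\<in>?K. w (ind_G1 (gs ! i)))"
  proof (rule sum_mono)
    fix i assume "i \<in> ?K"
    then have i: "i < length gs" using K by auto
    then have "\<bar>\<epsilon> i\<bar> = 1" using \<epsilon> by auto
    then show "\<bar>\<epsilon> i * pairing (restr E (gs ! i)) y\<bar> \<le> w (ind_G1 (gs ! i))"
      using w(1) U_seqs_nth[OF gs i] by (simp add: abs_mult)
  qed
  also have "\<dots> = (\<Sum>j\<in>(\<lambda>i. ind_G1 (gs ! i)) ` ?K. w j)"
    using U_seqs_inj_on_ind[OF gs] K by (subst sum.reindex) (auto intro: inj_on_subset)
  also have "\<dots> \<le> (\<Sum>j\<in>J. w j)"
    using J w by (intro sum_mono2) auto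
  finally show ?thesis .
qed

section \<open>The norming set\<close>

locale special_norm =
  fixes fs :: "countable_ordinal \<Rightarrow> nat \<Rightarrow> countable_ordinal"
    and M1 M2 :: "nat set" and \<sigma> :: "(nat \<Rightarrow>\<^sub>0 real) list \<Rightarrow> nat" and \<xi> :: countable_ordinal
  assumes fundamental: "fundamental_sequences fs"
    and partition: "partition_of_naturals M1 M2"
    and coding: "coding_function M2 \<sigma>"
begin

abbreviation special :: "(nat \<Rightarrow>\<^sub>0 real) list \<Rightarrow> bool" where
  "special \<equiv> special_sequence fs M1 \<sigma> \<xi>"

abbreviation atom :: "(nat \<Rightarrow>\<^sub>0 real) \<Rightarrow> nat set \<Rightarrow> bool" where
  "atom \<equiv> has_ind fs M1 \<sigma> \<xi>"

abbreviation N :: "(nat \<Rightarrow>\<^sub>0 real) \<Rightarrow> real" where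
  "N \<equiv> norm_G (G_xi fs M1 \<sigma> \<xi>)"

lemma special_U: "special gs \<Longrightarrow> gs \<in> U_seqs"
  by (simp add: special_sequence_def)

lemma interval_inter: "interval E \<Longrightarrow> interval E' \<Longrightarrow> interval (E \<inter> E')"
  unfolding interval_def by blast

lemma interval_inter_atLeast: "interval E \<Longrightarrow> interval (E \<inter> {m..})"
  unfolding interval_def by auto

lemma sp_atomI:
  assumes "special gs" "interval E" "\<forall>i<length gs. \<epsilon> i \<in> {-1, 1}"
  shows "atom (restr E (\<Sum>i<length gs. \<epsilon> i *\<^sub>R (gs ! i))) {ind_G1 f |f. f \<in> set gs \<and> restr E f \<noteq> 0}"
  using assms unfolding has_ind_def sp_with_ind_def by blast

lemma atom_cases [consumes 1, case_names special single]:
  assumes "atom \<phi> I"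
  obtains gs \<epsilon> E where "special gs" "interval E" "\<forall>i<length gs. \<epsilon> i \<in> {-1, 1}"
      "\<phi> = restr E (\<Sum>i<length gs. \<epsilon> i *\<^sub>R (gs ! i))" "I = {ind_G1 f |f. f \<in> set gs \<and> restr E f \<noteq> 0}"
    | j where "j \<ge> 1" "\<phi> \<in> G1_level j" "I = {j}"
  using assms unfolding has_ind_def sp_with_ind_def G1_def by (auto simp: ind_G1_eq)

lemma special_exists: "\<exists>gs. special gs"
proof -
  have "M1 \<subseteq> {1..}" "M1 \<noteq> {}"
    using partition by (auto simp: partition_of_naturals_def)
  then obtain j where j: "j \<in> M1" "j \<ge> 1" by auto
  let ?f = "Poly_Mapping.single 1 (1 / real (m_seq (2 * j - 1)) ^ 2)"
  have keys: "Poly_Mapping.keys ?f = {1}" by (simp add: m_seq_eq)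
  have "1 \<le> n_seq (2 * j - 1)"
  proof -
    have "2 * j - 1 = Suc (2 * j - 2)" using j by simp
    then show ?thesis using n_seq_pos by metis
  qed
  then have f: "?f \<in> G1_level j"
    unfolding G1_level_iff keys by simp
  then have "[?f] \<in> U_seqs"
    using j unfolding U_seqs_def by (auto intro!: exI[of _ "[j]"])
  moreover have "schreier fs \<xi> ((\<lambda>f. Min (Poly_Mapping.keys f)) ` set [?f])"
    unfolding list.set image_insert image_empty keys using schreier_singleton[OF fundamental, of 1] by simp
  ultimately show ?thesis
    using f j(1) unfolding special_sequence_def by (intro exI[of _ "[?f]"]) auto
qed

text \<open>Zero has empty support and so does not belong to \<open>G1\<close>; it arises by
  restricting some special functional to the empty interval, which requires that a special sequence
  exists. It replaces atoms that a restriction or a removal of indices has annihilated.\<close>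

lemma atom_zero: "atom 0 {}"
proof -
  obtain gs where gs: "special gs" using special_exists by blast
  have [simp]: "restr {} f = 0" for f :: "nat \<Rightarrow>\<^sub>0 real"
    by (rule poly_mapping_eqI) (simp add: lookup_restr)
  show ?thesis
    using sp_atomI[OF gs, of "{}" "\<lambda>_. 1"] by (simp add: interval_def)
qed

lemma atom_restr:
  assumes "interval E" "atom \<phi> I"
  shows "\<exists>I'\<subseteq>I. atom (restr E \<phi>) I'"
  using assms(2)
proof (cases rule: atom_cases)
  case (special gs \<epsilon> E')
  let ?I = "{ind_G1 f |f. f \<in> set gs \<and> restr (E \<inter> E') f \<noteq> 0}"
  have "atom (restr E \<phi>) ?I"
    unfolding special(4) restr_restr using special assms by (intro sp_atomI interval_inter)
  moreover have "restr (E \<inter> E') f = 0" if "restr E' f = 0" for f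
    using that restr_restr[of E E' f] by simp
  then have "?I \<subseteq> I"
    unfolding special(5) by blast
  ultimately show ?thesis by (intro exI[of _ ?I] conjI)
next
  case (single j)
  show ?thesis
  proof (cases "restr E \<phi> = 0")
    case True
    then show ?thesis using atom_zero by auto
  next
    case False
    then have "restr E \<phi> \<in> G1_level j" using single G1_level_restr by blast
    then have "atom (restr E \<phi>) {j}"
      using single ind_G1_eq unfolding has_ind_def G1_def by auto
    then show ?thesis using single by blast
  qed
qed

lemma atom_finite_pos:
  assumes "atom \<phi> I"
  shows "finite I" "I \<subseteq> {1..}"
proof -
  have "finite I \<and> I \<subseteq> {1..}"
    using assms
  proof (cases rule: atom_cases)
    case (special gs \<epsilon> E)
    have "ind_G1 f \<ge> 1" if "f \<in> set gs" for f
      using U_seqs_nth(1)[OF special_U[OF special(1)]] that by (auto simp: in_set_conv_nth)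
    then show ?thesis unfolding special(5) by auto
  qed auto
  then show "finite I" "I \<subseteq> {1..}" by auto
qed

lemma atom_abs_le_norm:
  assumes "atom \<phi> I"
  shows "\<bar>pairing \<phi> y\<bar> \<le> (\<Sum>j\<in>I. (1 / 2) ^ j) * norm y"
  using assms
proof (cases rule: atom_cases)
  case (special gs \<epsilon> E)
  have "\<bar>pairing (\<Sum>i\<in>{..<length gs}. \<epsilon> i *\<^sub>R restr E (gs ! i)) y\<bar> \<le> (\<Sum>j\<in>I. (1 / 2) ^ j * norm y)"
    using special abs_pairing_G1_level_le_norm
    by (intro abs_pairing_pieces_le special_U) auto
  then show ?thesis
    by (simp add: special(4) restr_sum restr_scaleR sum_distrib_right)
next
  case (single j)
  then have "\<bar>pairing (restr UNIV \<phi>) y\<bar> \<le> (1 / 2) ^ j * norm y"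
    by (intro abs_pairing_G1_level_le_norm)
  moreover have "restr UNIV \<phi> = \<phi>" by (rule poly_mapping_eqI) (simp add: lookup_restr)
  ultimately show ?thesis using single by simp
qed


section \<open>Removing small indices\<close>

lemma abs_pairing_low_pieces_le:
  assumes "gs \<in> U_seqs" "K \<subseteq> {..<length gs}" "\<forall>i<length gs. \<epsilon> i \<in> {-1, 1}"
    and "(\<lambda>i. ind_G1 (gs ! i)) ` {i \<in> K. restr E (gs ! i) \<noteq> 0} \<subseteq> J" "finite J"
    and y: "\<And>n. \<bar>Poly_Mapping.lookup y n\<bar> \<le> \<kappa>"
  shows "\<bar>pairing (\<Sum>i\<in>K. \<epsilon> i *\<^sub>R restr E (gs ! i)) y\<bar> \<le> (\<Sum>j\<in>J. real (n_seq (2 * j - 1))) * \<kappa>"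
proof -
  have "\<kappa> \<ge> 0" using y[of 0] by linarith
  then have "\<bar>pairing (\<Sum>i\<in>K. \<epsilon> i *\<^sub>R restr E (gs ! i)) y\<bar> \<le> (\<Sum>j\<in>J. real (n_seq (2 * j - 1)) * \<kappa>)"
    by (intro abs_pairing_pieces_le assms(1-5) abs_pairing_G1_level_le_card y) auto
  then show ?thesis by (simp add: sum_distrib_right)
qed

text \<open>The indices of a special sequence increase along the sequence, so cutting off the small ones
  is the same as restricting to a final interval and stays inside the norming set.\<close>

lemma atom_remove_low:
  assumes "atom \<phi> I"
  shows "\<exists>\<phi>' I'. atom \<phi>' I' \<and> I' \<subseteq> I - {..p} \<and>
    (\<forall>y \<kappa>. (\<forall>n. \<bar>Poly_Mapping.lookup y n\<bar> \<le> \<kappa>) \<longrightarrow>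
      \<bar>pairing (\<phi> - \<phi>') y\<bar> \<le> (\<Sum>j\<in>I \<inter> {..p}. real (n_seq (2 * j - 1))) * \<kappa>)"
  using assms
proof (cases rule: atom_cases)
  case (special gs \<epsilon> E)
  \<comment> \<open>Indices increase strictly along \<open>gs\<close>, so the pieces of index at
    most \<open>p\<close> form an initial segment, and \<open>k\<close> is its length.\<close>
  define k where "k = length (takeWhile (\<lambda>f. ind_G1 f \<le> p) gs)"
  have gs: "gs \<in> U_seqs" using special(1) by (rule special_U)
  have k: "k \<le> length gs" by (simp add: k_def length_takeWhile_le)
  have below: "ind_G1 (gs ! i) \<le> p" if "i < k" for i
    using that unfolding k_def by (metis nth_mem set_takeWhileD takeWhile_nth)
  have above: "ind_G1 (gs ! i) > p" if "k \<le> i" "i < length gs" for i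
  proof -
    have "k < length gs" using that by simp
    then have "ind_G1 (gs ! k) > p"
      unfolding k_def using nth_length_takeWhile by force
    then show ?thesis
      using U_seqs_ind_less[OF gs, of k i] that by (cases "k = i") auto
  qed
  have low: "\<bar>pairing (\<Sum>i<k. \<epsilon> i *\<^sub>R restr E (gs ! i)) y\<bar> \<le> (\<Sum>j\<in>I \<inter> {..p}. real (n_seq (2 * j - 1))) * \<kappa>"
    if "\<forall>n. \<bar>Poly_Mapping.lookup y n\<bar> \<le> \<kappa>" for y \<kappa>
  proof (rule abs_pairing_low_pieces_le[OF gs _ special(3)])
    show "(\<lambda>i. ind_G1 (gs ! i)) ` {i \<in> {..<k}. restr E (gs ! i) \<noteq> 0} \<subseteq> I \<inter> {..p}"
      using below k by (force simp: special(5))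
  qed (use that k in auto)
  have \<phi>: "\<phi> = (\<Sum>i<length gs. \<epsilon> i *\<^sub>R restr E (gs ! i))"
    by (simp add: special(4) restr_sum restr_scaleR)
  show ?thesis
  proof (cases "k = length gs")
    case True
    then show ?thesis
      using atom_zero low \<phi> by (intro exI[of _ 0] exI[of _ "{}"]) auto
  next
    case False
    then have k: "k < length gs" using k by simp
    let ?E = "E \<inter> {Min (Poly_Mapping.keys (gs ! k))..}"
    define \<phi>' where "\<phi>' = restr ?E (\<Sum>i<length gs. \<epsilon> i *\<^sub>R (gs ! i))"
    have \<phi>': "\<phi>' = (\<Sum>i=k..<length gs. \<epsilon> i *\<^sub>R restr E (gs ! i))"
      unfolding \<phi>'_def by (rule U_seqs_restr_tail[OF gs k])
    have "{..<length gs} = {..<k} \<union> {k..<length gs}" using k by auto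
    then have "\<phi> = (\<Sum>i<k. \<epsilon> i *\<^sub>R restr E (gs ! i)) + \<phi>'"
      unfolding \<phi> \<phi>' by (simp add: sum.union_disjoint ivl_disj_int)
    then have diff: "\<phi> - \<phi>' = (\<Sum>i<k. \<epsilon> i *\<^sub>R restr E (gs ! i))" by simp
    have "ind_G1 f \<in> I - {..p}" if f: "f \<in> set gs" "restr ?E f \<noteq> 0" for f
    proof -
      obtain i where i: "i < length gs" "f = gs ! i" using f by (auto simp: in_set_conv_nth)
      then have "k \<le> i" using U_seqs_restr_initial[OF gs _ k] f by (meson not_le)
      then have "restr E f \<noteq> 0" using U_seqs_restr_final[OF gs _ i(1)] f i by simp
      then show ?thesis using above[OF \<open>k \<le> i\<close> i(1)] f i unfolding special(5) by auto
    qed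
    then have sub: "{ind_G1 f |f. f \<in> set gs \<and> restr ?E f \<noteq> 0} \<subseteq> I - {..p}" by blast
    have "atom \<phi>' {ind_G1 f |f. f \<in> set gs \<and> restr ?E f \<noteq> 0}"
      unfolding \<phi>'_def using special by (intro sp_atomI interval_inter_atLeast)
    then show ?thesis
      using sub low unfolding diff[symmetric]
      by (intro exI[of _ \<phi>'] exI[of _ "{ind_G1 f |f. f \<in> set gs \<and> restr ?E f \<noteq> 0}"] conjI allI impI)
  qed
next
  case (single j)
  show ?thesis
  proof (cases "j \<le> p")
    case True
    have "\<bar>pairing \<phi> y\<bar> \<le> (\<Sum>j\<in>I \<inter> {..p}. real (n_seq (2 * j - 1))) * \<kappa>"
      if "\<forall>n. \<bar>Poly_Mapping.lookup y n\<bar> \<le> \<kappa>" for y \<kappa>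
    proof -
      have "restr UNIV \<phi> = \<phi>" by (rule poly_mapping_eqI) (simp add: lookup_restr)
      then show ?thesis
        using abs_pairing_G1_level_le_card[OF single(2,1), of y \<kappa> UNIV] that True single(3) by simp
    qed
    then show ?thesis using atom_zero by (intro exI[of _ 0] exI[of _ "{}"]) auto
  next
    case False
    then show ?thesis
      using assms single by (intro exI[of _ \<phi>] exI[of _ I]) auto
  qed
qed


text \<open>An inductive form of \<open>Gl2\<close>: \<open>J\<close> is the union of the index sets
  and \<open>s\<close> the exact sum of the squared coefficients. Leaving \<open>s\<close> unbounded
  allows combinations with disjoint indices to be added and rescaled only at the end;
  \<open>Gl2\<close> corresponds to \<open>s \<le> 1\<close>.\<close>

inductive l2_comb :: "(nat \<Rightarrow>\<^sub>0 real) \<Rightarrow> nat set \<Rightarrow> real \<Rightarrow> bool" where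
  zero: "l2_comb 0 {} 0"
| add: "l2_comb \<psi> J s \<Longrightarrow> atom \<phi> I \<Longrightarrow> I \<inter> J = {} \<Longrightarrow> a \<in> \<rat> \<Longrightarrow> l2_comb (\<psi> + a *\<^sub>R \<phi>) (J \<union> I) (s + a\<^sup>2)"

lemma l2_comb_nonneg: "l2_comb \<psi> J s \<Longrightarrow> 0 \<le> s"
  by (induction rule: l2_comb.induct) auto

lemma l2_comb_finite_pos: "l2_comb \<psi> J s \<Longrightarrow> finite J \<and> J \<subseteq> {1..}"
  by (induction rule: l2_comb.induct) (use atom_finite_pos in auto)

lemma l2_comb_atom: "atom \<phi> I \<Longrightarrow> l2_comb \<phi> I 1"
  using l2_comb.add[OF l2_comb.zero, of \<phi> I 1] by simp

lemma l2_comb_restr: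
  assumes "interval E"
  shows "l2_comb \<psi> J s \<Longrightarrow> \<exists>J'\<subseteq>J. l2_comb (restr E \<psi>) J' s"
proof (induction rule: l2_comb.induct)
  case zero
  then show ?case by (auto intro: l2_comb.zero)
next
  case (add \<psi> J s \<phi> I a)
  obtain J' where J': "J' \<subseteq> J" "l2_comb (restr E \<psi>) J' s" using add.IH by blast
  obtain I' where I': "I' \<subseteq> I" "atom (restr E \<phi>) I'" using atom_restr[OF assms add.hyps(2)] by blast
  have "l2_comb (restr E \<psi> + a *\<^sub>R restr E \<phi>) (J' \<union> I') (s + a\<^sup>2)"
    using J' I' add.hyps by (intro l2_comb.add) auto
  then show ?case
    using J'(1) I'(1) by (intro exI[of _ "J' \<union> I'"]) (auto simp: restr_add restr_scaleR)
qed

lemma l2_comb_scaleR: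
  assumes "r \<in> \<rat>"
  shows "l2_comb \<psi> J s \<Longrightarrow> l2_comb (r *\<^sub>R \<psi>) J (r\<^sup>2 * s)"
proof (induction rule: l2_comb.induct)
  case zero
  then show ?case by (simp add: l2_comb.zero)
next
  case (add \<psi> J s \<phi> I a)
  have "l2_comb (r *\<^sub>R \<psi> + (r * a) *\<^sub>R \<phi>) (J \<union> I) (r\<^sup>2 * s + (r * a)\<^sup>2)"
    using add assms by (intro l2_comb.add) auto
  then show ?case by (simp add: algebra_simps power_mult_distrib)
qed

lemma l2_comb_add:
  assumes "l2_comb \<psi> J s"
  shows "l2_comb \<psi>' J' s' \<Longrightarrow> J \<inter> J' = {} \<Longrightarrow> l2_comb (\<psi> + \<psi>') (J \<union> J') (s + s')"
proof (induction rule: l2_comb.induct)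
  case zero
  then show ?case using assms by simp
next
  case (add \<psi>' J' s' \<phi> I a)
  then have "l2_comb (\<psi> + \<psi>' + a *\<^sub>R \<phi>) (J \<union> J' \<union> I) (s + s' + a\<^sup>2)"
    by (intro l2_comb.add) auto
  then show ?case by (simp add: algebra_simps Un_assoc)
qed

lemma l2_comb_abs_coefficient_le: "s + a\<^sup>2 \<le> (1::real) \<Longrightarrow> 0 \<le> s \<Longrightarrow> \<bar>a\<bar> \<le> 1"
  using abs_square_le_1[of a] by linarith

text \<open>Coefficients are at most 1 in modulus and the index sets are disjoint, so the errors of
  the single atoms add up to one sum over the removed indices. The loss depends on \<open>p\<close>
  and on the size of the coordinates, not on the number of atoms.\<close>

lemma l2_comb_remove_low:
  assumes "l2_comb \<psi> J s" "s \<le> 1"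
  shows "\<exists>\<psi>' J'. l2_comb \<psi>' J' s \<and> J' \<subseteq> J - {..p} \<and>
    (\<forall>y \<kappa>. (\<forall>n. \<bar>Poly_Mapping.lookup y n\<bar> \<le> \<kappa>) \<longrightarrow>
      \<bar>pairing (\<psi> - \<psi>') y\<bar> \<le> (\<Sum>j\<in>J \<inter> {..p}. real (n_seq (2 * j - 1))) * \<kappa>)"
  using assms
proof (induction rule: l2_comb.induct)
  case zero
  then show ?case by (intro exI[of _ 0] exI[of _ "{}"]) (auto intro: l2_comb.zero)
next
  case (add \<psi> J s \<phi> I a)
  let ?w = "\<lambda>J. \<Sum>j\<in>J \<inter> {..p}. real (n_seq (2 * j - 1))"
  have a: "\<bar>a\<bar> \<le> 1" using add.prems l2_comb_nonneg[OF add.hyps(1)] by (rule l2_comb_abs_coefficient_le)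
  have "s \<le> 1" using add.prems by (smt (verit) zero_le_power2)
  then obtain \<psi>' J' where \<psi>': "l2_comb \<psi>' J' s" "J' \<subseteq> J - {..p}"
    "\<forall>y \<kappa>. (\<forall>n. \<bar>Poly_Mapping.lookup y n\<bar> \<le> \<kappa>) \<longrightarrow> \<bar>pairing (\<psi> - \<psi>') y\<bar> \<le> ?w J * \<kappa>"
    using add.IH by blast
  obtain \<phi>' I' where \<phi>': "atom \<phi>' I'" "I' \<subseteq> I - {..p}"
    "\<forall>y \<kappa>. (\<forall>n. \<bar>Poly_Mapping.lookup y n\<bar> \<le> \<kappa>) \<longrightarrow> \<bar>pairing (\<phi> - \<phi>') y\<bar> \<le> ?w I * \<kappa>"
    using atom_remove_low[OF add.hyps(2), of p] by blast
  have "l2_comb (\<psi>' + a *\<^sub>R \<phi>') (J' \<union> I') (s + a\<^sup>2)"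
    using \<psi>' \<phi>' add.hyps by (intro l2_comb.add) auto
  moreover have "J' \<union> I' \<subseteq> (J \<union> I) - {..p}" using \<psi>'(2) \<phi>'(2) by auto
  moreover have "\<bar>pairing (\<psi> + a *\<^sub>R \<phi> - (\<psi>' + a *\<^sub>R \<phi>')) y\<bar> \<le> ?w (J \<union> I) * \<kappa>"
    if y: "\<forall>n. \<bar>Poly_Mapping.lookup y n\<bar> \<le> \<kappa>" for y \<kappa>
  proof -
    have le: "\<bar>pairing (\<psi> - \<psi>') y\<bar> \<le> ?w J * \<kappa>" "\<bar>pairing (\<phi> - \<phi>') y\<bar> \<le> ?w I * \<kappa>"
      using \<psi>'(3) \<phi>'(3) y by blast+
    have "pairing (\<psi> + a *\<^sub>R \<phi> - (\<psi>' + a *\<^sub>R \<phi>')) y = pairing (\<psi> - \<psi>') y + a * pairing (\<phi> - \<phi>') y"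
      by (simp add: pairing_diff_left pairing_add_left pairing_scaleR_left algebra_simps)
    moreover have "\<bar>a * pairing (\<phi> - \<phi>') y\<bar> \<le> 1 * (?w I * \<kappa>)"
      unfolding abs_mult using a le(2) by (intro mult_mono) auto
    moreover have "?w (J \<union> I) = ?w J + ?w I"
      using add.hyps(3) by (subst sum.union_disjoint[symmetric]) (auto simp: Int_Un_distrib2)
    ultimately show ?thesis
      using le(1) by (simp add: distrib_right)
  qed
  ultimately show ?case by blast
qed

lemma l2_comb_abs_le_norm:
  "l2_comb \<psi> J s \<Longrightarrow> s \<le> 1 \<Longrightarrow> \<bar>pairing \<psi> y\<bar> \<le> (\<Sum>j\<in>J. (1 / 2) ^ j) * norm y"
proof (induction rule: l2_comb.induct)
  case zero
  then show ?case by simp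
next
  case (add \<psi> J s \<phi> I a)
  have "\<bar>a\<bar> \<le> 1" using add.prems l2_comb_nonneg[OF add.hyps(1)] by (rule l2_comb_abs_coefficient_le)
  then have "\<bar>a * pairing \<phi> y\<bar> \<le> 1 * ((\<Sum>j\<in>I. (1 / 2) ^ j) * norm y)"
    unfolding abs_mult using atom_abs_le_norm[OF add.hyps(2)] by (intro mult_mono) auto
  moreover have "s \<le> 1" using add.prems by (smt (verit) zero_le_power2)
  then have "\<bar>pairing \<psi> y\<bar> \<le> (\<Sum>j\<in>J. (1 / 2) ^ j) * norm y" by (rule add.IH)
  moreover have "(\<Sum>j\<in>J \<union> I. (1 / 2 :: real) ^ j) = (\<Sum>j\<in>J. (1 / 2) ^ j) + (\<Sum>j\<in>I. (1 / 2) ^ j)"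
    using l2_comb_finite_pos[OF add.hyps(1)] atom_finite_pos[OF add.hyps(2)] add.hyps(3)
    by (intro sum.union_disjoint) auto
  ultimately show ?case
    by (simp add: pairing_add_left pairing_scaleR_left distrib_right)
qed

lemma sum_half_powers_le:
  assumes "finite J" "J \<inter> {..q} = {}"
  shows "(\<Sum>j\<in>J. (1 / 2 :: real) ^ j) \<le> (1 / 2) ^ q"
proof -
  have sub: "J \<subseteq> {q<..<Suc (Max (insert q J))}" using assms by (auto simp: less_Suc_eq_le)
  have "(\<Sum>j\<in>{q<..<Suc m}. (1 / 2 :: real) ^ j) \<le> (1 / 2) ^ q - (1 / 2) ^ m" if "q \<le> m" for m
    using that
  proof (induction m rule: dec_induct)
    case (step m)
    then have "{q<..<Suc (Suc m)} = insert (Suc m) {q<..<Suc m}" by auto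
    then show ?case using step by simp
  qed (simp add: atLeastSucLessThan_greaterThanLessThan[symmetric])
  then have "(\<Sum>j\<in>{q<..<Suc (Max (insert q J))}. (1 / 2 :: real) ^ j) \<le> (1 / 2) ^ q"
    using assms by (smt (verit) Max_ge finite_insert insertI1 zero_le_power half_gt_zero_iff)
  moreover have "(\<Sum>j\<in>J. (1 / 2 :: real) ^ j) \<le> (\<Sum>j\<in>{q<..<Suc (Max (insert q J))}. (1 / 2) ^ j)"
    using sub by (intro sum_mono2) auto
  ultimately show ?thesis by linarith
qed

lemma l2_comb_in_Gl2:
  assumes "l2_comb \<psi> J s" "s \<le> 1"
  shows "\<psi> \<in> Gl2 fs M1 \<sigma> \<xi>"
proof -
  have "\<exists>(d::nat) a \<phi> I. 1 \<le> d \<and> \<psi> = (\<Sum>i=1..d. a i *\<^sub>R \<phi> i) \<and> (\<forall>i\<in>{1..d}. a i \<in> \<rat>) \<and>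
      (\<Sum>i=1..d. (a i)\<^sup>2) = s \<and> (\<forall>i\<in>{1..d}. atom (\<phi> i) (I i)) \<and>
      disjoint_family_on I {1..d} \<and> (\<Union>i\<in>{1..d}. I i) = J"
    using assms(1)
  proof (induction rule: l2_comb.induct)
    case zero
    \<comment> \<open>\<open>Gl2\<close> asks for at least one summand, so the empty combination is
      written as one zero term with empty index set.\<close>
    show ?case
      using atom_zero
      by (intro exI[of _ 1] exI[of _ "\<lambda>_. 0"] exI[of _ "\<lambda>_. {}"]) (auto simp: disjoint_family_on_def)
  next
    case (add \<psi> J s \<phi> I a)
    obtain d :: nat and b \<theta> H where d: "1 \<le> d" "\<psi> = (\<Sum>i=1..d. b i *\<^sub>R \<theta> i)" "\<forall>i\<in>{1..d}. b i \<in> \<rat>"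
      "(\<Sum>i=1..d. (b i)\<^sup>2) = s" "\<forall>i\<in>{1..d}. atom (\<theta> i) (H i)"
      "disjoint_family_on H {1..d}" "(\<Union>i\<in>{1..d}. H i) = J"
      using add.IH by blast
    have split: "{1..Suc d} = insert (Suc d) {1..d}" by auto
    have sums: "(\<Sum>i=1..Suc d. (b(Suc d := a)) i *\<^sub>R (\<theta>(Suc d := \<phi>)) i) = \<psi> + a *\<^sub>R \<phi>"
      "(\<Sum>i=1..Suc d. ((b(Suc d := a)) i)\<^sup>2) = s + a\<^sup>2"
      using d(2,4) by (auto intro!: sum.cong)
    have "disjoint_family_on (H(Suc d := I)) {1..Suc d}"
      using d(6,7) add.hyps(3) unfolding disjoint_family_on_def split by auto
    moreover have "(\<Union>i\<in>{1..Suc d}. (H(Suc d := I)) i) = J \<union> I"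
      unfolding split d(7)[symmetric] by auto
    moreover have "\<forall>i\<in>{1..Suc d}. (b(Suc d := a)) i \<in> \<rat>"
      "\<forall>i\<in>{1..Suc d}. atom ((\<theta>(Suc d := \<phi>)) i) ((H(Suc d := I)) i)"
      using d(3,5) add.hyps unfolding split by auto
    ultimately show ?case
      using sums by (intro exI[of _ "Suc d"] exI[of _ "b(Suc d := a)"] exI[of _ "\<theta>(Suc d := \<phi>)"]
          exI[of _ "H(Suc d := I)"]) (simp_all add: fun_upd_def)
  qed
  then show ?thesis using assms(2) unfolding Gl2_def by blast
qed

lemma Gl2_is_l2_comb:
  assumes "\<psi> \<in> Gl2 fs M1 \<sigma> \<xi>"
  shows "\<exists>J s. l2_comb \<psi> J s \<and> s \<le> 1"
proof -
  obtain d :: nat and a \<phi> I where d: "\<psi> = (\<Sum>i=1..d. a i *\<^sub>R \<phi> i)" "\<forall>i\<in>{1..d}. a i \<in> \<rat>"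
    "(\<Sum>i=1..d. (a i)\<^sup>2) \<le> 1" "\<forall>i\<in>{1..d}. atom (\<phi> i) (I i)" "disjoint_family_on I {1..d}"
    using assms unfolding Gl2_def by blast
  have "l2_comb (\<Sum>i=1..k. a i *\<^sub>R \<phi> i) (\<Union>i\<in>{1..k}. I i) (\<Sum>i=1..k. (a i)\<^sup>2)" if "k \<le> d" for k
    using that
  proof (induction k)
    case 0
    then show ?case by (simp add: l2_comb.zero)
  next
    case (Suc k)
    have "I (Suc k) \<inter> I i = {}" if "i \<in> {1..k}" for i
      using Suc.prems that by (intro disjoint_family_onD[OF d(5)]) auto
    then have "I (Suc k) \<inter> (\<Union>i\<in>{1..k}. I i) = {}" by blast
    then have "l2_comb ((\<Sum>i=1..k. a i *\<^sub>R \<phi> i) + a (Suc k) *\<^sub>R \<phi> (Suc k))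
        ((\<Union>i\<in>{1..k}. I i) \<union> I (Suc k)) ((\<Sum>i=1..k. (a i)\<^sup>2) + (a (Suc k))\<^sup>2)"
      using Suc d(2,4) by (intro l2_comb.add) auto
    moreover have "(\<Union>i\<in>{1..k}. I i) \<union> I (Suc k) = (\<Union>i\<in>{1..Suc k}. I i)"
      by (auto simp: atLeastAtMostSuc_conv)
    ultimately show ?case by simp
  qed
  from this[of d] show ?thesis using d(1,3) by auto
qed

lemma G_xi_cases:
  assumes "\<phi> \<in> G_xi fs M1 \<sigma> \<xi>"
  obtains n e where "n \<ge> 1" "e \<in> {-1, 1}" "\<phi> = Poly_Mapping.single n e"
  | J s where "l2_comb \<phi> J s" "s \<le> 1"
proof -
  consider "\<phi> \<in> G0" | J where "atom \<phi> J" | "\<phi> \<in> Gl2 fs M1 \<sigma> \<xi>"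
    using assms unfolding G_xi_def Gsp_def has_ind_def by blast
  then show ?thesis
  proof cases
    case 1
    then show ?thesis using that(1) unfolding G0_def by blast
  next
    case (2 J)
    then show ?thesis using that(2)[of J 1] l2_comb_atom by simp
  next
    case 3
    then show ?thesis using that(2) Gl2_is_l2_comb by blast
  qed
qed

text \<open>This makes the supremum defining \<open>N\<close> finite: disjoint index sets contribute
  weights with total at most 1.\<close>

lemma abs_pairing_G_xi_le_norm:
  assumes "\<phi> \<in> G_xi fs M1 \<sigma> \<xi>"
  shows "\<bar>pairing \<phi> y\<bar> \<le> norm y"
  using assms
proof (cases rule: G_xi_cases)
  case (1 n e)
  have "\<bar>pairing \<phi> y\<bar> \<le> 1 * norm y"
    by (rule abs_pairing_le_norm) (use 1 in \<open>auto simp: lookup_single when_def\<close>)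
  then show ?thesis by simp
next
  case (2 J s)
  have "(\<Sum>j\<in>J. (1 / 2 :: real) ^ j) \<le> (1 / 2) ^ 0"
    using l2_comb_finite_pos[OF 2(1)] by (intro sum_half_powers_le) auto
  then have "(\<Sum>j\<in>J. (1 / 2) ^ j) * norm y \<le> 1 * norm y"
    by (intro mult_right_mono) auto
  then show ?thesis using l2_comb_abs_le_norm[OF 2, of y] by simp
qed

section \<open>Properties of the norm \<open>N\<close>\<close>

lemma N_upper:
  assumes "\<phi> \<in> G_xi fs M1 \<sigma> \<xi>"
  shows "pairing \<phi> y \<le> N y"
  unfolding norm_G_def
proof (rule cSUP_upper[OF assms])
  show "bdd_above ((\<lambda>\<phi>. pairing \<phi> y) ` G_xi fs M1 \<sigma> \<xi>)"
    using abs_pairing_G_xi_le_norm by (intro bdd_aboveI2[of _ _ "norm y"]) (smt (verit))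
qed

lemma abs_l2_comb_le_N:
  assumes "l2_comb \<psi> J s" "s \<le> 1"
  shows "\<bar>pairing \<psi> y\<bar> \<le> N y"
proof -
  have "l2_comb (- \<psi>) J s"
    using l2_comb_scaleR[OF _ assms(1), of "-1"] by simp
  moreover have "\<theta> \<in> G_xi fs M1 \<sigma> \<xi>" if "l2_comb \<theta> J s" for \<theta>
    using l2_comb_in_Gl2[OF that assms(2)] by (simp add: G_xi_def)
  ultimately have "pairing (- \<psi>) y \<le> N y" "pairing \<psi> y \<le> N y"
    using assms(1) N_upper by blast+
  then show ?thesis by (simp add: pairing_uminus_left)
qed

lemma abs_atom_le_N: "atom \<phi> I \<Longrightarrow> \<bar>pairing \<phi> y\<bar> \<le> N y"
  using abs_l2_comb_le_N l2_comb_atom by fastforce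

lemma N_nonneg: "0 \<le> N y"
  using abs_atom_le_N[OF atom_zero] by simp

lemma abs_lookup_le_N:
  assumes "n \<ge> 1"
  shows "\<bar>Poly_Mapping.lookup y n\<bar> \<le> N y"
proof -
  have "pairing (Poly_Mapping.single n e) y \<le> N y" if "e \<in> {-1, 1}" for e
    using assms that by (intro N_upper) (auto simp: G_xi_def G0_def)
  from this[of 1] this[of "-1"] show ?thesis by (simp add: pairing_single)
qed

lemma N_leI:
  assumes "\<And>n. n \<ge> 1 \<Longrightarrow> \<bar>Poly_Mapping.lookup y n\<bar> \<le> \<kappa>"
    and "\<And>\<psi> J s. l2_comb \<psi> J s \<Longrightarrow> s \<le> 1 \<Longrightarrow> pairing \<psi> y \<le> \<kappa>"
  shows "N y \<le> \<kappa>"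
  unfolding norm_G_def
proof (rule cSUP_least)
  have "Poly_Mapping.single 1 1 \<in> G_xi fs M1 \<sigma> \<xi>" unfolding G_xi_def G0_def by blast
  then show "G_xi fs M1 \<sigma> \<xi> \<noteq> {}" by blast
  fix \<phi> assume "\<phi> \<in> G_xi fs M1 \<sigma> \<xi>"
  then show "pairing \<phi> y \<le> \<kappa>"
  proof (cases rule: G_xi_cases)
    case (1 n e)
    then show ?thesis using assms(1)[of n] by (auto simp: pairing_single)
  qed (rule assms(2))
qed

lemma N_add_le: "N (x + y) \<le> N x + N y"
  by (rule N_leI)
    (use abs_lookup_le_N[of _ x] abs_lookup_le_N[of _ y] abs_l2_comb_le_N[of _ _ _ x]
      abs_l2_comb_le_N[of _ _ _ y] in \<open>fastforce simp: lookup_add pairing_add_right\<close>)+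

lemma N_scaleR_le: "N (r *\<^sub>R x) \<le> \<bar>r\<bar> * N x"
proof (rule N_leI)
  show "\<bar>Poly_Mapping.lookup (r *\<^sub>R x) n\<bar> \<le> \<bar>r\<bar> * N x" if "n \<ge> 1" for n
    using abs_lookup_le_N[OF that] by (simp add: lookup_scaleR_real abs_mult mult_left_mono)
  show "pairing \<psi> (r *\<^sub>R x) \<le> \<bar>r\<bar> * N x" if "l2_comb \<psi> J s" "s \<le> 1" for \<psi> J s
  proof -
    have "pairing \<psi> (r *\<^sub>R x) \<le> \<bar>r\<bar> * \<bar>pairing \<psi> x\<bar>"
      unfolding pairing_scaleR_right by (simp flip: abs_mult)
    also have "\<dots> \<le> \<bar>r\<bar> * N x"
      using abs_l2_comb_le_N[OF that] by (intro mult_left_mono) auto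
    finally show ?thesis .
  qed
qed

lemma N_restr_le:
  assumes "interval E"
  shows "N (restr E y) \<le> N y"
proof (rule N_leI)
  show "\<bar>Poly_Mapping.lookup (restr E y) n\<bar> \<le> N y" if "n \<ge> 1" for n
    using abs_lookup_le_N[OF that, of y] N_nonneg[of y] by (simp add: lookup_restr)
  show "pairing \<psi> (restr E y) \<le> N y" if "l2_comb \<psi> J s" "s \<le> 1" for \<psi> J s
  proof -
    obtain J' where "l2_comb (restr E \<psi>) J' s"
      using l2_comb_restr[OF assms \<open>l2_comb \<psi> J s\<close>] by blast
    then show ?thesis
      using abs_l2_comb_le_N[OF _ that(2), of "restr E \<psi>" J' y] by (simp add: pairing_restr)
  qed
qed

text \<open>Dividing by \<open>sqrt s\<close> would normalise the combination, but this number may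
  be irrational or zero while coefficients must be rational. A rational \<open>r\<close> slightly
  above it is used instead, at the cost of an arbitrarily small error.\<close>

lemma abs_l2_comb_le_sqrt:
  assumes "l2_comb \<psi> J s"
  shows "\<bar>pairing \<psi> y\<bar> \<le> sqrt s * N y"
proof (rule field_le_epsilon)
  fix e :: real assume "e > 0"
  have s: "s \<ge> 0" using assms by (rule l2_comb_nonneg)
  let ?e = "e / (N y + 1)"
  have "sqrt s < sqrt s + ?e" using \<open>e > 0\<close> N_nonneg[of y] by simp
  then obtain r where r: "r \<in> \<rat>" "sqrt s < r" "r < sqrt s + ?e" using Rats_dense_in_real by blast
  then have "r > 0" using s by (meson le_less_trans real_sqrt_ge_zero)
  have "l2_comb ((1 / r) *\<^sub>R \<psi>) J ((1 / r)\<^sup>2 * s)"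
    using r(1) assms by (intro l2_comb_scaleR) auto
  moreover have "(1 / r)\<^sup>2 * s \<le> 1"
    using r(2) s \<open>r > 0\<close> real_le_lsqrt[of s r] sqrt_le_D[of s r]
    by (simp add: power_divide divide_le_eq)
  ultimately have "\<bar>pairing ((1 / r) *\<^sub>R \<psi>) y\<bar> \<le> N y" by (rule abs_l2_comb_le_N)
  then have "\<bar>pairing \<psi> y\<bar> \<le> r * N y"
    using \<open>r > 0\<close> by (simp add: pairing_scaleR_left abs_mult field_simps)
  also have "\<dots> \<le> (sqrt s + ?e) * N y" using r N_nonneg by (intro mult_right_mono) auto
  also have "\<dots> \<le> sqrt s * N y + e"
    using \<open>e > 0\<close> N_nonneg[of y] by (simp add: distrib_right divide_le_eq mult_left_mono)
  finally show "\<bar>pairing \<psi> y\<bar> \<le> sqrt s * N y + e" .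
qed


section \<open>Bounded completeness of the basis\<close>

definition partial_sum :: "(nat \<Rightarrow> real) \<Rightarrow> nat \<Rightarrow> (nat \<Rightarrow>\<^sub>0 real)" where
  "partial_sum c M = (\<Sum>n=1..M. Poly_Mapping.single n (c n))"

lemma lookup_partial_sum:
  "Poly_Mapping.lookup (partial_sum c M) n = (if n \<in> {1..M} then c n else 0)"
  by (simp add: partial_sum_def lookup_sum_scaleR lookup_single when_def)

lemma partial_sum_diff:
  assumes "k \<le> M" "M \<le> M'"
  shows "partial_sum c M - partial_sum c k = restr {k<..M} (partial_sum c M')"
  by (rule poly_mapping_eqI) (use assms in \<open>auto simp: lookup_minus lookup_partial_sum lookup_restr\<close>)

text \<open>With infinitely many coefficients of modulus at least \<delta>, a functional of index
  \<open>j\<close> can be placed on \<open>n_seq (2 * j - 1)\<close> of them with matching signs.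
  Its value is at least \<delta> times n / m^2, hence at least \<delta> m, which exceeds
  \<open>C\<close> for large \<open>j\<close>.\<close>

lemma bounded_partial_sums_coefficients:
  assumes bound: "\<And>M. N (partial_sum c M) \<le> C" and "\<delta> > 0"
  shows "finite {n. n \<ge> 1 \<and> \<bar>c n\<bar> \<ge> \<delta>}" (is "finite ?A")
proof (rule ccontr)
  assume inf: "infinite ?A"
  have "\<delta> * real j \<le> C" if j: "j \<ge> 2" for j :: nat
  proof -
    let ?k = "2 * j - 1"
    let ?m = "real (m_seq ?k)"
    obtain B where B: "B \<subseteq> ?A" "finite B" "card B = n_seq ?k"
      using infinite_arbitrarily_large[OF inf, of "n_seq ?k"] by blast
    have m: "?m > 0" by (simp add: m_seq_eq)
    have "m_seq ?k ^ 3 \<le> card B" using m_seq_cube_le_n_seq[of ?k] j B by simp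
    then have card: "?m ^ 3 \<le> real (card B)" by (metis of_nat_le_iff of_nat_power)
    define f where "f = (1 / ?m ^ 2) *\<^sub>R (\<Sum>i\<in>B. Poly_Mapping.single i (sgn (c i)))"
    have nonzero: "card B \<ge> 1" using card m by (cases "card B") auto
    have "f \<in> G1_level j"
      unfolding G1_level_def mem_Collect_eq f_def
      by (rule exI[of _ B], rule exI[of _ "\<lambda>i. sgn (c i)"])
        (use B nonzero \<open>\<delta> > 0\<close> in \<open>auto simp: sgn_if\<close>)
    then have "atom f {j}"
      using j ind_G1_eq[of f j] unfolding has_ind_def G1_def by auto
    moreover define M where "M = Max (insert 0 B)"
    ultimately have "pairing f (partial_sum c M) \<le> C"
      using abs_atom_le_N[of f "{j}" "partial_sum c M"] bound[of M] by simp
    have "j \<le> m_seq ?k"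
    proof -
      have "?k < 5 ^ ?k" by (rule less_exp[THEN less_le_trans]) (simp add: power_mono)
      also have "\<dots> < m_seq ?k" unfolding m_seq_eq by (rule less_exp)
      finally show ?thesis using j by simp
    qed
    then have "\<delta> * real j \<le> \<delta> * ?m" using \<open>\<delta> > 0\<close> by simp
    also have "\<dots> = ?m ^ 3 * \<delta> / ?m ^ 2" using m by (simp add: power2_eq_square power3_eq_cube)
    also have "\<dots> \<le> real (card B) * \<delta> / ?m ^ 2"
      using card \<open>\<delta> > 0\<close> by (intro divide_right_mono mult_right_mono) auto
    also have "\<dots> \<le> (\<Sum>i\<in>B. \<bar>c i\<bar>) / ?m ^ 2"
      using B by (intro divide_right_mono sum_bounded_below) auto
    also have "\<dots> = pairing f (partial_sum c M)"
    proof -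
      have "i \<in> {1..M}" if "i \<in> B" for i
        using that B by (auto simp: M_def)
      then have "pairing f (partial_sum c M) = 1 / ?m ^ 2 * (\<Sum>i\<in>B. sgn (c i) * c i)"
        by (simp add: f_def pairing_scaleR_left pairing_sum_left pairing_single lookup_partial_sum)
      then show ?thesis by (simp add: abs_sgn mult.commute)
    qed
    also have "\<dots> \<le> C" by fact
    finally show ?thesis .
  qed
  moreover obtain j :: nat where "C / \<delta> < real j" using reals_Archimedean2 by blast
  then have "C < \<delta> * real (j + 2)" using \<open>\<delta> > 0\<close> by (simp add: field_simps)
  ultimately show False by (meson le_add2 not_le)
qed

text \<open>A late block has large norm but tiny coordinates, so its norming functional keeps at
  least \<delta>/2 after losing the indices up to \<open>p\<close>. Restricting the functional to
  the block makes its value the same on all later partial sums, so that successive choices can be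
  added.\<close>

lemma large_block_functional:
  assumes bound: "\<And>M. N (partial_sum c M) \<le> C" and "\<delta> > 0"
    and gap: "\<And>M0. \<exists>k M. M0 \<le> k \<and> k \<le> M \<and> N (partial_sum c M - partial_sum c k) > \<delta>"
  shows "\<exists>\<psi> J s b. l2_comb \<psi> J s \<and> s \<le> 1 \<and> J \<inter> {..p} = {} \<and>
    (\<forall>M\<ge>b. pairing \<psi> (partial_sum c M) \<ge> \<delta> / 2)"
proof -
  \<comment> \<open>\<open>L\<close> bounds the total support size available to indices up to
    \<open>p\<close>. The term for \<open>j = 0\<close> vanishes, since truncated subtraction gives
    \<open>n_seq 0 = 0\<close>.\<close>
  define L where "L = (\<Sum>j\<le>p. real (n_seq (2 * j - 1)))"
  have L: "L \<ge> 0" by (simp add: L_def sum_nonneg)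
  \<comment> \<open>\<open>\<eta> \<le> \<delta>\<close> keeps coordinate functionals from
    witnessing the large norm; \<open>L * \<eta> \<le> \<delta> / 2\<close> pays for the removed
    indices.\<close>
  define \<eta> where "\<eta> = \<delta> / (2 * (L + 1))"
  have \<eta>: "\<eta> > 0" "\<eta> \<le> \<delta>" "L * \<eta> \<le> \<delta> / 2"
    using L \<open>\<delta> > 0\<close> by (auto simp: \<eta>_def field_simps)
  have "finite {n. n \<ge> 1 \<and> \<bar>c n\<bar> \<ge> \<eta>}" by (rule bounded_partial_sums_coefficients[OF bound \<eta>(1)])
  then obtain M0 where M0: "\<forall>n\<in>{n. n \<ge> 1 \<and> \<bar>c n\<bar> \<ge> \<eta>}. n \<le> M0"
    by (meson finite_nat_set_iff_bounded_le)
  obtain k M where kM: "M0 \<le> k" "k \<le> M" "N (partial_sum c M - partial_sum c k) > \<delta>"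
    using gap by blast
  let ?y = "partial_sum c M - partial_sum c k"
  have small: "\<bar>Poly_Mapping.lookup ?y n\<bar> \<le> \<eta>" for n
  proof (cases "n \<in> {k<..M}")
    case True
    have "\<not> (n \<ge> 1 \<and> \<bar>c n\<bar> \<ge> \<eta>)"
    proof
      assume "n \<ge> 1 \<and> \<bar>c n\<bar> \<ge> \<eta>"
      then have "n \<le> M0" using M0 by blast
      then show False using True kM(1) by simp
    qed
    then show ?thesis using True by (auto simp: lookup_minus lookup_partial_sum)
  qed (use \<eta>(1) kM(2) in \<open>auto simp: lookup_minus lookup_partial_sum\<close>)
  obtain \<psi> J s where \<psi>: "l2_comb \<psi> J s" "s \<le> 1" "pairing \<psi> ?y > \<delta>"
    using N_leI[of ?y \<delta>] small \<eta>(2) kM(3) by (meson not_le order_trans)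
  obtain \<psi>' J' where \<psi>': "l2_comb \<psi>' J' s" "J' \<subseteq> J - {..p}"
    "\<forall>y \<kappa>. (\<forall>n. \<bar>Poly_Mapping.lookup y n\<bar> \<le> \<kappa>) \<longrightarrow>
      \<bar>pairing (\<psi> - \<psi>') y\<bar> \<le> (\<Sum>j\<in>J \<inter> {..p}. real (n_seq (2 * j - 1))) * \<kappa>"
    using l2_comb_remove_low[OF \<psi>(1,2), of p] by blast
  have "\<bar>pairing (\<psi> - \<psi>') ?y\<bar> \<le> (\<Sum>j\<in>J \<inter> {..p}. real (n_seq (2 * j - 1))) * \<eta>"
    using \<psi>'(3) small by blast
  also have "\<dots> \<le> L * \<eta>"
    unfolding L_def using \<eta>(1) by (intro mult_right_mono sum_mono2) auto
  finally have large: "pairing \<psi>' ?y \<ge> \<delta> / 2"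
    using \<psi>(3) \<eta>(3) by (simp add: pairing_diff_left)
  have "interval {k<..M}" by (auto simp: interval_def)
  then obtain J'' where J'': "J'' \<subseteq> J'" "l2_comb (restr {k<..M} \<psi>') J'' s"
    using l2_comb_restr[OF _ \<psi>'(1)] by blast
  have "pairing (restr {k<..M} \<psi>') (partial_sum c M') \<ge> \<delta> / 2" if "M \<le> M'" for M'
    using large unfolding pairing_restr partial_sum_diff[OF kM(2) that] .
  then show ?thesis
    using J'' \<psi>'(2) \<psi>(2)
    by (intro exI[of _ "restr {k<..M} \<psi>'"] exI[of _ J''] exI[of _ s] exI[of _ M]) auto
qed

text \<open>Functionals with disjoint index sets norming successive blocks give a lower
  \<open>\<ell>\<^sub>2\<close>-estimate, which is incompatible with bounded partial sums.\<close>

lemma boundedly_complete: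
  assumes bound: "\<And>M. N (partial_sum c M) \<le> C" and "\<delta> > 0"
  shows "\<exists>M0. \<forall>k M. M0 \<le> k \<longrightarrow> k \<le> M \<longrightarrow> N (partial_sum c M - partial_sum c k) \<le> \<delta>"
proof (rule ccontr)
  assume "\<not> ?thesis"
  then have gap: "\<exists>k M. M0 \<le> k \<and> k \<le> M \<and> N (partial_sum c M - partial_sum c k) > \<delta>" for M0
    by (meson not_le)
  have blocks: "\<exists>\<psi> J s b. l2_comb \<psi> J s \<and> s \<le> real K \<and>
      (\<forall>M\<ge>b. pairing \<psi> (partial_sum c M) \<ge> real K * (\<delta> / 2))" for K
  proof (induction K)
    case 0
    show ?case by (intro exI[of _ 0] exI[of _ "{}"]) (auto intro: l2_comb.zero)
  next
    case (Suc K)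
    then obtain \<psi> J s b where \<psi>: "l2_comb \<psi> J s" "s \<le> real K"
      "\<forall>M\<ge>b. pairing \<psi> (partial_sum c M) \<ge> real K * (\<delta> / 2)" by blast
    have "finite J" using l2_comb_finite_pos[OF \<psi>(1)] by simp
    then obtain p where p: "J \<subseteq> {..p}" using finite_nat_iff_bounded_le by blast
    obtain \<psi>' J' s' b' where \<psi>': "l2_comb \<psi>' J' s'" "s' \<le> 1" "J' \<inter> {..p} = {}"
      "\<forall>M\<ge>b'. pairing \<psi>' (partial_sum c M) \<ge> \<delta> / 2"
      using large_block_functional[OF bound \<open>\<delta> > 0\<close> gap, of p] by blast
    have "l2_comb (\<psi> + \<psi>') (J \<union> J') (s + s')"
      using \<psi> \<psi>' p by (intro l2_comb_add) auto
    moreover have "pairing (\<psi> + \<psi>') (partial_sum c M) \<ge> real (Suc K) * (\<delta> / 2)" if "M \<ge> max b b'" for M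
    proof -
      have "pairing \<psi> (partial_sum c M) \<ge> real K * (\<delta> / 2)" "pairing \<psi>' (partial_sum c M) \<ge> \<delta> / 2"
        using \<psi>(3) \<psi>'(4) that by auto
      then show ?thesis by (simp add: pairing_add_left algebra_simps)
    qed
    moreover have "s + s' \<le> real (Suc K)" using \<psi>(2) \<psi>'(2) by simp
    ultimately show ?case by blast
  qed
  \<comment> \<open>A square number of blocks keeps the normalising factor \<open>1 / real q\<close>
    rational: the squared coefficients sum to at most 1 while the value is still at least
    \<open>q\<close> times \<delta>/2.\<close>
  have "real q * (\<delta> / 2) \<le> C" if "q \<ge> 1" for q :: nat
  proof -
    obtain \<psi> J s b where \<psi>: "l2_comb \<psi> J s" "s \<le> real (q\<^sup>2)"
      "\<forall>M\<ge>b. pairing \<psi> (partial_sum c M) \<ge> real (q\<^sup>2) * (\<delta> / 2)" using blocks[of "q\<^sup>2"] by blast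
    have "l2_comb ((1 / real q) *\<^sub>R \<psi>) J ((1 / real q)\<^sup>2 * s)"
      using \<psi>(1) by (intro l2_comb_scaleR) auto
    moreover have "(1 / real q)\<^sup>2 * s \<le> 1"
      using \<psi>(2) that by (simp add: power_divide divide_le_eq)
    ultimately have "\<bar>pairing ((1 / real q) *\<^sub>R \<psi>) (partial_sum c b)\<bar> \<le> C"
      using abs_l2_comb_le_N bound order_trans by blast
    moreover have "pairing \<psi> (partial_sum c b) \<ge> real (q\<^sup>2) * (\<delta> / 2)" using \<psi>(3) by blast
    then have "(1 / real q) * pairing \<psi> (partial_sum c b) \<ge> (1 / real q) * (real (q\<^sup>2) * (\<delta> / 2))"
      by (intro mult_left_mono) auto
    ultimately have "(1 / real q) * (real (q\<^sup>2) * (\<delta> / 2)) \<le> C"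
      unfolding pairing_scaleR_left by linarith
    then show ?thesis
      using that by (simp add: power2_eq_square)
  qed
  moreover obtain q :: nat where "C / (\<delta> / 2) < real q" using reals_Archimedean2 by blast
  then have "C < real (q + 1) * (\<delta> / 2)" using \<open>\<delta> > 0\<close> by (simp add: field_simps)
  ultimately show False by (meson le_add2 not_le)
qed


section \<open>Convex sets of vectors on which functionals are small\<close>

text \<open>A good family plays the role of the sets of convex combinations of the tails of a bounded
  sequence with coordinates tending to zero; attainable conditions can be imposed on all its
  members simultaneously.\<close>

definition good :: "(nat \<Rightarrow> (nat \<Rightarrow>\<^sub>0 real) set) \<Rightarrow> bool" where
  "good Y \<longleftrightarrow> (\<forall>n. Y n \<noteq> {} \<and> convex (Y n) \<and> Y (Suc n) \<subseteq> Y n \<and>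
     (\<forall>y\<in>Y n. N y \<le> 1 \<and> (\<forall>k. \<bar>Poly_Mapping.lookup y k\<bar> \<le> 1 / (real n + 1))))"

definition attainable :: "(nat \<Rightarrow>\<^sub>0 real) set \<Rightarrow> bool" where
  "attainable Q \<longleftrightarrow> convex Q \<and> (\<forall>Y. good Y \<longrightarrow> Y 0 \<inter> Q \<noteq> {})"

lemma good_shift:
  assumes "good Y"
  shows "good (\<lambda>k. Y (n + k))"
proof -
  have "1 / (real (n + k) + 1) \<le> 1 / (real k + 1)" for k
    by (intro divide_left_mono) auto
  then have "\<forall>y\<in>Y (n + k). N y \<le> 1 \<and> (\<forall>i. \<bar>Poly_Mapping.lookup y i\<bar> \<le> 1 / (real k + 1))" for k
    using assms order_trans unfolding good_def by blast
  then show ?thesis using assms unfolding good_def by auto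
qed

lemma attainable_meets: "attainable Q \<Longrightarrow> good Y \<Longrightarrow> Y n \<inter> Q \<noteq> {}"
  using good_shift[of Y n] unfolding attainable_def by fastforce

lemma attainable_ex: "attainable {y. P y} \<Longrightarrow> good Y \<Longrightarrow> \<exists>y\<in>Y 0. P y"
  unfolding attainable_def by blast

text \<open>Attainability quantifies over all good families precisely for this: after one condition
  is imposed, the smaller sets again form a good family, in which the next condition can be met.
  Shifting the family shows that a condition is met at every level, not only in
  \<open>Y 0\<close>.\<close>

lemma good_Int:
  assumes "good Y" "attainable Q"
  shows "good (\<lambda>n. Y n \<inter> Q)"
  using assms attainable_meets[OF assms(2,1)] unfolding good_def attainable_def
  by (auto intro: convex_Int)

lemma attainable_Int:
  assumes "attainable Q" "attainable R"
  shows "attainable (Q \<inter> R)"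
proof -
  have "Y 0 \<inter> (Q \<inter> R) \<noteq> {}" if "good Y" for Y
    using attainable_meets[OF assms(2) good_Int[OF that assms(1)], of 0] by auto
  then show ?thesis using assms by (auto simp: attainable_def convex_Int)
qed

lemma attainable_INT:
  assumes "finite C" "\<And>c. c \<in> C \<Longrightarrow> attainable (Q c)"
  shows "attainable (\<Inter>c\<in>C. Q c)"
  using assms
proof (induction C rule: finite_induct)
  case empty
  then show ?case by (auto simp: attainable_def good_def)
next
  case (insert c C)
  then show ?case by (simp add: attainable_Int)
qed

lemma attainable_mono: "attainable Q \<Longrightarrow> Q \<subseteq> R \<Longrightarrow> convex R \<Longrightarrow> attainable R"
  unfolding attainable_def by blast

lemma convex_abs_pairing_le: "convex {y. \<forall>\<phi>\<in>\<Phi>. \<bar>pairing \<phi> y\<bar> \<le> \<eta>}"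
proof (rule convexI)
  fix x y and u v :: real
  assume xy: "x \<in> {y. \<forall>\<phi>\<in>\<Phi>. \<bar>pairing \<phi> y\<bar> \<le> \<eta>}" "y \<in> {y. \<forall>\<phi>\<in>\<Phi>. \<bar>pairing \<phi> y\<bar> \<le> \<eta>}"
    and uv: "0 \<le> u" "0 \<le> v" "u + v = 1"
  have "\<bar>pairing \<phi> (u *\<^sub>R x + v *\<^sub>R y)\<bar> \<le> \<eta>" if "\<phi> \<in> \<Phi>" for \<phi>
  proof -
    have "\<bar>pairing \<phi> (u *\<^sub>R x + v *\<^sub>R y)\<bar> \<le> u * \<bar>pairing \<phi> x\<bar> + v * \<bar>pairing \<phi> y\<bar>"
      unfolding pairing_add_right pairing_scaleR_right
      using uv abs_triangle_ineq[of "u * pairing \<phi> x" "v * pairing \<phi> y"] by (simp add: abs_mult)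
    also have "\<dots> \<le> u * \<eta> + v * \<eta>"
      using xy uv that by (intro add_mono mult_left_mono) auto
    finally show ?thesis using uv by (simp flip: distrib_right)
  qed
  then show "u *\<^sub>R x + v *\<^sub>R y \<in> {y. \<forall>\<phi>\<in>\<Phi>. \<bar>pairing \<phi> y\<bar> \<le> \<eta>}" by blast
qed

text \<open>Here \<open>z\<close> stands for an unnormalised sum of \<open>Suc K\<close> vectors, to
  which \<open>x\<close> is added. Keeping sums instead of averages lets the inductive estimates
  below be purely additive.\<close>

lemma convex_average:
  assumes "convex S" "x \<in> S" "(1 / real (Suc K)) *\<^sub>R z \<in> S"
  shows "(1 / real (Suc (Suc K))) *\<^sub>R (x + z) \<in> S"
proof -
  let ?u = "1 / real (Suc (Suc K))" and ?v = "real (Suc K) / real (Suc (Suc K))"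
  have "?u *\<^sub>R x + ?v *\<^sub>R ((1 / real (Suc K)) *\<^sub>R z) \<in> S"
    using assms by (intro convexD) (auto simp: field_simps)
  then show ?thesis by (simp add: scaleR_add_right)
qed

lemma exists_half_power_mult_le:
  assumes "0 < (\<eta>::real)"
  shows "\<exists>q. \<forall>j\<ge>q. (1 / 2) ^ j * b \<le> \<eta>"
proof -
  have "(\<lambda>j. (1 / 2) ^ j * b) \<longlonglongrightarrow> 0 * b"
    by (intro tendsto_mult tendsto_const LIMSEQ_realpow_zero) auto
  then have "eventually (\<lambda>j. (1 / 2) ^ j * b < \<eta>) sequentially"
    using assms by (intro order_tendstoD) auto
  then show ?thesis unfolding eventually_sequentially by (meson less_imp_le)
qed

text \<open>Vectors are chosen one after the other and then averaged. A functional is small on the vectors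
  chosen before its rank is exceeded (by \<open>high\<close>) and on those chosen later (by \<open>low\<close>), so it is
  large on at most one of them.\<close>

lemma attainable_by_rank:
  fixes \<Phi> :: "((nat \<Rightarrow>\<^sub>0 real) \<times> nat) set"
  assumes le_N: "\<And>\<phi> r y. (\<phi>, r) \<in> \<Phi> \<Longrightarrow> \<bar>pairing \<phi> y\<bar> \<le> N y"
    and high: "\<And>y \<eta>. 0 < \<eta> \<Longrightarrow> \<exists>q. \<forall>(\<phi>, r)\<in>\<Phi>. q < r \<longrightarrow> \<bar>pairing \<phi> y\<bar> \<le> \<eta>"
    and low: "\<And>q \<eta>. 0 < \<eta> \<Longrightarrow> attainable {y. \<forall>\<phi>\<in>{\<phi>. \<exists>r\<le>q. (\<phi>, r) \<in> \<Phi>}. \<bar>pairing \<phi> y\<bar> \<le> \<eta>}"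
    and "0 < \<eta>"
  shows "attainable {y. \<forall>\<phi>\<in>fst ` \<Phi>. \<bar>pairing \<phi> y\<bar> \<le> \<eta>}"
  unfolding attainable_def
proof (intro conjI allI impI)
  fix Y assume Y: "good Y"
  define \<theta> where "\<theta> = \<eta> / 2"
  have \<theta>: "\<theta> > 0" using \<open>0 < \<eta>\<close> by (simp add: \<theta>_def)
  have Y0: "convex (Y 0)" "\<And>y. y \<in> Y 0 \<Longrightarrow> N y \<le> 1" using Y by (auto simp: good_def)
  \<comment> \<open>The summand 1 allows for the single vector on which a functional may be large.
    The bound \<open>q\<close> is arbitrary in the induction because vectors are added at the front:
    \<open>x\<close> is chosen first and determines \<open>q'\<close>, then the remaining sum is
    chosen to be small for all ranks up to \<open>max q q'\<close>.\<close>
  have "\<exists>z. (1 / real (Suc K)) *\<^sub>R z \<in> Y 0 \<and> (\<forall>(\<phi>, r)\<in>\<Phi>. \<bar>pairing \<phi> z\<bar> \<le> 1 + real (Suc K) * \<theta> \<and>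
      (r \<le> q \<longrightarrow> \<bar>pairing \<phi> z\<bar> \<le> real (Suc K) * \<theta>))" for K q :: nat
  proof (induction K arbitrary: q)
    case 0
    obtain z where z: "z \<in> Y 0" "\<forall>\<phi>\<in>{\<phi>. \<exists>r\<le>q. (\<phi>, r) \<in> \<Phi>}. \<bar>pairing \<phi> z\<bar> \<le> \<theta>"
      using attainable_ex[OF low[OF \<theta>, of q] Y] by (rule bexE)
    have "\<bar>pairing \<phi> z\<bar> \<le> 1" if "(\<phi>, r) \<in> \<Phi>" for \<phi> r
      using le_N[OF that] Y0(2)[OF z(1)] order_trans by blast
    then have "\<bar>pairing \<phi> z\<bar> \<le> 1 + \<theta>" if "(\<phi>, r) \<in> \<Phi>" for \<phi> r
      using that \<theta> by fastforce
    then show ?case using z by (intro exI[of _ z]) auto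
  next
    case (Suc K)
    obtain x where x: "x \<in> Y 0" "\<forall>\<phi>\<in>{\<phi>. \<exists>r\<le>q. (\<phi>, r) \<in> \<Phi>}. \<bar>pairing \<phi> x\<bar> \<le> \<theta>"
      using attainable_ex[OF low[OF \<theta>, of q] Y] by (rule bexE)
    obtain q' where q': "\<forall>(\<phi>, r)\<in>\<Phi>. q' < r \<longrightarrow> \<bar>pairing \<phi> x\<bar> \<le> \<theta>" using high[OF \<theta>] by blast
    obtain z where z: "(1 / real (Suc K)) *\<^sub>R z \<in> Y 0"
      "\<forall>(\<phi>, r)\<in>\<Phi>. \<bar>pairing \<phi> z\<bar> \<le> 1 + real (Suc K) * \<theta> \<and>
         (r \<le> max q q' \<longrightarrow> \<bar>pairing \<phi> z\<bar> \<le> real (Suc K) * \<theta>)"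
      using Suc.IH[of "max q q'"] by blast
    have "\<bar>pairing \<phi> (x + z)\<bar> \<le> 1 + real (Suc (Suc K)) * \<theta> \<and>
        (r \<le> q \<longrightarrow> \<bar>pairing \<phi> (x + z)\<bar> \<le> real (Suc (Suc K)) * \<theta>)" if "(\<phi>, r) \<in> \<Phi>" for \<phi> r
    proof -
      have *: "\<bar>pairing \<phi> z\<bar> \<le> 1 + real (Suc K) * \<theta>"
        "r \<le> max q q' \<Longrightarrow> \<bar>pairing \<phi> z\<bar> \<le> real (Suc K) * \<theta>"
        using z(2) that by auto
      have x_le: "\<bar>pairing \<phi> x\<bar> \<le> 1" "r \<le> q \<Longrightarrow> \<bar>pairing \<phi> x\<bar> \<le> \<theta>" "\<not> r \<le> q' \<Longrightarrow> \<bar>pairing \<phi> x\<bar> \<le> \<theta>"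
        using le_N[OF that, of x] Y0(2)[OF x(1)] x(2) q' that by (linarith, blast, auto)
      have sum: "\<bar>pairing \<phi> (x + z)\<bar> \<le> \<bar>pairing \<phi> x\<bar> + \<bar>pairing \<phi> z\<bar>"
        by (simp add: pairing_add_right)
      have eq: "real (Suc (Suc K)) * \<theta> = \<theta> + real (Suc K) * \<theta>"
        by (simp add: algebra_simps)
      show ?thesis
      proof (intro conjI impI)
        show "\<bar>pairing \<phi> (x + z)\<bar> \<le> 1 + real (Suc (Suc K)) * \<theta>"
        proof (cases "r \<le> q'")
          case True
          then have "\<bar>pairing \<phi> z\<bar> \<le> real (Suc K) * \<theta>" by (intro *(2)) simp
          then show ?thesis using x_le(1) sum eq \<theta> by linarith
        next
          case False
          then show ?thesis using x_le(3) *(1) sum eq by linarith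
        qed
        assume "r \<le> q"
        moreover from this have "\<bar>pairing \<phi> z\<bar> \<le> real (Suc K) * \<theta>" by (intro *(2)) simp
        ultimately show "\<bar>pairing \<phi> (x + z)\<bar> \<le> real (Suc (Suc K)) * \<theta>"
          using x_le(2) sum eq by linarith
      qed
    qed
    then show ?case
      using convex_average[OF Y0(1) x(1) z(1)] by (intro exI[of _ "x + z"]) auto
  qed
  note averages = this
  \<comment> \<open>After division by the number of vectors the exceptional 1 costs less than
    \<theta>, giving a total of at most 2 \<theta> = \<eta>.\<close>
  obtain K where "1 / real (Suc K) < \<theta>" using nat_approx_posE[OF \<theta>] .
  obtain z where z: "(1 / real (Suc K)) *\<^sub>R z \<in> Y 0"
    "\<forall>(\<phi>, r)\<in>\<Phi>. \<bar>pairing \<phi> z\<bar> \<le> 1 + real (Suc K) * \<theta>"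
    using averages[of K 0] by fast
  have "\<bar>pairing \<phi> ((1 / real (Suc K)) *\<^sub>R z)\<bar> \<le> \<eta>" if "\<phi> \<in> fst ` \<Phi>" for \<phi>
  proof -
    have "\<bar>pairing \<phi> z\<bar> \<le> 1 + real (Suc K) * \<theta>" using z(2) that by auto
    then have "(1 / real (Suc K)) * \<bar>pairing \<phi> z\<bar> \<le> (1 / real (Suc K)) * (1 + real (Suc K) * \<theta>)"
      by (intro mult_left_mono) auto
    also have "\<dots> = 1 / real (Suc K) + \<theta>" by (simp add: field_simps)
    finally show ?thesis
      using \<open>1 / real (Suc K) < \<theta>\<close> by (simp add: pairing_scaleR_right abs_mult \<theta>_def)
  qed
  then show "Y 0 \<inter> {y. \<forall>\<phi>\<in>fst ` \<Phi>. \<bar>pairing \<phi> y\<bar> \<le> \<eta>} \<noteq> {}" using z(1) by blast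
qed (rule convex_abs_pairing_le)

definition pieces :: "((nat \<Rightarrow>\<^sub>0 real) \<times> nat) set" where
  "pieces = {(restr E f, j) |E f j. interval E \<and> j \<ge> 1 \<and> f \<in> G1_level j}"

text \<open>The rank of a piece is its index. High ranks are handled by the geometric weights on a
  fixed vector, low ranks by the shrinking coordinates in a good family.\<close>

lemma attainable_pieces:
  assumes "0 < \<eta>"
  shows "attainable {y. \<forall>\<phi>\<in>fst ` pieces. \<bar>pairing \<phi> y\<bar> \<le> \<eta>}"
proof (rule attainable_by_rank[OF _ _ _ assms])
  fix \<phi> r y assume "(\<phi>, r) \<in> pieces"
  then obtain E f where f: "\<phi> = restr E f" "interval E" "r \<ge> 1" "f \<in> G1_level r"
    by (auto simp: pieces_def)
  then have "atom f {r}"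
    using ind_G1_eq[of f r] unfolding has_ind_def G1_def by auto
  then show "\<bar>pairing \<phi> y\<bar> \<le> N y"
    using atom_restr[OF f(2)] abs_atom_le_N f(1) by blast
next
  fix y :: "nat \<Rightarrow>\<^sub>0 real" and \<eta> :: real assume "0 < \<eta>"
  then obtain q where q: "\<forall>j\<ge>q. (1 / 2) ^ j * norm y \<le> \<eta>" using exists_half_power_mult_le by blast
  have "\<bar>pairing \<phi> y\<bar> \<le> \<eta>" if r: "(\<phi>, r) \<in> pieces" "q < r" for \<phi> r
  proof -
    have "\<bar>pairing \<phi> y\<bar> \<le> (1 / 2) ^ r * norm y"
      using r(1) abs_pairing_G1_level_le_norm by (auto simp: pieces_def)
    also have "\<dots> \<le> \<eta>" using q r(2) by simp
    finally show ?thesis .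
  qed
  then show "\<exists>q. \<forall>(\<phi>, r)\<in>pieces. q < r \<longrightarrow> \<bar>pairing \<phi> y\<bar> \<le> \<eta>" by blast
next
  fix q :: nat and \<eta> :: real assume "0 < \<eta>"
  define L where "L = (\<Sum>j\<le>q. real (n_seq (2 * j - 1)))"
  define \<kappa> where "\<kappa> = \<eta> / (L + 1)"
  have L: "L \<ge> 0" by (simp add: L_def sum_nonneg)
  then have \<kappa>: "\<kappa> > 0" "L * \<kappa> \<le> \<eta>" using \<open>0 < \<eta>\<close> by (auto simp: \<kappa>_def field_simps)
  let ?Q = "{y. \<forall>\<phi>\<in>{\<phi>. \<exists>r\<le>q. (\<phi>, r) \<in> pieces}. \<bar>pairing \<phi> y\<bar> \<le> \<eta>}"
  show "attainable ?Q"
    unfolding attainable_def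
  proof (intro conjI allI impI)
    fix Y assume Y: "good Y"
    obtain n where n: "1 / real (Suc n) < \<kappa>" using nat_approx_posE[OF \<kappa>(1)] .
    obtain y where y: "y \<in> Y n" using Y unfolding good_def by blast
    have "\<forall>k. \<bar>Poly_Mapping.lookup y k\<bar> \<le> 1 / (real n + 1)" using Y y by (auto simp: good_def)
    moreover have "1 / (real n + 1) \<le> \<kappa>" using n by (simp add: add.commute)
    ultimately have small: "\<bar>Poly_Mapping.lookup y k\<bar> \<le> \<kappa>" for k
      using order_trans by blast
    have "\<bar>pairing (restr E f) y\<bar> \<le> \<eta>" if "j \<le> q" "j \<ge> 1" "f \<in> G1_level j" for E f j
    proof -
      have "\<bar>pairing (restr E f) y\<bar> \<le> real (n_seq (2 * j - 1)) * \<kappa>"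
        using abs_pairing_G1_level_le_card[OF that(3,2) small] .
      also have "\<dots> \<le> L * \<kappa>"
        unfolding L_def using that(1) \<kappa>(1)
        by (intro mult_right_mono member_le_sum) auto
      finally show ?thesis using \<kappa>(2) by simp
    qed
    then have "y \<in> ?Q" by (auto simp: pieces_def)
    moreover have "decseq Y" using Y by (auto simp: good_def decseq_Suc_iff)
    then have "y \<in> Y 0" using y decseqD[of Y 0 n] by auto
    ultimately show "Y 0 \<inter> ?Q \<noteq> {}" by blast
  qed (rule convex_abs_pairing_le)
qed

section \<open>The tree of special sequences\<close>

definition initial :: "(nat \<Rightarrow>\<^sub>0 real) list \<Rightarrow> bool" where
  "initial s \<longleftrightarrow> (\<exists>gs. special gs \<and> length s \<le> length gs \<and> take (length s) gs = s)"

text \<open>What special functionals can contribute beyond the node \<open>s\<close> of the tree. At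
  the root, \<open>tails []\<close> consists of all special functionals; if \<open>gs\<close> ends
  at \<open>s\<close>, the contribution is zero.\<close>

definition tails :: "(nat \<Rightarrow>\<^sub>0 real) list \<Rightarrow> (nat \<Rightarrow>\<^sub>0 real) set" where
  "tails s = {(\<Sum>i=length s..<length gs. \<epsilon> i *\<^sub>R restr E (gs ! i)) |gs \<epsilon> E.
     special gs \<and> length s \<le> length gs \<and> take (length s) gs = s \<and> interval E \<and>
     (\<forall>i<length gs. \<epsilon> i \<in> {-1, 1})}"

lemma tailsI:
  assumes "special gs" "length s \<le> length gs" "take (length s) gs = s" "interval E"
    "\<forall>i<length gs. \<epsilon> i \<in> {-1, 1}"
  shows "(\<Sum>i=length s..<length gs. \<epsilon> i *\<^sub>R restr E (gs ! i)) \<in> tails s"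
  unfolding tails_def using assms by blast

definition minima :: "(nat \<Rightarrow>\<^sub>0 real) list \<Rightarrow> nat set" where
  "minima s = (\<lambda>f. Min (Poly_Mapping.keys f)) ` set s"

lemma initial_U_seqs:
  assumes "initial s" "s \<noteq> []"
  shows "s \<in> U_seqs"
proof -
  obtain gs where "special gs" "take (length s) gs = s" using assms by (auto simp: initial_def)
  moreover have "length s \<ge> 1" using assms(2) by (simp add: Suc_le_eq)
  ultimately show ?thesis using U_seqs_take[OF special_U] by metis
qed

lemma schreier_minima:
  assumes "initial s"
  shows "schreier fs \<xi> (minima s)"
proof -
  obtain gs where gs: "special gs" "take (length s) gs = s" using assms by (auto simp: initial_def)
  have "minima s \<subseteq> minima gs" unfolding minima_def using gs(2) set_take_subset by (metis image_mono)
  moreover have "schreier fs \<xi> (minima gs)"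
    using gs(1) by (simp add: special_sequence_def minima_def)
  ultimately show ?thesis using schreier_subset by blast
qed

lemma card_minima:
  assumes "s \<in> U_seqs"
  shows "card (minima s) = length s"
proof -
  have less: "Min (Poly_Mapping.keys (s ! i)) < Min (Poly_Mapping.keys (s ! k))"
    if "i < k" "k < length s" for i k
    using that U_seqs_nth(3)[OF assms, of i] U_seqs_nth(3)[OF assms, of k]
    by (intro U_seqs_block_less[OF assms that] Min_in) auto
  have "distinct (map (\<lambda>f. Min (Poly_Mapping.keys f)) s)"
    unfolding distinct_conv_nth
  proof (intro allI impI)
    fix i k assume "i < length (map (\<lambda>f. Min (Poly_Mapping.keys f)) s)"
      "k < length (map (\<lambda>f. Min (Poly_Mapping.keys f)) s)" "i \<noteq> k"
    then show "map (\<lambda>f. Min (Poly_Mapping.keys f)) s ! i \<noteq> map (\<lambda>f. Min (Poly_Mapping.keys f)) s ! k"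
      using less[of i k] less[of k i] by (cases "i < k") auto
  qed
  from distinct_card[OF this] show ?thesis by (simp add: minima_def)
qed

text \<open>Children are the smaller elements. Along an infinite branch the minima of the supports
  form an infinite set, each finite subset of which lies among the minima of some node and is
  therefore Schreier, against \<open>schreier_compact\<close>.\<close>

lemma wf_special_tree: "wf {(s @ [f], s) |s f. initial (s @ [f])}"
  unfolding wf_iff_no_infinite_down_chain
proof
  assume "\<exists>g. \<forall>i. (g (Suc i), g i) \<in> {(s @ [f], s) |s f. initial (s @ [f])}"
  then obtain g where g: "\<And>i. (g (Suc i), g i) \<in> {(s @ [f], s) |s f. initial (s @ [f])}" by blast
  have step: "\<exists>f. g (Suc i) = g i @ [f]" and init: "initial (g (Suc i))" for i
    using g[of i] by auto
  have len: "length (g i) \<ge> i" for i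
  proof (induction i)
    case (Suc i)
    then show ?case using step[of i] by auto
  qed simp
  define A where "A i = minima (g (Suc i))" for i
  have "A i \<subseteq> A (Suc i)" for i
    using step[of "Suc i"] by (auto simp: A_def minima_def)
  then have mono: "A i \<subseteq> A k" if "i \<le> k" for i k
    using that by (rule lift_Suc_mono_le)
  have cardA: "card (A i) = length (g (Suc i))" for i
    unfolding A_def using step[of i] init[of i] by (intro card_minima initial_U_seqs) auto
  have "infinite (\<Union>i. A i)"
  proof
    assume fin: "finite (\<Union>i. A i)"
    let ?c = "card (\<Union>i. A i)"
    have "card (A ?c) \<le> ?c" using fin by (intro card_mono) auto
    then show False using len[of "Suc ?c"] cardA[of ?c] by simp
  qed
  then obtain B where B: "B \<subseteq> (\<Union>i. A i)" "finite B" "\<not> schreier fs \<xi> B"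
    using schreier_compact[OF fundamental] by blast
  have "\<exists>i. B \<subseteq> A i"
    using B(2,1)
  proof (induction B rule: finite_induct)
    case (insert b B)
    then obtain i k where "B \<subseteq> A i" "b \<in> A k" by auto
    then have "insert b B \<subseteq> A (max i k)"
      using mono[of i "max i k"] mono[of k "max i k"] by auto
    then show ?case by blast
  qed simp
  then show False
    using B(3) schreier_subset[OF schreier_minima[OF init]] unfolding A_def by blast
qed

lemma tails_abs_le_N:
  assumes "\<phi> \<in> tails s"
  shows "\<bar>pairing \<phi> y\<bar> \<le> N y"
proof -
  obtain gs \<epsilon> E where gs: "\<phi> = (\<Sum>i=length s..<length gs. \<epsilon> i *\<^sub>R restr E (gs ! i))" "special gs"
    "length s \<le> length gs" "interval E" "\<forall>i<length gs. \<epsilon> i \<in> {-1, 1}"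
    using assms unfolding tails_def by blast
  show ?thesis
  proof (cases "length s = length gs")
    case True
    then show ?thesis by (simp add: gs(1) N_nonneg)
  next
    case False
    then have lt: "length s < length gs" using gs(3) by simp
    show ?thesis
      unfolding gs(1) U_seqs_restr_tail[OF special_U[OF gs(2)] lt, symmetric]
      by (rule abs_atom_le_N[OF sp_atomI[OF gs(2) interval_inter_atLeast[OF gs(4)] gs(5)]])
  qed
qed

lemma coding_ge_1:
  assumes "s \<in> U_seqs"
  shows "\<sigma> s \<ge> 1"
  using assms coding partition by (auto simp: coding_function_def partition_of_naturals_def)

text \<open>The first piece after \<open>s\<close> has index \<open>\<sigma> s\<close> and later
  indices are larger, so the weights form a geometric tail starting there. For the empty
  \<open>s\<close> this fails, since the first index of a special sequence is not prescribed by a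
  code.\<close>

lemma tails_abs_le_norm:
  assumes "\<phi> \<in> tails s" "s \<noteq> []"
  shows "\<bar>pairing \<phi> y\<bar> \<le> (1 / 2) ^ (\<sigma> s - 1) * norm y"
proof -
  obtain gs \<epsilon> E where gs: "\<phi> = (\<Sum>i=length s..<length gs. \<epsilon> i *\<^sub>R restr E (gs ! i))" "special gs"
    "length s \<le> length gs" "take (length s) gs = s" "interval E" "\<forall>i<length gs. \<epsilon> i \<in> {-1, 1}"
    using assms(1) unfolding tails_def by blast
  have U: "gs \<in> U_seqs" using gs(2) by (rule special_U)
  have "initial s" using gs by (auto simp: initial_def)
  then have \<sigma>: "\<sigma> s \<ge> 1" using coding_ge_1 initial_U_seqs assms(2) by blast
  let ?J = "(\<lambda>i. ind_G1 (gs ! i)) ` {length s..<length gs}"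
  have J: "\<sigma> s \<le> ind_G1 (gs ! i)" if "length s \<le> i" "i < length gs" for i
  proof -
    have "gs ! length s \<in> G1_level (\<sigma> (take (length s) gs))"
      using gs(2) assms(2) that unfolding special_sequence_def by (auto simp: Suc_le_eq)
    then have "ind_G1 (gs ! length s) = \<sigma> s" using gs(4) \<sigma> by (simp add: ind_G1_eq)
    then show ?thesis using U_seqs_ind_less[OF U, of "length s" i] that by (cases "length s = i") auto
  qed
  have "\<bar>pairing \<phi> y\<bar> \<le> (\<Sum>j\<in>?J. (1 / 2) ^ j * norm y)"
    unfolding gs(1) using gs(6) by (intro abs_pairing_pieces_le[OF U] abs_pairing_G1_level_le_norm) auto
  also have "\<dots> = (\<Sum>j\<in>?J. (1 / 2) ^ j) * norm y" by (simp add: sum_distrib_right)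
  also have "\<dots> \<le> (1 / 2) ^ (\<sigma> s - 1) * norm y"
  proof (intro mult_right_mono sum_half_powers_le)
    show "?J \<inter> {..\<sigma> s - 1} = {}" using J \<sigma> by fastforce
  qed auto
  finally show ?thesis .
qed

lemma tails_unfold:
  assumes "\<phi> \<in> tails s"
  shows "\<phi> = 0 \<or> (\<exists>e f E \<theta> j. \<phi> = e *\<^sub>R restr E f + \<theta> \<and> e \<in> {-1, 1} \<and> interval E \<and> j \<ge> 1 \<and>
    f \<in> G1_level j \<and> initial (s @ [f]) \<and> \<theta> \<in> tails (s @ [f]))"
proof -
  obtain gs \<epsilon> E where gs: "\<phi> = (\<Sum>i=length s..<length gs. \<epsilon> i *\<^sub>R restr E (gs ! i))" "special gs"
    "length s \<le> length gs" "take (length s) gs = s" "interval E" "\<forall>i<length gs. \<epsilon> i \<in> {-1, 1}"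
    using assms unfolding tails_def by blast
  show ?thesis
  proof (cases "length s = length gs")
    case False
    then have lt: "length s < length gs" using gs(3) by simp
    let ?f = "gs ! length s"
    let ?\<theta> = "\<Sum>i=length (s @ [?f])..<length gs. \<epsilon> i *\<^sub>R restr E (gs ! i)"
    have take: "take (length (s @ [?f])) gs = s @ [?f]"
      using gs(4) lt by (simp add: take_Suc_conv_app_nth)
    have "\<phi> = \<epsilon> (length s) *\<^sub>R restr E ?f + ?\<theta>"
      using gs(1) lt by (simp add: sum.atLeast_Suc_lessThan)
    moreover have "initial (s @ [?f])" using gs(2) lt take by (auto simp: initial_def)
    moreover have "?\<theta> \<in> tails (s @ [?f])"
      using gs(2,5,6) lt take by (intro tailsI) auto
    moreover have "ind_G1 ?f \<ge> 1" "?f \<in> G1_level (ind_G1 ?f)"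
      using U_seqs_nth[OF special_U[OF gs(2)] lt] by auto
    moreover have "\<epsilon> (length s) \<in> {-1, 1}" using gs(6) lt by blast
    ultimately show ?thesis using gs(5) by blast
  qed (use gs(1) in simp)
qed

text \<open>A tail at \<open>s\<close> is one piece plus a tail at a child, and each of the two gets
  \<eta>/2. Tails at children are ranked by the code of the child: a large code makes them
  negligible on a fixed vector, while injectivity of \<open>\<sigma>\<close> leaves finitely many
  children with a small code, for which the induction hypothesis can be imposed
  simultaneously.\<close>

lemma attainable_tails:
  assumes "0 < \<eta>"
  shows "attainable {y. \<forall>\<phi>\<in>tails s. \<bar>pairing \<phi> y\<bar> \<le> \<eta>}"
  using assms
proof (induction s arbitrary: \<eta> rule: wf_induct_rule[OF wf_special_tree])
  case (1 s)
  define \<Phi> where "\<Phi> = {(\<phi>, \<sigma> (s @ [f])) |\<phi> f. initial (s @ [f]) \<and> \<phi> \<in> tails (s @ [f])}"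
  have "attainable {y. \<forall>\<phi>\<in>fst ` \<Phi>. \<bar>pairing \<phi> y\<bar> \<le> \<eta> / 2}"
  proof (rule attainable_by_rank)
    show "\<bar>pairing \<phi> y\<bar> \<le> N y" if "(\<phi>, r) \<in> \<Phi>" for \<phi> r y
      using that tails_abs_le_N by (auto simp: \<Phi>_def)
  next
    fix y :: "nat \<Rightarrow>\<^sub>0 real" and \<eta> :: real assume "0 < \<eta>"
    then obtain q where q: "\<forall>j\<ge>q. (1 / 2) ^ j * norm y \<le> \<eta>" using exists_half_power_mult_le by blast
    have "\<bar>pairing \<phi> y\<bar> \<le> \<eta>" if "(\<phi>, r) \<in> \<Phi>" "q < r" for \<phi> r
    proof -
      have "\<bar>pairing \<phi> y\<bar> \<le> (1 / 2) ^ (r - 1) * norm y"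
        using that(1) tails_abs_le_norm by (auto simp: \<Phi>_def)
      also have "\<dots> \<le> \<eta>" using q that(2) by simp
      finally show ?thesis .
    qed
    then show "\<exists>q. \<forall>(\<phi>, r)\<in>\<Phi>. q < r \<longrightarrow> \<bar>pairing \<phi> y\<bar> \<le> \<eta>" by blast
  next
    fix q :: nat and \<eta> :: real assume "0 < \<eta>"
    let ?C = "{s @ [f] |f. initial (s @ [f]) \<and> \<sigma> (s @ [f]) \<le> q}"
    have "inj_on \<sigma> ?C"
      using coding by (auto simp: coding_function_def intro!: inj_on_subset[of \<sigma> U_seqs] initial_U_seqs)
    moreover have "finite (\<sigma> ` ?C)" by (rule finite_subset[of _ "{..q}"]) auto
    ultimately have "finite ?C" by (rule finite_imageD[rotated])
    then have "attainable (\<Inter>c\<in>?C. {y. \<forall>\<phi>\<in>tails c. \<bar>pairing \<phi> y\<bar> \<le> \<eta>})"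
      using 1 \<open>0 < \<eta>\<close> by (intro attainable_INT) auto
    then show "attainable {y. \<forall>\<phi>\<in>{\<phi>. \<exists>r\<le>q. (\<phi>, r) \<in> \<Phi>}. \<bar>pairing \<phi> y\<bar> \<le> \<eta>}"
    proof (rule attainable_mono)
      show "(\<Inter>c\<in>?C. {y. \<forall>\<phi>\<in>tails c. \<bar>pairing \<phi> y\<bar> \<le> \<eta>})
          \<subseteq> {y. \<forall>\<phi>\<in>{\<phi>. \<exists>r\<le>q. (\<phi>, r) \<in> \<Phi>}. \<bar>pairing \<phi> y\<bar> \<le> \<eta>}"
        unfolding \<Phi>_def by blast
    qed (rule convex_abs_pairing_le)
  qed (use 1 in auto)
  then have "attainable ({y. \<forall>\<phi>\<in>fst ` pieces. \<bar>pairing \<phi> y\<bar> \<le> \<eta> / 2} \<inter>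
      {y. \<forall>\<phi>\<in>fst ` \<Phi>. \<bar>pairing \<phi> y\<bar> \<le> \<eta> / 2})"
    using 1 by (intro attainable_Int attainable_pieces) auto
  then show ?case
  proof (rule attainable_mono)
    show "{y. \<forall>\<phi>\<in>fst ` pieces. \<bar>pairing \<phi> y\<bar> \<le> \<eta> / 2} \<inter> {y. \<forall>\<phi>\<in>fst ` \<Phi>. \<bar>pairing \<phi> y\<bar> \<le> \<eta> / 2}
        \<subseteq> {y. \<forall>\<phi>\<in>tails s. \<bar>pairing \<phi> y\<bar> \<le> \<eta>}"
    proof (intro subsetI CollectI ballI)
      fix y \<phi>
      assume y: "y \<in> {y. \<forall>\<phi>\<in>fst ` pieces. \<bar>pairing \<phi> y\<bar> \<le> \<eta> / 2} \<inter> {y. \<forall>\<phi>\<in>fst ` \<Phi>. \<bar>pairing \<phi> y\<bar> \<le> \<eta> / 2}"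
        and "\<phi> \<in> tails s"
      from tails_unfold[OF this(2)] show "\<bar>pairing \<phi> y\<bar> \<le> \<eta>"
      proof (elim disjE exE conjE)
        fix e f E \<theta> j
        assume \<phi>: "\<phi> = e *\<^sub>R restr E f + \<theta>" "e \<in> {-1, 1}" "interval E" "j \<ge> 1" "f \<in> G1_level j"
          "initial (s @ [f])" "\<theta> \<in> tails (s @ [f])"
        have "restr E f \<in> fst ` pieces" using \<phi> by (force simp: pieces_def)
        moreover have "\<theta> \<in> fst ` \<Phi>" using \<phi> by (force simp: \<Phi>_def)
        ultimately have "\<bar>pairing (restr E f) y\<bar> \<le> \<eta> / 2" "\<bar>pairing \<theta> y\<bar> \<le> \<eta> / 2" using y by auto
        then show ?thesis using \<phi>(2) by (auto simp: \<phi>(1) pairing_add_left pairing_scaleR_left)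
      qed (use 1 in simp)
    qed
  qed (rule convex_abs_pairing_le)
qed

lemma attainable_atoms:
  assumes "0 < \<eta>"
  shows "attainable {y. \<forall>\<phi>\<in>{\<phi>. \<exists>I. atom \<phi> I}. \<bar>pairing \<phi> y\<bar> \<le> \<eta>}"
proof -
  have "attainable ({y. \<forall>\<phi>\<in>fst ` pieces. \<bar>pairing \<phi> y\<bar> \<le> \<eta>} \<inter> {y. \<forall>\<phi>\<in>tails []. \<bar>pairing \<phi> y\<bar> \<le> \<eta>})"
    using assms by (intro attainable_Int attainable_pieces attainable_tails)
  moreover have "\<phi> \<in> fst ` pieces \<union> tails []" if "atom \<phi> I" for \<phi> I
    using that
  proof (cases rule: atom_cases)
    case (special gs \<epsilon> E)
    then have "\<phi> \<in> tails []"
      using tailsI[of gs "[]" E \<epsilon>] by (simp add: restr_sum restr_scaleR atLeast0LessThan)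
    then show ?thesis by simp
  next
    case (single j)
    then have "restr {1..} \<phi> = \<phi>"
      by (intro poly_mapping_eqI) (auto simp: lookup_restr G1_level_iff in_keys_iff)
    moreover have "interval {1..}" by (auto simp: interval_def)
    ultimately have "\<phi> \<in> fst ` pieces" using single by (force simp: pieces_def)
    then show ?thesis by simp
  qed
  ultimately show ?thesis
    by (elim attainable_mono) (blast intro: convex_abs_pairing_le)+
qed


section \<open>The basis is shrinking\<close>

text \<open>The first part collects the atoms having some index up to \<open>q\<close>. Each of them
  owns such an index exclusively, so their number is at most
  \<open>card (J1 \<inter> {..q})\<close>, whatever the length of the combination.\<close>

lemma l2_comb_split:
  assumes "l2_comb \<psi> J s" "s \<le> 1"
  shows "\<exists>\<psi>1 J1 s1 \<psi>2 J2 s2. \<psi> = \<psi>1 + \<psi>2 \<and> l2_comb \<psi>1 J1 s1 \<and> l2_comb \<psi>2 J2 s2 \<and> s1 + s2 = s \<and>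
    J1 \<union> J2 \<subseteq> J \<and> J2 \<inter> {..q} = {} \<and>
    (\<forall>z \<kappa>. (\<forall>\<phi>\<in>{\<phi>. \<exists>I. atom \<phi> I}. \<bar>pairing \<phi> z\<bar> \<le> \<kappa>) \<longrightarrow>
       \<bar>pairing \<psi>1 z\<bar> \<le> real (card (J1 \<inter> {..q})) * \<kappa>)"
  using assms
proof (induction rule: l2_comb.induct)
  case zero
  show ?case
    by (intro exI[of _ 0] exI[of _ "{}"] conjI l2_comb.zero) auto
next
  case (add \<psi> J s \<phi> I a)
  have a: "\<bar>a\<bar> \<le> 1" using add.prems l2_comb_nonneg[OF add.hyps(1)] by (rule l2_comb_abs_coefficient_le)
  have "s \<le> 1" using add.prems by (smt (verit) zero_le_power2)
  then obtain \<psi>1 J1 s1 \<psi>2 J2 s2 where IH: "\<psi> = \<psi>1 + \<psi>2" "l2_comb \<psi>1 J1 s1" "l2_comb \<psi>2 J2 s2"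
    "s1 + s2 = s" "J1 \<union> J2 \<subseteq> J" "J2 \<inter> {..q} = {}"
    and small: "\<forall>z \<kappa>. (\<forall>\<phi>\<in>{\<phi>. \<exists>I. atom \<phi> I}. \<bar>pairing \<phi> z\<bar> \<le> \<kappa>) \<longrightarrow>
       \<bar>pairing \<psi>1 z\<bar> \<le> real (card (J1 \<inter> {..q})) * \<kappa>"
    using add.IH by blast
  show ?case
  proof (cases "I \<inter> {..q} = {}")
    case True
    have "l2_comb (\<psi>2 + a *\<^sub>R \<phi>) (J2 \<union> I) (s2 + a\<^sup>2)"
      using IH add.hyps by (intro l2_comb.add) auto
    moreover have "\<psi> + a *\<^sub>R \<phi> = \<psi>1 + (\<psi>2 + a *\<^sub>R \<phi>)" "s1 + (s2 + a\<^sup>2) = s + a\<^sup>2"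
      "J1 \<union> (J2 \<union> I) \<subseteq> J \<union> I" "(J2 \<union> I) \<inter> {..q} = {}"
      using IH True by auto
    ultimately show ?thesis using IH(2) small by blast
  next
    case False
    have "l2_comb (\<psi>1 + a *\<^sub>R \<phi>) (J1 \<union> I) (s1 + a\<^sup>2)"
      using IH add.hyps by (intro l2_comb.add) auto
    moreover have "\<psi> + a *\<^sub>R \<phi> = (\<psi>1 + a *\<^sub>R \<phi>) + \<psi>2" "(s1 + a\<^sup>2) + s2 = s + a\<^sup>2"
      "(J1 \<union> I) \<union> J2 \<subseteq> J \<union> I"
      using IH by auto
    moreover have "\<bar>pairing (\<psi>1 + a *\<^sub>R \<phi>) z\<bar> \<le> real (card ((J1 \<union> I) \<inter> {..q})) * \<kappa>"
      if z: "\<forall>\<phi>\<in>{\<phi>. \<exists>I. atom \<phi> I}. \<bar>pairing \<phi> z\<bar> \<le> \<kappa>" for z \<kappa>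
    proof -
      have \<phi>: "\<bar>pairing \<phi> z\<bar> \<le> \<kappa>" using z add.hyps(2) by blast
      then have \<kappa>: "\<kappa> \<ge> 0" by linarith
      have "\<bar>a * pairing \<phi> z\<bar> \<le> 1 * \<kappa>"
        unfolding abs_mult using a \<phi> by (intro mult_mono) auto
      moreover have "\<bar>pairing \<psi>1 z\<bar> \<le> real (card (J1 \<inter> {..q})) * \<kappa>" using small z by blast
      moreover have "card (J1 \<inter> {..q}) + 1 \<le> card ((J1 \<union> I) \<inter> {..q})"
      proof -
        have "card (I \<inter> {..q}) \<ge> 1" using False by (simp add: Suc_le_eq card_gt_0_iff)
        moreover have "card ((J1 \<union> I) \<inter> {..q}) = card (J1 \<inter> {..q}) + card (I \<inter> {..q})"
          unfolding Int_Un_distrib2 using IH(5) add.hyps(3) by (intro card_Un_disjoint) auto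
        ultimately show ?thesis by linarith
      qed
      then have "(real (card (J1 \<inter> {..q})) + 1) * \<kappa> \<le> real (card ((J1 \<union> I) \<inter> {..q})) * \<kappa>"
        using \<kappa> by (intro mult_right_mono) linarith+
      ultimately show ?thesis
        by (simp add: pairing_add_left pairing_scaleR_left distrib_right)
    qed
    ultimately show ?thesis using IH(3,6) by blast
  qed
qed

text \<open>This is Cauchy-Schwarz for (1, sqrt m) and (sqrt a, sqrt b). It carries the l_2 estimate
  from \<open>m\<close> vectors to \<open>m + 1\<close> when the squared coefficients split as
  \<open>a + b\<close>.\<close>

lemma sqrt_add_sqrt_mult_le:
  assumes "0 \<le> a" "0 \<le> b" "0 \<le> m"
  shows "sqrt a + sqrt (m * b) \<le> sqrt ((m + 1) * (a + b))"
proof (rule real_le_rsqrt)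
  have "0 \<le> (sqrt m * sqrt a - sqrt b)\<^sup>2" by simp
  also have "\<dots> = m * a + b - 2 * (sqrt a * sqrt (m * b))"
    using assms by (simp add: power2_diff power_mult_distrib real_sqrt_mult)
  finally show "(sqrt a + sqrt (m * b))\<^sup>2 \<le> (m + 1) * (a + b)"
    using assms by (simp add: power2_sum algebra_simps)
qed

text \<open>An upper \<open>\<ell>\<^sub>2\<close>-estimate. A combination of atoms is split according to whether an atom has an
  index that the first vector can see: there are few such atoms, and all of them are small on the
  remaining vectors, while the other atoms vanish on the first vector up to a small error.\<close>

lemma upper_l2_estimate:
  assumes Y: "good Y" and "0 < \<eta>"
  shows "\<exists>z. (1 / real (Suc K)) *\<^sub>R z \<in> Y 0 \<and>
    (\<forall>\<phi>\<in>{\<phi>. \<exists>I. atom \<phi> I}. \<bar>pairing \<phi> z\<bar> \<le> \<eta> / real (Suc q)) \<and>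
    (\<forall>\<psi> J s. l2_comb \<psi> J s \<longrightarrow> s \<le> 1 \<longrightarrow>
       \<bar>pairing \<psi> z\<bar> \<le> sqrt (real (Suc K) * s) + 2 * real (Suc K) * \<eta>)"
proof (induction K arbitrary: q)
  case 0
  have "0 < \<eta> / real (Suc q)" using \<open>0 < \<eta>\<close> by simp
  from attainable_ex[OF attainable_atoms[OF this] Y]
  obtain z where z: "z \<in> Y 0" "\<forall>\<phi>\<in>{\<phi>. \<exists>I. atom \<phi> I}. \<bar>pairing \<phi> z\<bar> \<le> \<eta> / real (Suc q)"
    by (rule bexE)
  have "N z \<le> 1" using Y z(1) by (auto simp: good_def)
  have "\<bar>pairing \<psi> z\<bar> \<le> sqrt (real (Suc 0) * s) + 2 * real (Suc 0) * \<eta>" if "l2_comb \<psi> J s" for \<psi> J s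
  proof -
    have "sqrt s * N z \<le> sqrt s * 1"
      using \<open>N z \<le> 1\<close> l2_comb_nonneg[OF that] by (intro mult_left_mono) auto
    then show ?thesis using abs_l2_comb_le_sqrt[OF that, of z] \<open>0 < \<eta>\<close> by simp
  qed
  then show ?case using z by (intro exI[of _ z]) auto
next
  case (Suc K)
  have "0 < \<eta> / (2 * real (Suc q))" using \<open>0 < \<eta>\<close> by simp
  from attainable_ex[OF attainable_atoms[OF this] Y]
  obtain x where x: "x \<in> Y 0" "\<forall>\<phi>\<in>{\<phi>. \<exists>I. atom \<phi> I}. \<bar>pairing \<phi> x\<bar> \<le> \<eta> / (2 * real (Suc q))"
    by (rule bexE)
  have Y0: "N x \<le> 1" "convex (Y 0)" using Y x(1) by (auto simp: good_def)
  obtain p where p: "\<forall>j\<ge>p. (1 / 2) ^ j * norm x \<le> \<eta>"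
    using exists_half_power_mult_le[OF \<open>0 < \<eta>\<close>] by blast
  \<comment> \<open>Beyond \<open>p\<close> the indices are negligible on \<open>x\<close>. The
    second entry makes the bound \<eta> / (r + 1) for atoms on \<open>z\<close> small enough to fill
    the half of \<eta> / (q + 1) that \<open>x\<close> left free.\<close>
  define r where "r = max p (2 * Suc q)"
  obtain z where z: "(1 / real (Suc K)) *\<^sub>R z \<in> Y 0"
    and z_atom: "\<forall>\<phi>\<in>{\<phi>. \<exists>I. atom \<phi> I}. \<bar>pairing \<phi> z\<bar> \<le> \<eta> / real (Suc r)"
    and z_l2: "\<forall>\<psi> J s. l2_comb \<psi> J s \<longrightarrow> s \<le> 1 \<longrightarrow>
       \<bar>pairing \<psi> z\<bar> \<le> sqrt (real (Suc K) * s) + 2 * real (Suc K) * \<eta>"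
    using Suc.IH[of r] by (elim exE conjE) (rule that)
  have "\<bar>pairing \<phi> (x + z)\<bar> \<le> \<eta> / real (Suc q)" if \<phi>: "\<phi> \<in> {\<phi>. \<exists>I. atom \<phi> I}" for \<phi>
  proof -
    define D where "D = \<eta> / (2 * real (Suc q))"
    have "real (Suc r) \<ge> 2 * real (Suc q)" by (auto simp: r_def)
    then have "\<eta> / real (Suc r) \<le> D"
      unfolding D_def using \<open>0 < \<eta>\<close> by (intro divide_left_mono) auto
    then have "\<bar>pairing \<phi> x\<bar> \<le> D" "\<bar>pairing \<phi> z\<bar> \<le> D"
      using bspec[OF x(2) \<phi>] order_trans[OF bspec[OF z_atom \<phi>]] by (simp_all add: D_def)
    moreover have "\<eta> / real (Suc q) = D + D"
      by (simp add: D_def divide_simps del: of_nat_Suc)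
    ultimately show ?thesis unfolding pairing_add_right by linarith
  qed
  moreover have "\<bar>pairing \<psi> (x + z)\<bar> \<le> sqrt (real (Suc (Suc K)) * s) + 2 * real (Suc (Suc K)) * \<eta>"
    if \<psi>: "l2_comb \<psi> J s" "s \<le> 1" for \<psi> J s
  proof -
    obtain \<psi>1 J1 s1 \<psi>2 J2 s2 where split: "\<psi> = \<psi>1 + \<psi>2" "l2_comb \<psi>1 J1 s1" "l2_comb \<psi>2 J2 s2"
      "s1 + s2 = s" "J2 \<inter> {..r} = {}"
      and few: "\<forall>z \<kappa>. (\<forall>\<phi>\<in>{\<phi>. \<exists>I. atom \<phi> I}. \<bar>pairing \<phi> z\<bar> \<le> \<kappa>) \<longrightarrow>
         \<bar>pairing \<psi>1 z\<bar> \<le> real (card (J1 \<inter> {..r})) * \<kappa>"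
      using l2_comb_split[OF \<psi>, of r] by (elim exE conjE) (rule that)
    have s: "0 \<le> s1" "0 \<le> s2" using split l2_comb_nonneg by auto
    then have "s2 \<le> 1" using split(4) \<psi>(2) by linarith
    have "sqrt s1 * N x \<le> sqrt s1 * 1" using Y0(1) s by (intro mult_left_mono) auto
    then have 1: "\<bar>pairing \<psi>1 x\<bar> \<le> sqrt s1"
      using abs_l2_comb_le_sqrt[OF split(2), of x] by simp
    have "\<bar>pairing \<psi>2 x\<bar> \<le> (\<Sum>j\<in>J2. (1 / 2) ^ j) * norm x"
      by (rule l2_comb_abs_le_norm[OF split(3) \<open>s2 \<le> 1\<close>])
    also have "\<dots> \<le> (1 / 2) ^ r * norm x"
      using l2_comb_finite_pos[OF split(3)] split(5)
      by (intro mult_right_mono sum_half_powers_le) auto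
    also have "\<dots> \<le> \<eta>" using p by (simp add: r_def)
    finally have 2: "\<bar>pairing \<psi>2 x\<bar> \<le> \<eta>" .
    \<comment> \<open>There are at most \<open>r\<close> exceptional atoms and each is at most
      \<eta> / (r + 1) on \<open>z\<close>, so together they cost at most \<eta>.\<close>
    have "J1 \<inter> {..r} \<subseteq> {1..r}" using l2_comb_finite_pos[OF split(2)] by auto
    then have "card (J1 \<inter> {..r}) \<le> r" using card_mono[of "{1..r}"] by fastforce
    then have "real (card (J1 \<inter> {..r})) * (\<eta> / real (Suc r)) \<le> real (Suc r) * (\<eta> / real (Suc r))"
      using \<open>0 < \<eta>\<close> by (intro mult_right_mono) auto
    moreover have "\<bar>pairing \<psi>1 z\<bar> \<le> real (card (J1 \<inter> {..r})) * (\<eta> / real (Suc r))"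
      using few z_atom by blast
    ultimately have 3: "\<bar>pairing \<psi>1 z\<bar> \<le> \<eta>" by simp
    have 4: "\<bar>pairing \<psi>2 z\<bar> \<le> sqrt (real (Suc K) * s2) + 2 * real (Suc K) * \<eta>"
      using z_l2 split(3) \<open>s2 \<le> 1\<close> by blast
    have 5: "sqrt s1 + sqrt (real (Suc K) * s2) \<le> sqrt (real (Suc (Suc K)) * s)"
      using sqrt_add_sqrt_mult_le[OF s, of "real (Suc K)"] split(4) by (simp add: add.commute)
    have 6: "2 * real (Suc (Suc K)) * \<eta> = \<eta> + \<eta> + 2 * real (Suc K) * \<eta>" by (simp add: algebra_simps)
    have "pairing \<psi> (x + z) = pairing \<psi>1 x + pairing \<psi>2 x + pairing \<psi>1 z + pairing \<psi>2 z"
      by (simp add: split(1) pairing_add_left pairing_add_right)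
    then show ?thesis using 1 2 3 4 5 6 by linarith
  qed
  ultimately show ?case
    using convex_average[OF Y0(2) x(1) z] by (intro exI[of _ "x + z"]) auto
qed

lemma good_norm_small:
  assumes "good Y" "0 < \<tau>"
  shows "\<exists>n. \<exists>y\<in>Y n. N y \<le> \<tau>"
proof -
  \<comment> \<open>Coordinate functionals are outside the l_2 estimate; starting at level
    \<open>n\<close> makes them at most \<tau> separately.\<close>
  obtain n where n: "1 / real (Suc n) < \<tau>" using nat_approx_posE[OF assms(2)] .
  have Y: "good (\<lambda>k. Y (n + k))" using assms(1) by (rule good_shift)
  have "0 < (\<tau> / 2)\<^sup>2" using assms(2) by simp
  then obtain K where K: "1 / real (Suc K) < (\<tau> / 2)\<^sup>2" using nat_approx_posE by blast
  define \<eta> where "\<eta> = \<tau> / 4"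
  have "0 < \<eta>" using assms(2) by (simp add: \<eta>_def)
  obtain z where z: "(1 / real (Suc K)) *\<^sub>R z \<in> Y (n + 0)"
    and l2: "\<forall>\<psi> J s. l2_comb \<psi> J s \<longrightarrow> s \<le> 1 \<longrightarrow>
       \<bar>pairing \<psi> z\<bar> \<le> sqrt (real (Suc K) * s) + 2 * real (Suc K) * \<eta>"
    using upper_l2_estimate[OF Y \<open>0 < \<eta>\<close>, of K 0] by (elim exE conjE) (rule that)
  let ?y = "(1 / real (Suc K)) *\<^sub>R z"
  have "N ?y \<le> \<tau>"
  proof (rule N_leI)
    fix k :: nat
    have "\<bar>Poly_Mapping.lookup ?y k\<bar> \<le> 1 / (real n + 1)"
      using assms(1) z unfolding good_def by auto
    then show "\<bar>Poly_Mapping.lookup ?y k\<bar> \<le> \<tau>" using n by (simp add: add.commute)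
  next
    fix \<psi> J s assume \<psi>: "l2_comb \<psi> J s" "s \<le> 1"
    have "sqrt (real (Suc K) * s) \<le> sqrt (real (Suc K))"
      using \<psi>(2) by (simp add: mult_left_le)
    then have "pairing \<psi> z \<le> sqrt (real (Suc K)) + 2 * real (Suc K) * \<eta>"
      using l2 \<psi> by (smt (verit))
    then have "1 / real (Suc K) * pairing \<psi> z \<le>
        1 / real (Suc K) * (sqrt (real (Suc K)) + 2 * real (Suc K) * \<eta>)"
      by (intro mult_left_mono) auto
    also have "\<dots> = sqrt (real (Suc K)) / real (Suc K) + 2 * \<eta>"
      by (simp add: distrib_left del: of_nat_Suc)
    also have "sqrt (real (Suc K)) / real (Suc K) = sqrt (1 / real (Suc K))"
      by (simp add: real_sqrt_divide divide_simps del: of_nat_Suc)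
    also have "sqrt (1 / real (Suc K)) \<le> \<tau> / 2"
      using K assms(2) by (intro real_le_lsqrt) auto
    finally show "pairing \<psi> ?y \<le> \<tau>" by (simp add: pairing_scaleR_right \<eta>_def)
  qed
  then show ?thesis using z by auto
qed

lemma shrinking:
  fixes L :: "(nat \<Rightarrow>\<^sub>0 real) \<Rightarrow> real"
  assumes L: "linear L" and bound: "\<And>y. \<bar>L y\<bar> \<le> C * N y" and "0 < \<delta>"
  shows "\<exists>n. \<forall>y. Poly_Mapping.keys y \<subseteq> {n<..} \<longrightarrow> \<bar>L y\<bar> \<le> \<delta> * N y"
proof (rule ccontr)
  assume "\<not> ?thesis"
  then have far: "\<exists>y. Poly_Mapping.keys y \<subseteq> {n<..} \<and> \<bar>L y\<bar> > \<delta> * N y" for n by (meson not_le)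
  define Z where "Z n = {y. Poly_Mapping.keys y \<subseteq> {n<..} \<and> N y \<le> 1 \<and> \<delta> \<le> L y}" for n
  have keys_comb: "Poly_Mapping.keys (u *\<^sub>R x + v *\<^sub>R y) \<subseteq> Poly_Mapping.keys x \<union> Poly_Mapping.keys y"
    for u v and x y :: "nat \<Rightarrow>\<^sub>0 real"
    by (auto simp: in_keys_iff lookup_add lookup_scaleR_real)
  have Z_convex: "convex (Z n)" for n
  proof (rule convexI)
    fix x y and u v :: real
    assume xy: "x \<in> Z n" "y \<in> Z n" and uv: "0 \<le> u" "0 \<le> v" "u + v = 1"
    have "N (u *\<^sub>R x + v *\<^sub>R y) \<le> u * N x + v * N y"
      using N_add_le[of "u *\<^sub>R x" "v *\<^sub>R y"] N_scaleR_le[of u x] N_scaleR_le[of v y] uv by simp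
    also have "\<dots> \<le> u * 1 + v * 1" using xy uv by (intro add_mono mult_left_mono) (auto simp: Z_def)
    finally have "N (u *\<^sub>R x + v *\<^sub>R y) \<le> 1" using uv by simp
    moreover have "u * \<delta> + v * \<delta> \<le> u * L x + v * L y"
      using xy uv by (intro add_mono mult_left_mono) (auto simp: Z_def)
    then have "\<delta> \<le> L (u *\<^sub>R x + v *\<^sub>R y)"
      using uv by (simp add: linear_add[OF L] linear_scale[OF L] flip: distrib_right)
    ultimately show "u *\<^sub>R x + v *\<^sub>R y \<in> Z n"
      using keys_comb[of u x v y] xy by (auto simp: Z_def)
  qed
  have Z_nonempty: "Z n \<noteq> {}" for n
  proof -
    obtain y where y: "Poly_Mapping.keys y \<subseteq> {n<..}" "\<bar>L y\<bar> > \<delta> * N y" using far by blast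
    have "N y \<noteq> 0" using bound[of y] y(2) by auto
    then have pos: "N y > 0" using N_nonneg[of y] by simp
    let ?r = "sgn (L y) / N y"
    have "Poly_Mapping.keys (?r *\<^sub>R y) \<subseteq> {n<..}"
      using y(1) by (auto simp: in_keys_iff lookup_scaleR_real)
    moreover have "\<bar>?r\<bar> * N y \<le> 1" using pos by (simp add: abs_sgn_eq)
    then have "N (?r *\<^sub>R y) \<le> 1" using N_scaleR_le[of ?r y] by simp
    moreover have "L (?r *\<^sub>R y) = \<bar>L y\<bar> / N y"
      by (simp add: linear_scale[OF L] abs_sgn mult.commute)
    then have "\<delta> \<le> L (?r *\<^sub>R y)" using y(2) pos by (simp add: le_divide_eq)
    ultimately show ?thesis unfolding Z_def by blast
  qed
  have Z_mono: "Z m \<subseteq> Z n" if "n \<le> m" for n m using that by (auto simp: Z_def)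
  have Z_lookup: "\<bar>Poly_Mapping.lookup y k\<bar> \<le> 1" if "y \<in> Z n" for y n k
  proof (cases "k \<in> Poly_Mapping.keys y")
    case True
    then have "k \<ge> 1" using that by (auto simp: Z_def)
    then show ?thesis using abs_lookup_le_N[of k y] that by (auto simp: Z_def)
  qed (simp add: in_keys_iff)
  \<comment> \<open>Each new vector lives beyond the support of the sum so far, so coordinates of
    sums stay at most 1 and those of averages are at most 1 / (K + 1).\<close>
  have flat: "\<exists>z. (1 / real (Suc K)) *\<^sub>R z \<in> Z n \<and> (\<forall>k. \<bar>Poly_Mapping.lookup z k\<bar> \<le> 1)" for K n
  proof (induction K)
    case 0
    obtain z where "z \<in> Z n" using Z_nonempty by blast
    then show ?case using Z_lookup by (intro exI[of _ z]) auto
  next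
    case (Suc K)
    then obtain z where z: "(1 / real (Suc K)) *\<^sub>R z \<in> Z n" "\<forall>k. \<bar>Poly_Mapping.lookup z k\<bar> \<le> 1"
      by blast
    obtain m where m: "\<forall>k\<in>Poly_Mapping.keys z. k \<le> m"
      by (meson finite_keys finite_nat_set_iff_bounded_le)
    obtain x where x: "x \<in> Z (max n m)" using Z_nonempty by blast
    have "\<bar>Poly_Mapping.lookup (x + z) k\<bar> \<le> 1" for k
    proof (cases "k \<in> Poly_Mapping.keys z")
      case True
      then have "k \<notin> Poly_Mapping.keys x" using m x by (fastforce simp: Z_def)
      then show ?thesis using z(2) by (simp add: lookup_add in_keys_iff)
    next
      case False
      then show ?thesis using Z_lookup[OF x] by (simp add: lookup_add in_keys_iff)
    qed
    moreover have "x \<in> Z n" using x Z_mono[of n "max n m"] by auto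
    then have "(1 / real (Suc (Suc K))) *\<^sub>R (x + z) \<in> Z n"
      using z(1) by (intro convex_average Z_convex)
    ultimately show ?case by blast
  qed
  define Y where "Y n = Z 0 \<inter> {y. \<forall>k. \<bar>Poly_Mapping.lookup y k\<bar> \<le> 1 / (real n + 1)}" for n
  have "good Y"
    unfolding good_def
  proof (intro allI conjI ballI)
    fix n
    obtain z where z: "(1 / real (Suc n)) *\<^sub>R z \<in> Z 0" "\<forall>k. \<bar>Poly_Mapping.lookup z k\<bar> \<le> 1"
      using flat by blast
    have "\<bar>Poly_Mapping.lookup ((1 / real (Suc n)) *\<^sub>R z) k\<bar> \<le> 1 / (real n + 1)" for k
      using z(2)[rule_format, of k]
      by (simp add: lookup_scaleR_real abs_mult divide_right_mono add.commute)
    then show "Y n \<noteq> {}" using z(1) unfolding Y_def by blast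
    have "convex {y :: nat \<Rightarrow>\<^sub>0 real. \<forall>k. \<bar>Poly_Mapping.lookup y k\<bar> \<le> 1 / (real n + 1)}"
      using convex_abs_pairing_le[of "range (\<lambda>k. Poly_Mapping.single k 1)" "1 / (real n + 1)"]
      by (simp add: pairing_single)
    then show "convex (Y n)" unfolding Y_def by (intro convex_Int Z_convex)
    have "1 / (real (Suc n) + 1) \<le> 1 / (real n + 1)" by (intro divide_left_mono) auto
    then show "Y (Suc n) \<subseteq> Y n" unfolding Y_def using order_trans by blast
  qed (auto simp: Y_def Z_def)
  \<comment> \<open>Chosen so that norm at most \<tau> forces \<open>L y \<le> \<delta> / 2\<close>,
    although \<open>L\<close> is at least \<delta> on the whole family.\<close>
  define \<tau> where "\<tau> = \<delta> / (2 * (\<bar>C\<bar> + 1))"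
  have "0 < \<tau>" using \<open>0 < \<delta>\<close> by (simp add: \<tau>_def add_nonneg_pos)
  then obtain n y where y: "y \<in> Y n" "N y \<le> \<tau>" using good_norm_small[OF \<open>good Y\<close>] by blast
  have "\<delta> \<le> L y" using y(1) by (simp add: Y_def Z_def)
  also have "\<dots> \<le> C * N y" using bound[of y] by simp
  also have "\<dots> \<le> (\<bar>C\<bar> + 1) * \<tau>" using y(2) N_nonneg[of y] by (intro mult_mono) auto
  also have "\<dots> = \<delta> / 2" by (simp add: \<tau>_def field_simps)
  finally show False using \<open>0 < \<delta>\<close> by simp
qed

end

section \<open>Completions and reflexivity\<close>

lemma c00_add: "x \<in> c00 \<Longrightarrow> y \<in> c00 \<Longrightarrow> x + y \<in> c00"
  by (auto simp: c00_def in_keys_iff lookup_add) (metis add.right_neutral atLeast_iff in_keys_iff subset_iff)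

lemma c00_scaleR: "x \<in> c00 \<Longrightarrow> r *\<^sub>R x \<in> c00"
  by (auto simp: c00_def in_keys_iff lookup_scaleR_real subset_iff)

lemma c00_diff: "x \<in> c00 \<Longrightarrow> y \<in> c00 \<Longrightarrow> x - y \<in> c00"
  using c00_add[of x "(-1) *\<^sub>R y"] c00_scaleR[of y "-1"] by simp

lemma restr_c00: "restr {1..} y \<in> c00"
  by (simp add: c00_def keys_restr)

lemma restr_of_c00: "x \<in> c00 \<Longrightarrow> restr {1..} x = x"
  by (rule poly_mapping_eqI) (auto simp: c00_def lookup_restr in_keys_iff subset_iff)

text \<open>It supplies the coordinate functionals on the completion. The value at \<open>u\<close>
  is a limit along one chosen approximating sequence; the inner fact \<open>lim\<close> shows that
  every approximating sequence gives this limit, whence linearity.\<close>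

lemma extend_bounded_functional:
  fixes S :: "(nat \<Rightarrow>\<^sub>0 real) \<Rightarrow> 'a::banach" and g :: "(nat \<Rightarrow>\<^sub>0 real) \<Rightarrow> real"
  assumes S: "linear S" and dense: "closure (S ` c00) = UNIV"
    and g: "linear g" and bound: "\<And>x. x \<in> c00 \<Longrightarrow> \<bar>g x\<bar> \<le> norm (S x)"
  shows "\<exists>e :: 'a \<Rightarrow>\<^sub>L real. \<forall>x\<in>c00. e (S x) = g x"
proof -
  have "\<exists>X. (\<forall>k. X k \<in> c00) \<and> (\<lambda>k. S (X k)) \<longlonglongrightarrow> u" for u
  proof -
    have "u \<in> closure (S ` c00)" using dense by simp
    then obtain w where w: "\<forall>k. w k \<in> S ` c00" "w \<longlonglongrightarrow> u" unfolding closure_sequential by blast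
    have "\<forall>k. \<exists>x. x \<in> c00 \<and> w k = S x" using w(1) by blast
    then obtain X where X: "\<forall>k. X k \<in> c00 \<and> w k = S (X k)" by (rule choice[THEN exE])
    then have "w = (\<lambda>k. S (X k))" by auto
    then show ?thesis using w(2) X by blast
  qed
  then obtain X where X: "\<And>u k. X u k \<in> c00" "\<And>u. (\<lambda>k. S (X u k)) \<longlonglongrightarrow> u" by metis
  define e where "e u = lim (\<lambda>k. g (X u k))" for u
  have g_diff: "\<bar>g x - g y\<bar> \<le> norm (S x - S y)" if "x \<in> c00" "y \<in> c00" for x y
    using bound[OF c00_diff[OF that]] by (simp add: linear_diff[OF S] linear_diff[OF g])
  have lim: "(\<lambda>k. g (x k)) \<longlonglongrightarrow> e u" if x: "\<And>k. x k \<in> c00" "(\<lambda>k. S (x k)) \<longlonglongrightarrow> u" for x u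
  proof -
    have "Cauchy (\<lambda>k. g (X u k))"
    proof (rule CauchyI)
      fix \<epsilon> :: real assume "0 < \<epsilon>"
      have "Cauchy (\<lambda>k. S (X u k))" using X(2) by (auto intro: LIMSEQ_imp_Cauchy)
      then obtain M where "\<forall>m\<ge>M. \<forall>n\<ge>M. norm (S (X u m) - S (X u n)) < \<epsilon>"
        using \<open>0 < \<epsilon>\<close> by (meson CauchyD)
      then show "\<exists>M. \<forall>m\<ge>M. \<forall>n\<ge>M. norm (g (X u m) - g (X u n)) < \<epsilon>"
        using g_diff[OF X(1) X(1)] by (metis le_less_trans real_norm_def)
    qed
    then have "(\<lambda>k. g (X u k)) \<longlonglongrightarrow> e u"
      unfolding e_def using Cauchy_convergent convergent_LIMSEQ_iff by blast
    moreover have "(\<lambda>k. g (x k) - g (X u k)) \<longlonglongrightarrow> 0"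
    proof (rule Lim_null_comparison)
      show "eventually (\<lambda>k. norm (g (x k) - g (X u k)) \<le> norm (S (x k) - S (X u k))) sequentially"
        using g_diff x X by simp
      show "(\<lambda>k. norm (S (x k) - S (X u k))) \<longlonglongrightarrow> 0"
        using tendsto_norm[OF tendsto_diff[OF x(2) X(2)[of u]]] by simp
    qed
    ultimately show ?thesis using tendsto_add by fastforce
  qed
  have "bounded_linear e"
  proof (rule bounded_linear_intro)
    fix u v :: 'a and r :: real
    have "(\<lambda>k. g (X u k + X v k)) \<longlonglongrightarrow> e (u + v)"
      using X by (intro lim c00_add) (simp_all add: linear_add[OF S] tendsto_add)
    moreover have "(\<lambda>k. g (X u k + X v k)) \<longlonglongrightarrow> e u + e v"
      using X by (simp add: linear_add[OF g]) (intro tendsto_add lim; simp)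
    ultimately show "e (u + v) = e u + e v" by (rule LIMSEQ_unique)
    have "(\<lambda>k. g (r *\<^sub>R X u k)) \<longlonglongrightarrow> e (r *\<^sub>R u)"
      using X by (intro lim c00_scaleR) (simp_all add: linear_scale[OF S] tendsto_scaleR)
    moreover have "(\<lambda>k. g (r *\<^sub>R X u k)) \<longlonglongrightarrow> r *\<^sub>R e u"
      using X by (simp only: linear_scale[OF g]) (intro tendsto_scaleR tendsto_const lim; simp)
    ultimately show "e (r *\<^sub>R u) = r *\<^sub>R e u" by (rule LIMSEQ_unique)
    have "norm (e u) \<le> norm u"
    proof (rule LIMSEQ_le)
      show "(\<lambda>k. norm (g (X u k))) \<longlonglongrightarrow> norm (e u)" using X by (intro tendsto_norm lim)
      show "(\<lambda>k. norm (S (X u k))) \<longlonglongrightarrow> norm u" using X by (intro tendsto_norm)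
    qed (use bound X in auto)
    then show "norm (e u) \<le> norm u * 1" by simp
  qed
  moreover have "e (S x) = g x" if "x \<in> c00" for x
    using lim[of "\<lambda>_. x" "S x"] that by (simp add: LIMSEQ_const_iff)
  ultimately show ?thesis
    by (intro exI[of _ "Blinfun e"]) (simp add: bounded_linear_Blinfun_apply)
qed

lemma norm_blinfun_le_of_dense:
  fixes h :: "'a::real_normed_vector \<Rightarrow>\<^sub>L real"
  assumes "closure A = UNIV" "\<And>u. u \<in> A \<Longrightarrow> \<bar>h u\<bar> \<le> K * norm u" "0 \<le> K"
  shows "norm h \<le> K"
proof -
  have "closed {u. norm (h u) \<le> K * norm u}"
    by (intro closed_Collect_le continuous_intros)
  then have "closure A \<subseteq> {u. norm (h u) \<le> K * norm u}"
    using assms(2) by (intro closure_minimal) auto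
  then show ?thesis using assms(1,3) by (intro norm_blinfun_bound) auto
qed

context special_norm begin

text \<open>For \<open>F\<close> in the bidual, the values on the coordinate functionals are the
  coefficients of a formal series. Its partial sums are bounded by \<open>norm F\<close>, so it
  converges to some \<open>u\<close> by bounded completeness. Then \<open>F\<close> and
  \<open>u\<close> agree on finite combinations of coordinate functionals, and by the shrinking
  property these approximate every \<open>f\<close> in norm.\<close>

theorem reflexive_completion:
  fixes T :: "(nat \<Rightarrow>\<^sub>0 real) \<Rightarrow> 'a::banach"
  assumes T: "completion_of_c00 N T"
  shows "reflexive_space TYPE('a)"
proof -
  \<comment> \<open>The map \<open>T\<close> is constrained only on \<open>c00\<close>; deleting
    coordinate 0 first gives a map that is linear on the whole type.\<close>
  define S where "S y = T (restr {1..} y)" for y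
  have S_T: "S x = T x" if "x \<in> c00" for x unfolding S_def restr_of_c00[OF that] ..
  have S: "linear S"
    using T restr_c00 unfolding completion_of_c00_def S_def
    by (intro linearI) (simp_all add: restr_add restr_scaleR)
  have norm_S: "norm (S y) = N y" if "y \<in> c00" for y
    using T that by (simp add: S_T completion_of_c00_def)
  have norm_S_le: "norm (S y) \<le> N y" for y
  proof -
    have "norm (S y) = N (restr {1..} y)" using T restr_c00 by (simp add: S_def completion_of_c00_def)
    then show ?thesis using N_restr_le[of "{1..}" y] by (simp add: interval_def)
  qed
  have dense: "closure (S ` c00) = UNIV"
    using T S_T by (simp add: completion_of_c00_def)
  have lookup_le: "\<bar>Poly_Mapping.lookup x n\<bar> \<le> N x" if "x \<in> c00" for x n
    using abs_lookup_le_N[of n x] N_nonneg[of x] that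
    by (cases "Poly_Mapping.lookup x n = 0") (auto simp: c00_def in_keys_iff subset_iff)
  have "\<exists>e :: 'a \<Rightarrow>\<^sub>L real. \<forall>x\<in>c00. e (S x) = Poly_Mapping.lookup x n" for n
    using lookup_le norm_S
    by (intro extend_bounded_functional[OF S dense] linearI) (simp_all add: lookup_add lookup_scaleR_real)
  then obtain e :: "nat \<Rightarrow> 'a \<Rightarrow>\<^sub>L real"
    where e: "\<And>n x. x \<in> c00 \<Longrightarrow> e n (S x) = Poly_Mapping.lookup x n" by metis
  have "\<exists>u. bidual_embedding u = F" for F :: "('a \<Rightarrow>\<^sub>L real) \<Rightarrow>\<^sub>L real"
  proof -
    define c where "c n = F (e n)" for n
    \<comment> \<open>A finitely supported functional dominated by \<open>N\<close> becomes an
      element of the dual unit ball of the completion, to which \<open>F\<close> can be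
      applied.\<close>
    have pairing_c: "\<bar>\<Sum>n\<in>Poly_Mapping.keys g. Poly_Mapping.lookup g n * c n\<bar> \<le> norm F"
      if g: "\<And>x. x \<in> c00 \<Longrightarrow> \<bar>pairing g x\<bar> \<le> N x" for g
    proof -
      let ?g = "\<Sum>n\<in>Poly_Mapping.keys g. Poly_Mapping.lookup g n *\<^sub>R e n"
      have "?g (S x) = pairing g x" if "x \<in> c00" for x
        using that by (simp add: blinfun.sum_left blinfun.scaleR_left e pairing_def)
      then have "norm ?g \<le> 1"
        using g norm_S by (intro norm_blinfun_le_of_dense[OF dense]) auto
      then have "norm F * norm ?g \<le> norm F * 1" by (intro mult_left_mono) auto
      moreover have "F ?g = (\<Sum>n\<in>Poly_Mapping.keys g. Poly_Mapping.lookup g n * c n)"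
        by (simp add: blinfun.sum_right blinfun.scaleR_right c_def)
      ultimately show ?thesis using norm_blinfun[of F ?g] by simp
    qed
    have "N (partial_sum c M) \<le> norm F" for M
    proof (rule N_leI)
      show "\<bar>Poly_Mapping.lookup (partial_sum c M) n\<bar> \<le> norm F" for n
        using pairing_c[of "Poly_Mapping.single n 1"] lookup_le
        by (simp add: pairing_single lookup_partial_sum)
    next
      fix \<psi> J s assume \<psi>: "l2_comb \<psi> J s" "s \<le> 1"
      let ?g = "restr {1..M} \<psi>"
      have "interval {1..M}" by (auto simp: interval_def)
      then obtain J' where J': "l2_comb ?g J' s" using l2_comb_restr[OF _ \<psi>(1)] by blast
      have "pairing \<psi> (partial_sum c M) = pairing ?g (partial_sum c M)"
        unfolding pairing_restr
        by (rule arg_cong[of _ _ "pairing \<psi>"], rule poly_mapping_eqI)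
          (simp add: lookup_restr lookup_partial_sum)
      also have "\<dots> = (\<Sum>n\<in>Poly_Mapping.keys ?g. Poly_Mapping.lookup ?g n * c n)"
        unfolding pairing_def by (intro sum.cong) (auto simp: keys_restr lookup_partial_sum)
      also have "\<dots> \<le> norm F"
        using pairing_c[of ?g] abs_l2_comb_le_N[OF J' \<psi>(2)] by simp
      finally show "pairing \<psi> (partial_sum c M) \<le> norm F" .
    qed
    note complete = boundedly_complete[OF this]
    have "Cauchy (\<lambda>M. S (partial_sum c M))"
    proof (rule CauchyI')
      fix \<epsilon> :: real assume "0 < \<epsilon>"
      then obtain M0 where M0: "\<forall>k M. M0 \<le> k \<longrightarrow> k \<le> M \<longrightarrow> N (partial_sum c M - partial_sum c k) \<le> \<epsilon> / 2"
        using complete[of "\<epsilon> / 2"] by auto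
      have "dist (S (partial_sum c m)) (S (partial_sum c n)) < \<epsilon>" if "M0 \<le> m" "m < n" for m n
      proof -
        have "norm (S (partial_sum c n - partial_sum c m)) \<le> \<epsilon> / 2"
          using norm_S_le M0 that by (meson less_imp_le order_trans)
        then show ?thesis
          using \<open>0 < \<epsilon>\<close> by (simp add: linear_diff[OF S] dist_norm norm_minus_commute)
      qed
      then show "\<exists>M. \<forall>m\<ge>M. \<forall>n>m. dist (S (partial_sum c m)) (S (partial_sum c n)) < \<epsilon>" by blast
    qed
    then obtain u where u: "(\<lambda>M. S (partial_sum c M)) \<longlonglongrightarrow> u"
      using Cauchy_convergent convergent_def by blast
    have "f u = F f" for f :: "'a \<Rightarrow>\<^sub>L real"
    proof -
      define a where "a n = f (S (Poly_Mapping.single n 1))" for n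
      \<comment> \<open>These are the initial segments of \<open>f\<close>; on \<open>S x\<close>
        the difference from \<open>f\<close> is, up to sign, the value of \<open>f\<close> on the
        part of \<open>x\<close> beyond \<open>M\<close>, which \<open>shrinking\<close>
        controls.\<close>
      define fM where "fM M = (\<Sum>n=1..M. a n *\<^sub>R e n)" for M
      have initial_sum: "f (S (partial_sum b M)) = (\<Sum>n=1..M. a n * b n)" for b M
      proof -
        have "partial_sum b M = (\<Sum>n=1..M. b n *\<^sub>R Poly_Mapping.single n 1)"
          unfolding partial_sum_def
          by (intro sum.cong refl poly_mapping_eqI) (simp add: lookup_scaleR_real lookup_single when_def)
        then show ?thesis
          by (simp add: linear_sum[OF S] linear_scale[OF S] blinfun.sum_right blinfun.scaleR_right
              a_def mult.commute)
      qed
      have "fM \<longlonglongrightarrow> f"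
      proof (rule LIMSEQ_I)
        fix \<epsilon> :: real assume "0 < \<epsilon>"
        have "linear (\<lambda>y. f (S y))"
          using S by (intro linearI) (simp_all add: linear_add linear_scale blinfun.add_right blinfun.scaleR_right)
        moreover have "\<bar>f (S y)\<bar> \<le> norm f * N y" for y
          using norm_blinfun[of f "S y"] norm_S_le[of y] mult_left_mono[of "norm (S y)" "N y" "norm f"]
          by simp
        ultimately obtain n0 where n0:
          "\<forall>y. Poly_Mapping.keys y \<subseteq> {n0<..} \<longrightarrow> \<bar>f (S y)\<bar> \<le> \<epsilon> / 2 * N y"
          using shrinking[of "\<lambda>y. f (S y)" "norm f" "\<epsilon> / 2"] \<open>0 < \<epsilon>\<close> by auto
        have "norm (fM M - f) \<le> \<epsilon> / 2" if "n0 \<le> M" for M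
        proof (rule norm_blinfun_le_of_dense[OF dense])
          fix v assume "v \<in> S ` c00"
          then obtain x where x: "x \<in> c00" "v = S x" by blast
          let ?x = "restr {M<..} x"
          have "x = partial_sum (Poly_Mapping.lookup x) M + ?x"
            using x(1) by (intro poly_mapping_eqI)
              (auto simp: lookup_add lookup_partial_sum lookup_restr c00_def in_keys_iff subset_iff)
          then have "f v = f (S (partial_sum (Poly_Mapping.lookup x) M)) + f (S ?x)"
            unfolding x(2) by (metis linear_add[OF S] blinfun.add_right)
          moreover have "fM M v = (\<Sum>n=1..M. a n * Poly_Mapping.lookup x n)"
            using x by (simp add: fM_def blinfun.sum_left blinfun.scaleR_left e)
          ultimately have "\<bar>(fM M - f) v\<bar> = \<bar>f (S ?x)\<bar>"
            by (simp add: blinfun.diff_left initial_sum)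
          also have "\<dots> \<le> \<epsilon> / 2 * N ?x"
          proof -
            have "Poly_Mapping.keys ?x \<subseteq> {n0<..}" using that by (auto simp: keys_restr)
            then show ?thesis using n0 by blast
          qed
          also have "\<dots> \<le> \<epsilon> / 2 * N x"
            using \<open>0 < \<epsilon>\<close> by (intro mult_left_mono N_restr_le) (auto simp: interval_def)
          finally show "\<bar>(fM M - f) v\<bar> \<le> \<epsilon> / 2 * norm v" using x norm_S by simp
        qed (use \<open>0 < \<epsilon>\<close> in simp)
        then show "\<exists>no. \<forall>n\<ge>no. norm (fM n - f) < \<epsilon>" using \<open>0 < \<epsilon>\<close>
          by (intro exI[of _ n0]) fastforce
      qed
      then have "(\<lambda>M. F (fM M)) \<longlonglongrightarrow> F f" by (intro tendsto_intros)
      moreover have "F (fM M) = f (S (partial_sum c M))" for M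
        by (simp add: initial_sum fM_def blinfun.sum_right blinfun.scaleR_right c_def)
      moreover have "(\<lambda>M. f (S (partial_sum c M))) \<longlonglongrightarrow> f u" using u by (intro tendsto_intros)
      ultimately show ?thesis using LIMSEQ_unique by auto
    qed
    then have "bidual_embedding u = F"
      by (intro blinfun_eqI) (simp add: bidual_embedding.rep_eq)
    then show ?thesis by blast
  qed
  then show ?thesis unfolding reflexive_space_def surj_def by metis
qed

end

theorem theorem5p6:
  fixes \<xi> :: countable_ordinal
    and fs :: "countable_ordinal \<Rightarrow> nat \<Rightarrow> countable_ordinal"
    and M1 M2 :: "nat set"
    and \<sigma> :: "(nat \<Rightarrow>\<^sub>0 real) list \<Rightarrow> nat"
    and T :: "(nat \<Rightarrow>\<^sub>0 real) \<Rightarrow> 'a::banach"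
  assumes "fundamental_sequences fs"
    and "partition_of_naturals M1 M2"
    and "coding_function M2 \<sigma>"
    and "completion_of_c00 (norm_G (G_xi fs M1 \<sigma> \<xi>)) T"
  shows "reflexive_space TYPE('a)"
proof -
  interpret special_norm fs M1 M2 \<sigma> \<xi>
    using assms(1-3) by unfold_locales
  show ?thesis using assms(4) by (rule reflexive_completion)
qed

end
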